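(* Let $p$ be a prime and $m \geq 1$. Let $\mathcal{A}_m$ denote the subset of $\mathcal{M}_{p^m}(\overline{\mathbb{F}}_p)$ consisting of all linear conjugacy classes which have a representative that is an additive, separable polynomial. Then $\dim_{\overline{\mathbb{F}}_p}(\mathcal{A}_m) = m$.
   Context: $\mathcal{M}_d(\overline{\mathbb{F}}_p)$ denotes the moduli space of dynamical systems of degree $d$: its points are equivalence classes of rational maps $f \in \overline{\mathbb{F}}_p(z)$ of degree $d$ under linear conjugacy, where $f$ and $g$ are linearly conjugate if $g = \alpha \circ f \circ \alpha^{-1}$ for some $\alpha \in \mathrm{PGL}_2(\overline{\mathbb{F}}_p)$. A polynomial $f \in \overline{\mathbb{F}}_p[z]$ is additive if $f(x+y) = f(x) + f(y)$; equivalently $f(z) = \sum_{i=0}^m a_i z^{p^i}$ with $a_i \in \overline{\mathbb{F}}_p$. It is separable iff $f'(z) = a_0 \neq 0$. *)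

theory Defs
  imports
    "HOL-Computational_Algebra.Polynomial_Factorial"
    "HOL-Library.Poly_Mapping"
    "HOL-Library.Extended_Nat"
    "HOL-Analysis.Abstract_Topology"
begin

section \<open>Rational maps and linear conjugacy\<close>

text \<open>A rational map is an element of the function field \<open>k(z)\<close>, represented as \<^typ>\<open>'k poly fract\<close>.
  The function \<^const>\<open>quot_of_fract\<close> returns its numerator and denominator in lowest terms
  (with monic denominator).\<close>

definition rat_num :: "'k::{alg_closed_field,field_gcd} poly fract \<Rightarrow> 'k poly" where
  "rat_num f = fst (quot_of_fract f)"

definition rat_den :: "'k::{alg_closed_field,field_gcd} poly fract \<Rightarrow> 'k poly" where
  "rat_den f = snd (quot_of_fract f)"

definition rat_degree :: "'k::{alg_closed_field,field_gcd} poly fract \<Rightarrow> nat" where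
  "rat_degree f = max (degree (rat_num f)) (degree (rat_den f))"

definition rat_maps :: "nat \<Rightarrow> 'k::{alg_closed_field,field_gcd} poly fract set" where
  "rat_maps d = {f. rat_degree f = d}"

text \<open>The value \<open>P(g)\<close> of a polynomial \<open>P\<close> over \<open>k\<close> at an element \<open>g\<close> of \<open>k(z)\<close>.\<close>

definition poly_at_rat :: "'k::{alg_closed_field,field_gcd} poly \<Rightarrow> 'k poly fract \<Rightarrow> 'k poly fract" where
  "poly_at_rat P g = poly (map_poly (\<lambda>c. to_fract [:c:]) P) g"

text \<open>Composition of rational maps. The denominator can only vanish if \<open>g\<close> is constant.\<close>

definition rat_comp ::
    "'k::{alg_closed_field,field_gcd} poly fract \<Rightarrow> 'k poly fract \<Rightarrow> 'k poly fract" where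
  "rat_comp f g = poly_at_rat (rat_num f) g / poly_at_rat (rat_den f) g"

text \<open>The map \<open>z \<mapsto> (a z + b) / (c z + d)\<close>.\<close>

definition moebius_rat ::
    "'k::{alg_closed_field,field_gcd} \<Rightarrow> 'k \<Rightarrow> 'k \<Rightarrow> 'k \<Rightarrow> 'k poly fract" where
  "moebius_rat a b c d = Fract [:b, a:] [:d, c:]"

text \<open>\<open>g = \<alpha> \<circ> f \<circ> \<alpha>\<inverse>\<close> for some \<open>\<alpha>\<close> in \<open>PGL\<^sub>2(k)\<close>; the inverse of \<open>\<alpha>\<close> is given by the adjugate
  matrix.\<close>

definition lin_conjugate ::
    "'k::{alg_closed_field,field_gcd} poly fract \<Rightarrow> 'k poly fract \<Rightarrow> bool" where
  "lin_conjugate f g \<longleftrightarrow>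
     (\<exists>a b c d. a * d - b * c \<noteq> 0 \<and>
        g = rat_comp (rat_comp (moebius_rat a b c d) f) (moebius_rat d (- b) (- c) a))"

definition conj_rel :: "nat \<Rightarrow> 'k::{alg_closed_field,field_gcd} poly fract rel" where
  "conj_rel d = {(f, g). f \<in> rat_maps d \<and> g \<in> rat_maps d \<and> lin_conjugate f g}"

definition moduli :: "nat \<Rightarrow> 'k::{alg_closed_field,field_gcd} poly fract set set" where
  "moduli d = rat_maps d // conj_rel d"


section \<open>The Zariski topology\<close>

text \<open>Multivariate polynomials over \<open>k\<close> are finitely supported maps from monomials (finitely
  supported exponent vectors) to coefficients.\<close>

type_synonym 'k multipoly = "(nat \<Rightarrow>\<^sub>0 nat) \<Rightarrow>\<^sub>0 'k"

definition multipoly_eval :: "'k::comm_semiring_1 multipoly \<Rightarrow> (nat \<Rightarrow> 'k) \<Rightarrow> 'k" where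
  "multipoly_eval P x =
     (\<Sum>\<mu>\<in>Poly_Mapping.keys P. Poly_Mapping.lookup P \<mu> *
        (\<Prod>i\<in>Poly_Mapping.keys \<mu>. x i ^ Poly_Mapping.lookup \<mu> i))"

text \<open>Homogeneous of degree \<open>n\<close> in the variables with index below \<open>N\<close>.\<close>

definition homogeneous_multipoly :: "nat \<Rightarrow> nat \<Rightarrow> 'k::comm_semiring_1 multipoly \<Rightarrow> bool" where
  "homogeneous_multipoly N n P \<longleftrightarrow>
     (\<forall>\<mu>\<in>Poly_Mapping.keys P. Poly_Mapping.keys \<mu> \<subseteq> {..<N} \<and>
        (\<Sum>i\<in>Poly_Mapping.keys \<mu>. Poly_Mapping.lookup \<mu> i) = n)"

text \<open>Homogeneous coordinates of the point of \<open>\<P>\<^bsup>2d+1\<^esup>\<close> given by the coefficients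
  \<open>[a\<^sub>0 : \<dots> : a\<^sub>d : b\<^sub>0 : \<dots> : b\<^sub>d]\<close> of numerator and denominator. This embeds the rational maps
  of degree \<open>d\<close> as the complement of the resultant hypersurface. Non-vanishing of a homogeneous
  polynomial does not depend on the scaling, so the choice made by \<^const>\<open>quot_of_fract\<close> is
  immaterial.\<close>

definition rat_coords :: "nat \<Rightarrow> 'k::{alg_closed_field,field_gcd} poly fract \<Rightarrow> nat \<Rightarrow> 'k" where
  "rat_coords d f i = (if i \<le> d then coeff (rat_num f) i else coeff (rat_den f) (i - (d + 1)))"

definition rat_topology :: "nat \<Rightarrow> 'k::{alg_closed_field,field_gcd} poly fract topology" where
  "rat_topology d = topology_generated_by
     {{f \<in> rat_maps d. multipoly_eval P (rat_coords d f) \<noteq> 0} | P n.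
        homogeneous_multipoly (2 * d + 2) n P}"

text \<open>For \<open>d \<ge> 2\<close> the moduli space is a geometric quotient of the space of rational maps of degree \<open>d\<close>
  by the conjugation action, so its Zariski topology is the quotient topology.\<close>

definition moduli_topology :: "nat \<Rightarrow> 'k::{alg_closed_field,field_gcd} poly fract set topology" where
  "moduli_topology d = topology
     (\<lambda>U. U \<subseteq> moduli d \<and> openin (rat_topology d) {f \<in> rat_maps d. conj_rel d `` {f} \<in> U})"

lemma topspace_rat_topology [simp]:
  "topspace (rat_topology d :: 'k::{alg_closed_field,field_gcd} poly fract topology) = rat_maps d"
proof -
  have "homogeneous_multipoly (2 * d + 2) 0 (1 :: 'k multipoly)"
    by (simp add: homogeneous_multipoly_def)
  moreover have "multipoly_eval (1 :: 'k multipoly) x \<noteq> 0" for x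
    by (simp add: multipoly_eval_def)
  ultimately have "rat_maps d \<in> {{f \<in> rat_maps d. multipoly_eval P (rat_coords d f) \<noteq> (0::'k)} | P n.
        homogeneous_multipoly (2 * d + 2) n P}"
    by (intro CollectI exI[of _ 1] exI[of _ 0]) auto
  then show ?thesis
    unfolding rat_topology_def topology_generated_by_topspace by blast
qed

lemma openin_moduli_topology:
  "openin (moduli_topology d) U \<longleftrightarrow>
     U \<subseteq> moduli d \<and> openin (rat_topology d) {f \<in> rat_maps d. conj_rel d `` {f} \<in> U}"
proof -
  let ?T = "rat_topology d :: 'a poly fract topology"
  let ?pre = "\<lambda>U. {f \<in> rat_maps d. conj_rel d `` {f} \<in> U}"
  have "istopology (\<lambda>U. U \<subseteq> moduli d \<and> openin ?T (?pre U))"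
    unfolding istopology_def
  proof (intro conjI allI impI)
    fix S T assume *: "S \<subseteq> moduli d \<and> openin ?T (?pre S)" "T \<subseteq> moduli d \<and> openin ?T (?pre T)"
    have "?pre (S \<inter> T) = ?pre S \<inter> ?pre T"
      by blast
    then show "openin ?T (?pre (S \<inter> T))"
      using * by (simp only: openin_Int)
    show "S \<inter> T \<subseteq> moduli d"
      using * by blast
  next
    fix \<K> assume *: "\<forall>K\<in>\<K>. K \<subseteq> moduli d \<and> openin ?T (?pre K)"
    have "?pre (\<Union>\<K>) = \<Union>(?pre ` \<K>)"
      by blast
    then show "openin ?T (?pre (\<Union>\<K>))"
      using * by (metis (no_types, lifting) imageE openin_Union)
    show "\<Union>\<K> \<subseteq> moduli d"
      using * by blast
  qed
  then show ?thesis
    unfolding moduli_topology_def by simp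
qed

lemma topspace_moduli_topology [simp]:
  "topspace (moduli_topology d :: 'k::{alg_closed_field,field_gcd} poly fract set topology) = moduli d"
proof -
  have "{f \<in> rat_maps d :: 'k poly fract set. conj_rel d `` {f} \<in> moduli d} = rat_maps d"
    by (auto simp: moduli_def quotient_def)
  moreover have "openin (rat_topology d) (rat_maps d :: 'k poly fract set)"
    by (metis openin_topspace topspace_rat_topology)
  ultimately have "openin (moduli_topology d) (moduli d :: 'k poly fract set set)"
    unfolding openin_moduli_topology by simp
  moreover have "topspace (moduli_topology d) \<subseteq> (moduli d :: 'k poly fract set set)"
    using openin_topspace[of "moduli_topology d :: 'k poly fract set topology"] unfolding openin_moduli_topology by blast
  ultimately show ?thesis
    by (meson openin_subset subset_antisym)
qed

lemma quotient_map_moduli: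
  "quotient_map (rat_topology d) (moduli_topology d) (\<lambda>f. conj_rel d `` {f})"
  unfolding quotient_map_def by (auto simp: openin_moduli_topology moduli_def quotient_def)


section \<open>Krull dimension\<close>

definition irreducible_in :: "'a topology \<Rightarrow> 'a set \<Rightarrow> bool" where
  "irreducible_in X S \<longleftrightarrow> S \<subseteq> topspace X \<and> S \<noteq> {} \<and>
     (\<forall>A B. closedin X A \<and> closedin X B \<and> S \<subseteq> A \<union> B \<longrightarrow> S \<subseteq> A \<or> S \<subseteq> B)"

text \<open>The supremum of the lengths of chains \<open>Z\<^sub>0 \<subset> \<dots> \<subset> Z\<^sub>n\<close> of irreducible closed subsets.
  In \<^typ>\<open>enat\<close>, the empty space gets dimension 0.\<close>

definition krull_dim :: "'a topology \<Rightarrow> enat" where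
  "krull_dim X = Sup {enat n | n. \<exists>Z :: nat \<Rightarrow> 'a set.
     (\<forall>i\<le>n. closedin X (Z i) \<and> irreducible_in X (Z i)) \<and> (\<forall>i<n. Z i \<subset> Z (Suc i))}"


section \<open>Additive separable polynomials\<close>

text \<open>Over an infinite field, the identity \<open>f(x + y) = f(x) + f(y)\<close> for all values is the same as the
  polynomial identity.\<close>

definition additive_poly :: "'k::alg_closed_field poly \<Rightarrow> bool" where
  "additive_poly f \<longleftrightarrow> (\<forall>x y. poly f (x + y) = poly f x + poly f y)"

definition separable_poly :: "'k::alg_closed_field poly \<Rightarrow> bool" where
  "separable_poly f \<longleftrightarrow> coprime f (pderiv f)"

definition additive_separable_classes ::
    "nat \<Rightarrow> 'k::{alg_closed_field,field_gcd} poly fract set set" where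
  "additive_separable_classes d =
     {C \<in> moduli d. \<exists>f. additive_poly f \<and> separable_poly f \<and> to_fract f \<in> C}"


section \<open>Elements algebraic over the prime field\<close>

text \<open>In positive characteristic \<^term>\<open>\<int>\<close>, the image of the integers, is the prime field.\<close>

definition algebraic_over_prime_field :: "'k::field \<Rightarrow> bool" where
  "algebraic_over_prime_field x \<longleftrightarrow> (\<exists>q. q \<noteq> 0 \<and> (\<forall>i. coeff q i \<in> \<int>) \<and> poly q x = 0)"

end

(* On the additive separable polynomials f = sum a_i z^(p^i), conjugation by z -> c z acts on the
   coefficients with weights p^i - 1, and there are no further identifications. If a rational map
   P/Q of degree p^m is conjugate to such an f, the terms a_i z^(p^i) with i > 0 do not contribute to
   the coefficients u, v of z in P and Q; hence (u : v) is the image of the totally ramified fixed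
   point of f, and the matrix (u, 0; -v, u), whose entries are linear in the coordinates of P/Q, turns
   P/Q back into an additive polynomial up to an affine change of variable. Substituting the
   normalised coefficients into a weighted homogeneous polynomial and clearing denominators shows that
   every zero set of weighted homogeneous polynomials in the a_i is closed among the classes. So the
   space of classes is the quotient of {a_0 a_m # 0} by the weighted torus action.

   Upper bound: along a strict chain of irreducible closed sets, weight zero functions separating
   consecutive members are algebraically independent; on the slice a_m = 1 they are polynomials in m
   variables, so there are at most m of them. Lower bound: the linear sections a_j = ... = a_(m-1) = 0
   are irreducible. *)

theory Submission
  imports Defs
begin

text \<open>The coefficient of z is the derivative at 0. For j > 0 both p^j and p^m - p^j are
  multiples of p, so a product of linear forms with these exponents has derivative zero; this is why
  only a_0 is visible in u and v. The obstacle is that closedness of a set of classes is decided by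
  polynomials in the coordinates of all rational maps of degree p^m, whereas the matrix that
  conjugates a given map to an additive polynomial is unknown. Reading a matrix off from u and v
  keeps the whole construction polynomial. It breaks down only where u = 0, that is, where the
  ramified fixed point is 0. A factor u discards these maps, and no class is lost, since u = a_0 is
  nonzero at the additive representative. In the other direction, a polynomial restricted to a torus
  orbit is a polynomial in the scaling parameter c, so vanishing on orbits passes to each weighted
  component. A component P of weight n yields the weight zero function P^w / a_m^n with w = p^m - 1.
  The linear sections alone are one set short of a chain of length m. The missing bottom member is
  the single class with a_0 = 1 and a_1 = ... = a_(m-1) = 0, which is closed because a_0 has weight
  0.\<close>

section \<open>Polynomial functions\<close>

text \<open>Polynomials enter only through the functions they define. The set \<open>I\<close> of
  admissible exponents lets one predicate serve for arbitrary, bounded degree, homogeneous and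
  weighted homogeneous polynomials, and additive statements have to be checked on monomials
  only.\<close>

inductive monomial_span ::
    "nat \<Rightarrow> (nat \<Rightarrow> nat) set \<Rightarrow> ((nat \<Rightarrow> 'k::comm_ring_1) \<Rightarrow> 'k) \<Rightarrow> bool" for N I where
  zero: "monomial_span N I (\<lambda>x. 0)"
| mono: "e \<in> I \<Longrightarrow> monomial_span N I (\<lambda>x. c * (\<Prod>i<N. x i ^ e i))"
| add: "monomial_span N I f \<Longrightarrow> monomial_span N I g \<Longrightarrow> monomial_span N I (\<lambda>x. f x + g x)"

lemma monomial_span_mono:
  "monomial_span N I f \<Longrightarrow> I \<subseteq> J \<Longrightarrow> monomial_span N J f"
  by (induction rule: monomial_span.induct) (auto intro: monomial_span.intros)

lemma monomial_span_mult:
  assumes f: "monomial_span N I f" and g: "monomial_span N J g"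
    and IJ: "\<And>e e'. e \<in> I \<Longrightarrow> e' \<in> J \<Longrightarrow> (\<lambda>i. e i + e' i) \<in> K"
  shows "monomial_span N K (\<lambda>x. f x * g x)"
  using f
proof (induction rule: monomial_span.induct)
  case zero
  then show ?case by (simp add: monomial_span.zero)
next
  case (mono e c)
  from g show ?case
  proof (induction rule: monomial_span.induct)
    case zero
    then show ?case by (simp add: monomial_span.zero)
  next
    case (mono e' c')
    have "monomial_span N K (\<lambda>x. (c * c') * (\<Prod>i<N. x i ^ (e i + e' i)))"
      using monomial_span.mono[OF IJ[OF \<open>e \<in> I\<close> \<open>e' \<in> J\<close>]] .
    then show ?case
      by (simp add: power_add prod.distrib mult_ac)
  next
    case (add f g)
    then show ?case by (simp add: distrib_left monomial_span.add)
  qed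
next
  case (add f g)
  then show ?case by (simp add: distrib_right monomial_span.add)
qed

lemma monomial_span_sum:
  assumes "\<And>s. s \<in> S \<Longrightarrow> monomial_span N I (f s)"
  shows "monomial_span N I (\<lambda>x. \<Sum>s\<in>S. f s x)"
  using assms
  by (induction S rule: infinite_finite_induct) (auto intro: monomial_span.intros)

abbreviation poly_fun :: "nat \<Rightarrow> ((nat \<Rightarrow> 'k::comm_ring_1) \<Rightarrow> 'k) \<Rightarrow> bool" where
  "poly_fun N \<equiv> monomial_span N UNIV"

lemma poly_fun_const: "poly_fun N (\<lambda>x. c)"
  using monomial_span.mono[of "\<lambda>_. 0" UNIV N c] by simp

lemma prod_power_single:
  fixes j :: nat
  assumes "j < N"
  shows "(\<Prod>i<N. (x i :: 'k::comm_ring_1) ^ (if i = j then n else 0)) = x j ^ n"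
proof -
  have "(\<Prod>i<N. x i ^ (if i = j then n else 0)) = (\<Prod>i<N. if i = j then x j ^ n else 1)"
    by (rule prod.cong) auto
  also have "\<dots> = x j ^ n"
    by (subst prod.delta) (use assms in auto)
  finally show ?thesis .
qed

lemma monomial_span_var:
  assumes "j < N" "(\<lambda>i. if i = j then 1 else 0) \<in> I"
  shows "monomial_span N I (\<lambda>x. x j)"
  using monomial_span.mono[OF assms(2), of N 1]
  unfolding prod_power_single[OF assms(1)] by simp

lemma poly_fun_var: "j < N \<Longrightarrow> poly_fun N (\<lambda>x. x j)"
  by (rule monomial_span_var) auto

lemma poly_fun_mult: "poly_fun N f \<Longrightarrow> poly_fun N g \<Longrightarrow> poly_fun N (\<lambda>x. f x * g x)"
  by (rule monomial_span_mult) auto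

lemma poly_fun_power: "poly_fun N f \<Longrightarrow> poly_fun N (\<lambda>x. f x ^ n)"
  by (induction n) (auto intro: poly_fun_mult poly_fun_const)

lemma poly_fun_prod:
  assumes "\<And>s. s \<in> S \<Longrightarrow> poly_fun N (f s)"
  shows "poly_fun N (\<lambda>x. \<Prod>s\<in>S. f s x)"
  using assms
  by (induction S rule: infinite_finite_induct) (auto intro: poly_fun_mult poly_fun_const)

lemma poly_fun_subst:
  assumes "poly_fun N f" "\<And>i. i < N \<Longrightarrow> poly_fun M (\<lambda>x. s x i)"
  shows "poly_fun M (\<lambda>x. f (s x))"
  using assms(1)
proof (induction rule: monomial_span.induct)
  case (mono e c)
  then show ?case
    by (intro poly_fun_mult poly_fun_const poly_fun_prod poly_fun_power assms(2)) auto
qed (auto intro: monomial_span.intros)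

lemma poly_fun_cong:
  assumes "poly_fun N f" "\<And>i. i < N \<Longrightarrow> x i = y i"
  shows "f x = f y"
  using assms(1) by (induction rule: monomial_span.induct) (auto simp: assms(2))

text \<open>Irreducibility of linear sections is tested along lines, where it reduces to the absence
  of zero divisors among polynomials in one variable.\<close>

lemma poly_fun_line:
  fixes f :: "(nat \<Rightarrow> 'k::comm_ring_1) \<Rightarrow> 'k"
  assumes "poly_fun N f"
  shows "\<exists>q. \<forall>t. poly q t = f (\<lambda>i. a i + t * b i)"
  using assms
proof (induction rule: monomial_span.induct)
  case zero
  then show ?case by (metis poly_0)
next
  case (mono e c)
  show ?case
    by (rule exI[of _ "[:c:] * (\<Prod>i<N. [:a i, b i:] ^ e i)"]) (simp add: poly_prod poly_power)
next
  case (add f g)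
  then obtain q r where "\<forall>t. poly q t = f (\<lambda>i. a i + t * b i)" "\<forall>t. poly r t = g (\<lambda>i. a i + t * b i)"
    by blast
  then show ?case by (intro exI[of _ "q + r"]) simp
qed

lemma monomial_span_homogeneous:
  fixes f :: "(nat \<Rightarrow> 'k::comm_ring_1) \<Rightarrow> 'k"
  assumes "monomial_span N {e. (\<Sum>i<N. e i * w i) = n} f"
  shows "f (\<lambda>i. c ^ w i * x i) = c ^ n * f x"
  using assms
proof (induction rule: monomial_span.induct)
  case (mono e c')
  then have "(\<Prod>i<N. (c ^ w i * x i) ^ e i) = c ^ n * (\<Prod>i<N. x i ^ e i)"
    by (auto simp: power_mult_distrib prod.distrib power_sum mult.commute simp flip: power_mult)
  then show ?case by (simp add: mult_ac)
qed (auto simp: algebra_simps)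

text \<open>Scaling by \<open>c\<close> multiplies the component \<open>F j\<close> by
  \<open>c ^ j\<close>, so a function vanishing on orbits can be treated weight by weight. That
  \<open>F j\<close> vanishes from \<open>n\<close> on allows two decompositions of different
  lengths to be padded and added.\<close>

lemma poly_fun_weight_decomposition:
  fixes f :: "(nat \<Rightarrow> 'k::comm_ring_1) \<Rightarrow> 'k"
  assumes "poly_fun N f"
  shows "\<exists>F n. (\<forall>j. monomial_span N {e. (\<Sum>i<N. e i * w i) = j} (F j)) \<and>
    (\<forall>j\<ge>n. \<forall>x. F j x = 0) \<and> (\<forall>x. f x = (\<Sum>j<n. F j x))"
  using assms
proof (induction rule: monomial_span.induct)
  case zero
  show ?case
    by (rule exI[of _ "\<lambda>_ _. 0"], rule exI[of _ 0]) (auto intro: monomial_span.zero)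
next
  case (mono e c)
  let ?n = "\<Sum>i<N. e i * w i"
  let ?F = "\<lambda>j x. if j = ?n then c * (\<Prod>i<N. x i ^ e i) else 0"
  have "monomial_span N {e. (\<Sum>i<N. e i * w i) = j} (?F j)" for j
    by (cases "j = ?n") (auto intro: monomial_span.intros)
  then show ?case
    by (intro exI[of _ ?F] exI[of _ "Suc ?n"]) auto
next
  case (add f g)
  from add.IH(1) obtain F n where "\<forall>j. monomial_span N {e. (\<Sum>i<N. e i * w i) = j} (F j)"
      "\<forall>j\<ge>n. \<forall>x. F j x = 0" "\<forall>x. f x = (\<Sum>j<n. F j x)"
    by (elim exE conjE)
  note F = this[rule_format]
  from add.IH(2) obtain G n' where "\<forall>j. monomial_span N {e. (\<Sum>i<N. e i * w i) = j} (G j)"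
      "\<forall>j\<ge>n'. \<forall>x. G j x = 0" "\<forall>x. g x = (\<Sum>j<n'. G j x)"
    by (elim exE conjE)
  note G = this[rule_format]
  have "(\<Sum>j<n. F j x) = (\<Sum>j<max n n'. F j x)" for x
    by (rule sum.mono_neutral_left) (auto simp: F(2))
  moreover have "(\<Sum>j<n'. G j x) = (\<Sum>j<max n n'. G j x)" for x
    by (rule sum.mono_neutral_left) (auto simp: G(2))
  ultimately have "f x + g x = (\<Sum>j<max n n'. F j x + G j x)" for x
    by (simp only: F(3) G(3) sum.distrib)
  moreover have "\<forall>j\<ge>max n n'. \<forall>x. F j x + G j x = 0"
    by (simp add: F(2) G(2))
  ultimately show ?case
    using monomial_span.add[OF F(1) G(1)]
    by (intro exI[of _ "\<lambda>j x. F j x + G j x"] exI[of _ "max n n'"]) blast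
qed

section \<open>Algebraic dependence of more polynomials than variables\<close>

lemma poly_fun_bounded_degree:
  fixes f :: "(nat \<Rightarrow> 'k::comm_ring_1) \<Rightarrow> 'k"
  assumes "poly_fun N f"
  shows "\<exists>D. monomial_span N {e. \<forall>i<N. e i \<le> D} f"
  using assms
proof (induction rule: monomial_span.induct)
  case zero
  then show ?case by (blast intro: monomial_span.zero)
next
  case (mono e c)
  have "e i \<le> (\<Sum>i<N. e i)" if "i < N" for i
    using that by (intro member_le_sum) auto
  then show ?case
    by (intro exI[of _ "\<Sum>i<N. e i"] monomial_span.mono) auto
next
  case (add f g)
  then obtain D D' where "monomial_span N {e. \<forall>i<N. e i \<le> D} f" "monomial_span N {e. \<forall>i<N. e i \<le> D'} g"
    by blast
  then have "monomial_span N {e. \<forall>i<N. e i \<le> max D D'} f" "monomial_span N {e. \<forall>i<N. e i \<le> max D D'} g"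
    by (auto elim!: monomial_span_mono)
  then show ?case by (blast intro: monomial_span.add)
qed

lemma monomial_span_bounded_power:
  fixes f :: "(nat \<Rightarrow> 'k::comm_ring_1) \<Rightarrow> 'k"
  assumes "monomial_span N {e. \<forall>i<N. e i \<le> D} f"
  shows "monomial_span N {e. \<forall>i<N. e i \<le> n * D} (\<lambda>x. f x ^ n)"
proof (induction n)
  case 0
  have "monomial_span N {e. \<forall>i<N. e i \<le> 0} (\<lambda>x. 1 * (\<Prod>i<N. x i ^ 0) :: 'k)"
    by (rule monomial_span.mono[where e = "\<lambda>_. 0"]) simp
  then show ?case by simp
next
  case (Suc n)
  show ?case
    unfolding power_Suc by (rule monomial_span_mult[OF assms Suc]) (auto intro!: add_mono)
qed

lemma monomial_span_bounded_prod:
  fixes f :: "nat \<Rightarrow> (nat \<Rightarrow> 'k::comm_ring_1) \<Rightarrow> 'k"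
  assumes "\<And>j. j < n \<Longrightarrow> monomial_span N {e. \<forall>i<N. e i \<le> D} (f j)"
  shows "monomial_span N {e. \<forall>i<N. e i \<le> n * D} (\<lambda>x. \<Prod>j<n. f j x)"
  using assms
proof (induction n)
  case 0
  have "monomial_span N {e. \<forall>i<N. e i \<le> 0} (\<lambda>x. 1 * (\<Prod>i<N. x i ^ 0) :: 'k)"
    by (rule monomial_span.mono[where e = "\<lambda>_. 0"]) simp
  then show ?case by simp
next
  case (Suc n)
  have "monomial_span N {e. \<forall>i<N. e i \<le> Suc n * D} (\<lambda>x. f n x * (\<Prod>j<n. f j x))"
    by (rule monomial_span_mult[OF Suc.prems Suc.IH]) (auto intro!: add_mono Suc.prems)
  then show ?case by (simp add: mult.commute)
qed

lemma monomial_span_bounded_expand: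
  fixes f :: "(nat \<Rightarrow> 'k::comm_ring_1) \<Rightarrow> 'k"
  assumes "monomial_span N {e. \<forall>i<N. e i \<le> D} f"
  shows "\<exists>c. \<forall>x. f x = (\<Sum>e\<in>PiE {..<N} (\<lambda>_. {..D}). c e * (\<Prod>i<N. x i ^ e i))"
  using assms
proof (induction rule: monomial_span.induct)
  case zero
  show ?case by (rule exI[of _ "\<lambda>_. 0"]) simp
next
  case (mono e c)
  \<comment> \<open>The monomial ignores exponents from \<open>N\<close> on, but members of
    \<open>PiE\<close> are \<open>undefined\<close> there; the restriction makes the index set
    finite without changing the monomial.\<close>
  let ?e = "restrict e {..<N}"
  have "?e \<in> PiE {..<N} (\<lambda>_. {..D})"
    using mono by auto
  moreover have "finite (PiE {..<N} (\<lambda>_. {..D}))"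
    by (intro finite_PiE) auto
  moreover have "(\<Prod>i<N. x i ^ e i) = (\<Prod>i<N. x i ^ ?e i)" for x :: "nat \<Rightarrow> 'k"
    by (rule prod.cong) auto
  ultimately show ?case
    by (intro exI[of _ "\<lambda>e'. if e' = ?e then c else 0"]) (simp add: if_distrib [where f = "\<lambda>x. x * _"] cong: if_cong)
next
  case (add f g)
  then obtain c c' where "\<forall>x. f x = (\<Sum>e\<in>PiE {..<N} (\<lambda>_. {..D}). c e * (\<Prod>i<N. x i ^ e i))"
    "\<forall>x. g x = (\<Sum>e\<in>PiE {..<N} (\<lambda>_. {..D}). c' e * (\<Prod>i<N. x i ^ e i))"
    by blast
  then show ?case
    by (intro exI[of _ "\<lambda>e. c e + c' e"]) (simp add: distrib_right sum.distrib)
qed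

text \<open>Gaussian elimination, by induction on the equations: either equation \<open>t\<close> is
  trivial, or a pivot \<open>s0\<close> is eliminated, at the cost of one equation and one
  unknown.\<close>

lemma homogeneous_system_nontrivial_solution:
  fixes c :: "'s \<Rightarrow> 't \<Rightarrow> 'k::field"
  assumes "finite T" "finite S" "card T < card S"
  shows "\<exists>l. (\<exists>s\<in>S. l s \<noteq> 0) \<and> (\<forall>t\<in>T. (\<Sum>s\<in>S. l s * c s t) = 0)"
  using assms
proof (induction T arbitrary: S c rule: finite_induct)
  case empty
  then have "S \<noteq> {}" by auto
  then show ?case by (intro exI[of _ "\<lambda>_. 1"]) auto
next
  case (insert t T)
  show ?case
  proof (cases "\<forall>s\<in>S. c s t = 0")
    case True
    have "card T < card S" using insert by simp
    from insert.IH[OF insert.prems(1) this, of c] show ?thesis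
      using True by auto
  next
    case False
    then obtain s0 where s0: "s0 \<in> S" "c s0 t \<noteq> 0" by blast
    have "card T < card (S - {s0})"
      using insert s0 by simp
    from insert.IH[OF _ this, of "\<lambda>s t'. c s t' - c s t / c s0 t * c s0 t'"]
    obtain l where l: "\<exists>s\<in>S - {s0}. l s \<noteq> 0"
      "\<And>t'. t' \<in> T \<Longrightarrow> (\<Sum>s\<in>S - {s0}. l s * (c s t' - c s t / c s0 t * c s0 t')) = 0"
      using insert.prems by auto
    \<comment> \<open>The value at the pivot is the one forced by equation \<open>t\<close>. With it
      every sum over \<open>S\<close> becomes the reduced sum over \<open>S - {s0}\<close>, and at
      \<open>t' = t\<close> the reduced coefficients vanish.\<close>
    define l' where "l' = l(s0 := - (\<Sum>s\<in>S - {s0}. l s * (c s t / c s0 t)))"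
    have eq: "(\<Sum>s\<in>S. l' s * c s t') = (\<Sum>s\<in>S - {s0}. l s * (c s t' - c s t / c s0 t * c s0 t'))" for t'
    proof -
      have "(\<Sum>s\<in>S. l' s * c s t') = l' s0 * c s0 t' + (\<Sum>s\<in>S - {s0}. l' s * c s t')"
        by (rule sum.remove) (use insert.prems s0 in auto)
      also have "(\<Sum>s\<in>S - {s0}. l' s * c s t') = (\<Sum>s\<in>S - {s0}. l s * c s t')"
        by (rule sum.cong) (auto simp: l'_def)
      finally show ?thesis
        by (simp add: l'_def algebra_simps sum_subtractf sum_distrib_left)
    qed
    have "(\<Sum>s\<in>S. l' s * c s t) = 0"
      unfolding eq using s0 by simp
    moreover have "\<exists>s\<in>S. l' s \<noteq> 0"
      using l(1) by (auto simp: l'_def)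
    ultimately show ?thesis
      using l(2) eq by (intro exI[of _ l']) auto
  qed
qed

text \<open>Counting dimensions: the \<open>(B + 1)\<^bsup>N + 1\<^esup>\<close> monomials of multidegree at most \<open>B\<close> in the \<open>f\<^sub>j\<close>
  lie in a space of dimension at most \<open>((N + 1) B D + 1)\<^bsup>N\<^esup>\<close>, which is smaller for large \<open>B\<close>.\<close>

lemma poly_fun_algebraically_dependent:
  fixes f :: "nat \<Rightarrow> (nat \<Rightarrow> 'k::field) \<Rightarrow> 'k"
  assumes "\<And>j. j < Suc N \<Longrightarrow> poly_fun N (f j)"
  shows "\<exists>B l. (\<exists>e\<in>PiE {..<Suc N} (\<lambda>_. {..B}). l e \<noteq> 0) \<and>
    (\<forall>x. (\<Sum>e\<in>PiE {..<Suc N} (\<lambda>_. {..B}). l e * (\<Prod>j<Suc N. f j x ^ e j)) = 0)"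
proof -
  have "\<forall>j\<in>{..<Suc N}. \<exists>D. monomial_span N {e. \<forall>i<N. e i \<le> D} (f j)"
    using poly_fun_bounded_degree[OF assms] by simp
  from bchoice[OF this] obtain D' where
    D': "\<And>j. j < Suc N \<Longrightarrow> monomial_span N {e. \<forall>i<N. e i \<le> D' j} (f j)"
    by auto
  define D where "D = (\<Sum>j<Suc N. D' j)"
  have D: "monomial_span N {e. \<forall>i<N. e i \<le> D} (f j)" if "j < Suc N" for j
  proof -
    have "D' j \<le> D" unfolding D_def using that by (intro member_le_sum) auto
    then show ?thesis
      by (intro monomial_span_mono[OF D'[OF that]]) (blast intro: order_trans)
  qed
  \<comment> \<open>Chosen so that \<open>card T\<close>, which is at most
    \<open>((Suc N * D + 1) * (B + 1)) ^ N\<close>, is at most \<open>B * (B + 1) ^ N\<close>, just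
    below \<open>card S = (B + 1) ^ Suc N\<close>.\<close>
  define B where "B = (Suc N * D + 1) ^ N"
  define S where "S = PiE {..<Suc N} (\<lambda>_. {..B})"
  define T where "T = PiE {..<N} (\<lambda>_. {..Suc N * (B * D)})"
  have "\<exists>c. \<forall>x. (\<Prod>j<Suc N. f j x ^ e j) = (\<Sum>e\<in>T. c e * (\<Prod>i<N. x i ^ e i))" if "e \<in> S" for e
    unfolding T_def
  proof (intro monomial_span_bounded_expand monomial_span_bounded_prod)
    fix j assume j: "j < Suc N"
    have "e j * D \<le> B * D"
      using that j by (auto simp: S_def PiE_iff)
    then show "monomial_span N {e. \<forall>i<N. e i \<le> B * D} (\<lambda>x. f j x ^ e j)"
      by (intro monomial_span_mono[OF monomial_span_bounded_power[OF D[OF j]]]) (blast intro: order_trans)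
  qed
  then have "\<forall>e\<in>S. \<exists>c. \<forall>x. (\<Prod>j<Suc N. f j x ^ e j) = (\<Sum>e\<in>T. c e * (\<Prod>i<N. x i ^ e i))"
    by blast
  from bchoice[OF this] obtain c where
    c: "\<And>e x. e \<in> S \<Longrightarrow> (\<Prod>j<Suc N. f j x ^ e j) = (\<Sum>e'\<in>T. c e e' * (\<Prod>i<N. x i ^ e' i))"
    by blast
  have fin: "finite S" "finite T"
    unfolding S_def T_def by (intro finite_PiE; simp)+
  have "card T = (Suc N * (B * D) + 1) ^ N"
    unfolding T_def by (simp add: card_PiE)
  also have "\<dots> \<le> ((Suc N * D + 1) * (B + 1)) ^ N"
    by (intro power_mono) (auto simp: algebra_simps)
  also have "\<dots> = B * (B + 1) ^ N"
    by (simp only: power_mult_distrib B_def)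
  also have "\<dots> < (B + 1) ^ Suc N"
    unfolding power_Suc by (intro mult_strict_right_mono zero_less_power) auto
  also have "\<dots> = card S"
    unfolding S_def by (simp add: card_PiE)
  finally obtain l where l: "\<exists>s\<in>S. l s \<noteq> 0" "\<And>t. t \<in> T \<Longrightarrow> (\<Sum>s\<in>S. l s * c s t) = 0"
    using homogeneous_system_nontrivial_solution[OF fin(2,1)] by blast
  have "(\<Sum>e\<in>S. l e * (\<Prod>j<Suc N. f j x ^ e j)) = 0" for x
  proof -
    have "(\<Sum>e\<in>S. l e * (\<Prod>j<Suc N. f j x ^ e j)) = (\<Sum>e\<in>S. \<Sum>t\<in>T. l e * c e t * (\<Prod>i<N. x i ^ t i))"
      by (rule sum.cong) (simp_all only: c sum_distrib_left mult_ac)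
    also have "\<dots> = (\<Sum>t\<in>T. (\<Sum>e\<in>S. l e * c e t) * (\<Prod>i<N. x i ^ t i))"
      by (subst sum.swap) (simp add: sum_distrib_right)
    also have "\<dots> = 0"
      using l(2) by simp
    finally show ?thesis .
  qed
  then show ?thesis
    using l(1) unfolding S_def by blast
qed

section \<open>Dimension of a quotient by a weighted torus action\<close>

text \<open>Over a finite field, the product of all z - a, increased by 1, would be a nonconstant
  polynomial without a root.\<close>

lemma infinite_UNIV_alg_closed: "infinite (UNIV :: 'k::alg_closed_field set)"
proof
  assume fin: "finite (UNIV :: 'k set)"
  define q :: "'k poly" where "q = (\<Prod>a\<in>UNIV. [:-a, 1:])"
  have "degree q = card (UNIV :: 'k set)"
    unfolding q_def by (subst degree_prod_eq_sum_degree) auto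
  then have "degree (q + 1) > 0"
    using fin by (subst degree_add_eq_left) (auto simp: card_gt_0_iff)
  then obtain x where "poly (q + 1) x = 0"
    using alg_closed_imp_poly_has_root by blast
  moreover have "poly q x = 0"
    unfolding q_def poly_prod using fin by (intro prod_zero) auto
  ultimately show False by simp
qed

text \<open>Lets polynomial identities be checked pointwise; \<open>A\<close> holds the points where
  the check fails, such as zeros of a denominator or the scaling parameter 0.\<close>

lemma poly_eq_0_if_cofinite_roots:
  fixes q :: "'k::alg_closed_field poly"
  assumes "finite A" "\<And>x. x \<notin> A \<Longrightarrow> poly q x = 0"
  shows "q = 0"
proof (rule ccontr)
  assume "q \<noteq> 0"
  then have "finite {x. poly q x = 0}" by (rule poly_roots_finite)
  moreover have "UNIV \<subseteq> A \<union> {x. poly q x = 0}" using assms(2) by blast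
  ultimately show False
    using assms(1) infinite_UNIV_alg_closed by (metis finite_UnI finite_subset)
qed

lemma irreducible_inD:
  "irreducible_in X Z \<Longrightarrow> closedin X A \<Longrightarrow> closedin X B \<Longrightarrow> Z \<subseteq> A \<union> B \<Longrightarrow> Z \<subseteq> A \<or> Z \<subseteq> B"
  by (simp add: irreducible_in_def)

text \<open>The torus acts by \<open>(c \<cdot> a)\<^sub>i = c\<^bsup>w i\<^esup> a\<^sub>i\<close>, and \<^term>\<open>cls\<close> is the quotient map.\<close>

locale weighted_quotient =
  fixes X :: "'c topology"
    and cls :: "(nat \<Rightarrow> 'k::alg_closed_field) \<Rightarrow> 'c"
    and m :: nat
    and w :: "nat \<Rightarrow> nat"
    and L :: "(nat \<Rightarrow> 'k) set"
  assumes L_def: "L = {a. a 0 \<noteq> 0 \<and> a m \<noteq> 0}"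
    and m_pos: "m > 0" and w_0: "w 0 = 0" and w_m: "w m > 0"
    and topspace_eq: "topspace X = cls ` L"
    and cls_eq_iff: "a \<in> L \<Longrightarrow> b \<in> L \<Longrightarrow>
      cls a = cls b \<longleftrightarrow> (\<exists>c. c \<noteq> 0 \<and> (\<forall>i\<le>m. b i = c ^ w i * a i))"
    and separation: "closedin X Z \<Longrightarrow> a \<in> L \<Longrightarrow> cls a \<notin> Z \<Longrightarrow>
      \<exists>n P. monomial_span (Suc m) {e. (\<Sum>i<Suc m. e i * w i) = n} P \<and> P a \<noteq> 0 \<and>
        (\<forall>b\<in>L. cls b \<in> Z \<longrightarrow> P b = 0)"
    and closedin_zeros: "poly_fun (Suc m) P \<Longrightarrow>
      (\<And>a c. a \<in> L \<Longrightarrow> c \<noteq> 0 \<Longrightarrow> P a = 0 \<Longrightarrow> P (\<lambda>i. c ^ w i * a i) = 0) \<Longrightarrow>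
      closedin X (cls ` {a \<in> L. P a = 0})"
begin

section \<open>Invariant functions and irreducible sets of classes\<close>

lemma scale_in_L: "a \<in> L \<Longrightarrow> c \<noteq> 0 \<Longrightarrow> (\<lambda>i. c ^ w i * a i) \<in> L"
  by (auto simp: L_def)

lemma cls_scale: "a \<in> L \<Longrightarrow> c \<noteq> 0 \<Longrightarrow> cls (\<lambda>i. c ^ w i * a i) = cls a"
  using cls_eq_iff[of a "\<lambda>i. c ^ w i * a i"] scale_in_L by metis

definition regular :: "((nat \<Rightarrow> 'k) \<Rightarrow> 'k) \<Rightarrow> bool" where
  "regular h \<longleftrightarrow> (\<exists>P M. poly_fun (Suc m) P \<and> (\<forall>a\<in>L. P a = h a * a m ^ M)) \<and>
     (\<forall>a\<in>L. \<forall>c. c \<noteq> 0 \<longrightarrow> h (\<lambda>i. c ^ w i * a i) = h a)"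

lemma regularI:
  assumes "poly_fun (Suc m) P" "\<And>a. a \<in> L \<Longrightarrow> P a = h a * a m ^ M"
    "\<And>a c. a \<in> L \<Longrightarrow> c \<noteq> 0 \<Longrightarrow> h (\<lambda>i. c ^ w i * a i) = h a"
  shows "regular h"
  using assms unfolding regular_def by blast

lemma regular_const: "regular (\<lambda>a. c)"
  by (rule regularI[where P = "\<lambda>_. c" and M = 0]) (auto intro: poly_fun_const)

lemma regular_add:
  assumes "regular f" "regular g"
  shows "regular (\<lambda>a. f a + g a)"
proof -
  from assms(1) obtain P M where "poly_fun (Suc m) P" "\<forall>a\<in>L. P a = f a * a m ^ M"
      "\<forall>a\<in>L. \<forall>c. c \<noteq> 0 \<longrightarrow> f (\<lambda>i. c ^ w i * a i) = f a"
    unfolding regular_def by (elim exE conjE)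
  note P = this[rule_format]
  from assms(2) obtain Q N where "poly_fun (Suc m) Q" "\<forall>a\<in>L. Q a = g a * a m ^ N"
      "\<forall>a\<in>L. \<forall>c. c \<noteq> 0 \<longrightarrow> g (\<lambda>i. c ^ w i * a i) = g a"
    unfolding regular_def by (elim exE conjE)
  note Q = this[rule_format]
  show ?thesis
  proof (rule regularI)
    show "poly_fun (Suc m) (\<lambda>a. P a * a m ^ N + Q a * a m ^ M)"
      by (intro monomial_span.add poly_fun_mult poly_fun_power poly_fun_var P Q) simp_all
    show "P a * a m ^ N + Q a * a m ^ M = (f a + g a) * a m ^ (M + N)" if "a \<in> L" for a
      using that by (simp add: P(2) Q(2) power_add algebra_simps)
  qed (simp add: P(3) Q(3))
qed

lemma regular_mult:
  assumes "regular f" "regular g"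
  shows "regular (\<lambda>a. f a * g a)"
proof -
  from assms(1) obtain P M where "poly_fun (Suc m) P" "\<forall>a\<in>L. P a = f a * a m ^ M"
      "\<forall>a\<in>L. \<forall>c. c \<noteq> 0 \<longrightarrow> f (\<lambda>i. c ^ w i * a i) = f a"
    unfolding regular_def by (elim exE conjE)
  note P = this[rule_format]
  from assms(2) obtain Q N where "poly_fun (Suc m) Q" "\<forall>a\<in>L. Q a = g a * a m ^ N"
      "\<forall>a\<in>L. \<forall>c. c \<noteq> 0 \<longrightarrow> g (\<lambda>i. c ^ w i * a i) = g a"
    unfolding regular_def by (elim exE conjE)
  note Q = this[rule_format]
  show ?thesis
  proof (rule regularI)
    show "poly_fun (Suc m) (\<lambda>a. P a * Q a)"
      by (intro poly_fun_mult P Q)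
    show "P a * Q a = (f a * g a) * a m ^ (M + N)" if "a \<in> L" for a
      using that by (simp add: P(2) Q(2) power_add algebra_simps)
  qed (simp add: P(3) Q(3))
qed

lemma regular_power: "regular f \<Longrightarrow> regular (\<lambda>a. f a ^ n)"
  by (induction n) (auto intro: regular_const regular_mult)

lemma regular_sum: "(\<And>s. s \<in> S \<Longrightarrow> regular (f s)) \<Longrightarrow> regular (\<lambda>a. \<Sum>s\<in>S. f s a)"
  by (induction S rule: infinite_finite_induct) (auto intro: regular_const regular_add)

lemma regular_prod: "(\<And>s. s \<in> S \<Longrightarrow> regular (f s)) \<Longrightarrow> regular (\<lambda>a. \<Prod>s\<in>S. f s a)"
  by (induction S rule: infinite_finite_induct) (auto intro: regular_const regular_mult)

text \<open>Equal classes control only the coordinates up to \<open>m\<close>, while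
  \<open>h\<close> sees the whole sequence. The comparison therefore passes through
  \<open>P\<close>, which ignores the other coordinates.\<close>

lemma regular_cls_eq:
  assumes "regular h" "a \<in> L" "b \<in> L" "cls a = cls b"
  shows "h a = h b"
proof -
  from assms(1) obtain P M where "poly_fun (Suc m) P" "\<forall>a\<in>L. P a = h a * a m ^ M"
      "\<forall>a\<in>L. \<forall>c. c \<noteq> 0 \<longrightarrow> h (\<lambda>i. c ^ w i * a i) = h a"
    unfolding regular_def by (elim exE conjE)
  note P = this[rule_format]
  obtain c where c: "c \<noteq> 0" "\<And>i. i \<le> m \<Longrightarrow> b i = c ^ w i * a i"
    using cls_eq_iff[OF assms(2,3)] assms(4) by auto
  let ?b = "\<lambda>i. c ^ w i * a i"
  have "h b * b m ^ M = P b"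
    by (rule P(2)[OF assms(3), symmetric])
  also have "P b = P ?b"
    using poly_fun_cong[OF P(1), of b ?b] c(2) by simp
  also have "\<dots> = h ?b * ?b m ^ M"
    by (rule P(2)[OF scale_in_L[OF assms(2) c(1)]])
  finally have "h b * b m ^ M = h ?b * ?b m ^ M" .
  moreover have "?b m = b m" "b m \<noteq> 0"
    using c(2)[of m] assms(3) by (auto simp: L_def)
  ultimately have "h b = h ?b"
    by (metis mult_right_cancel power_not_zero)
  then show ?thesis using P(3)[OF assms(2) c(1)] by simp
qed

lemma closedin_regular_zeros:
  assumes "regular h"
  shows "closedin X (cls ` {a \<in> L. h a = 0})"
proof -
  from assms obtain P M where "poly_fun (Suc m) P" "\<forall>a\<in>L. P a = h a * a m ^ M"
      "\<forall>a\<in>L. \<forall>c. c \<noteq> 0 \<longrightarrow> h (\<lambda>i. c ^ w i * a i) = h a"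
    unfolding regular_def by (elim exE conjE)
  note P = this[rule_format]
  have eq: "P a = 0 \<longleftrightarrow> h a = 0" if "a \<in> L" for a
    using that P(2)[OF that] by (auto simp: L_def)
  have "closedin X (cls ` {a \<in> L. P a = 0})"
    by (rule closedin_zeros[OF P(1)]) (use eq scale_in_L P(3) in auto)
  also have "{a \<in> L. P a = 0} = {a \<in> L. h a = 0}"
    using eq by blast
  finally show ?thesis .
qed

text \<open>Functions on an irreducible set have no zero divisors: the zero sets of \<open>f\<close>
  and \<open>g\<close> are closed and cover \<open>Z\<close>, and the point \<open>b\<close> rules
  out the first.\<close>

lemma irreducible_regular_mult:
  assumes Z: "irreducible_in X Z" and fg: "regular f" "regular g"
    and 0: "\<And>a. a \<in> L \<Longrightarrow> cls a \<in> Z \<Longrightarrow> f a * g a = 0"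
    and b: "b \<in> L" "cls b \<in> Z" "f b \<noteq> 0" and a: "a \<in> L" "cls a \<in> Z"
  shows "g a = 0"
proof -
  let ?F = "cls ` {a \<in> L. f a = 0}" and ?G = "cls ` {a \<in> L. g a = 0}"
  have "Z \<subseteq> ?F \<union> ?G"
  proof
    fix x assume x: "x \<in> Z"
    then obtain d where d: "d \<in> L" "x = cls d"
      using Z by (auto simp: irreducible_in_def topspace_eq)
    then have "f d = 0 \<or> g d = 0" using 0[of d] x by simp
    then show "x \<in> ?F \<union> ?G" using d by blast
  qed
  then have "Z \<subseteq> ?F \<or> Z \<subseteq> ?G"
    by (rule irreducible_inD[OF Z closedin_regular_zeros[OF fg(1)] closedin_regular_zeros[OF fg(2)]])
  moreover have "cls b \<notin> ?F"
  proof
    assume "cls b \<in> ?F"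
    then obtain d where "d \<in> L" "f d = 0" "cls b = cls d" by blast
    then show False using regular_cls_eq[OF fg(1) b(1), of d] b(3) by simp
  qed
  ultimately have "cls a \<in> ?G"
    using a b by blast
  then obtain d where "d \<in> L" "g d = 0" "cls a = cls d" by blast
  then show ?thesis
    using regular_cls_eq[OF fg(2) a(1), of d] by simp
qed

text \<open>Pull the lowest power of the last function out of a relation, cancel it on the irreducible
  set, and restrict to the next smaller set, where only the constant coefficient survives.\<close>

lemma chain_algebraically_independent:
  assumes "\<And>i. i \<le> n \<Longrightarrow> irreducible_in X (Z i)"
    and "\<And>i. i < n \<Longrightarrow> Z i \<subseteq> Z (Suc i)"
    and "\<And>i. i < n \<Longrightarrow> regular (f i)"
    and "\<And>i a. i < n \<Longrightarrow> a \<in> L \<Longrightarrow> cls a \<in> Z i \<Longrightarrow> f i a = 0"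
    and "\<And>i. i < n \<Longrightarrow> \<exists>a\<in>L. cls a \<in> Z (Suc i) \<and> f i a \<noteq> 0"
    and "\<And>a. a \<in> L \<Longrightarrow> cls a \<in> Z n \<Longrightarrow>
      (\<Sum>e\<in>PiE {..<n} (\<lambda>_. {..B}). l e * (\<Prod>j<n. f j a ^ e j)) = 0"
    and "e \<in> PiE {..<n} (\<lambda>_. {..B::nat})"
  shows "l e = 0"
  using assms
proof (induction n arbitrary: l e)
  case 0
  \<comment> \<open>Without functions the relation is the constant \<open>l e\<close> itself; a
    point of the nonempty \<open>Z 0\<close> shows that it is zero.\<close>
  have "Z 0 \<subseteq> cls ` L" "Z 0 \<noteq> {}"
    using "0.prems"(1)[of 0] by (simp_all add: irreducible_in_def topspace_eq)
  then obtain a where "a \<in> L" "cls a \<in> Z 0"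
    by blast
  with "0.prems"(6)[of a] "0.prems"(7) show ?case by simp
next
  case (Suc n)
  let ?E = "PiE {..<n} (\<lambda>_. {..B})"
  \<comment> \<open>\<open>G j\<close> is the coefficient of \<open>f n ^ j\<close> when the
    relation is read as a polynomial in the last function.\<close>
  define G where "G j a = (\<Sum>e\<in>?E. l (e(n := j)) * (\<Prod>i<n. f i a ^ e i))" for j a
  have "{..<Suc n} = insert n {..<n}"
    by auto
  then have E_Suc: "PiE {..<Suc n} (\<lambda>_. {..B}) = (\<lambda>(y, g). g(n := y)) ` ({..B} \<times> ?E)"
    by (simp only: PiE_insert_eq)
  have expand: "(\<Sum>e\<in>PiE {..<Suc n} (\<lambda>_. {..B}). l e * (\<Prod>j<Suc n. f j a ^ e j)) =
    (\<Sum>j\<le>B. f n a ^ j * G j a)" for a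
  proof -
    have "(\<Sum>e\<in>PiE {..<Suc n} (\<lambda>_. {..B}). l e * (\<Prod>j<Suc n. f j a ^ e j)) =
      (\<Sum>(j, e)\<in>{..B} \<times> ?E. l (e(n := j)) * (\<Prod>i<Suc n. f i a ^ (e(n := j)) i))"
      unfolding E_Suc by (subst sum.reindex[OF inj_combinator]) (auto simp: case_prod_unfold)
    also have "\<dots> = (\<Sum>j\<le>B. \<Sum>e\<in>?E. l (e(n := j)) * (\<Prod>i<Suc n. f i a ^ (e(n := j)) i))"
      by (simp add: sum.cartesian_product)
    also have "\<dots> = (\<Sum>j\<le>B. f n a ^ j * G j a)"
      unfolding G_def sum_distrib_left by (intro sum.cong refl) (simp add: mult_ac)
    finally show ?thesis .
  qed
  have reg_G: "regular (G j)" for j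
    unfolding G_def
    by (intro regular_sum regular_mult regular_const regular_prod regular_power Suc.prems(3)) auto
  have "\<forall>e\<in>?E. l (e(n := j)) = 0" if "j \<le> B" for j
    using that
  proof (induction j rule: less_induct)
    case (less j)
    have G0: "G i a = 0" if "i < j" for i a
      unfolding G_def by (rule sum.neutral) (use less.IH[OF that] less.prems that in fastforce)
    \<comment> \<open>The relation divided by \<open>f n ^ j\<close>, which is possible since the
      coefficients below \<open>j\<close> are already known to vanish.\<close>
    define H where "H a = (\<Sum>i\<in>{j..B}. f n a ^ (i - j) * G i a)" for a
    have reg_f: "regular (\<lambda>a. f n a ^ j)"
      by (intro regular_power Suc.prems(3)) simp
    have reg_H: "regular H"
      unfolding H_def by (intro regular_sum regular_mult regular_power reg_G Suc.prems(3)) simp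
    have fH: "f n a ^ j * H a = 0" if "a \<in> L" "cls a \<in> Z (Suc n)" for a
    proof -
      have "f n a ^ j * H a = (\<Sum>i\<in>{j..B}. f n a ^ i * G i a)"
        unfolding H_def sum_distrib_left
        by (intro sum.cong refl) (simp flip: power_add mult.assoc)
      also have "\<dots> = (\<Sum>i\<le>B. f n a ^ i * G i a)"
        by (rule sum.mono_neutral_left) (auto simp: G0)
      also have "\<dots> = 0"
        using Suc.prems(6)[OF that] unfolding expand .
      finally show ?thesis .
    qed
    obtain b where b: "b \<in> L" "cls b \<in> Z (Suc n)" "f n b \<noteq> 0"
      using Suc.prems(5)[of n] by auto
    have H0: "H a = 0" if "a \<in> L" "cls a \<in> Z (Suc n)" for a
      by (rule irreducible_regular_mult[OF Suc.prems(1) reg_f reg_H fH b(1,2) _ that])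
        (use b in auto)
    have "G j a = 0" if a: "a \<in> L" "cls a \<in> Z n" for a
    proof -
      have f0: "f n a = 0" using Suc.prems(4)[of n a] a by simp
      have "H a = (\<Sum>i\<in>{j..B}. if i = j then G j a else 0)"
        unfolding H_def by (intro sum.cong refl) (auto simp: f0)
      then have "H a = G j a" using less.prems by simp
      moreover have "cls a \<in> Z (Suc n)" using Suc.prems(2)[of n] a by auto
      ultimately show ?thesis using H0 a by simp
    qed
    then have *: "(\<Sum>e\<in>?E. l (e(n := j)) * (\<Prod>i<n. f i a ^ e i)) = 0" if "a \<in> L" "cls a \<in> Z n" for a
      using that unfolding G_def by blast
    show ?case
    proof
      fix e assume e: "e \<in> ?E"
      show "l (e(n := j)) = 0"
        by (rule Suc.IH[of "\<lambda>e. l (e(n := j))", OF _ _ _ _ _ * e])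
          (use Suc.prems(1-5) in auto)
    qed
  qed
  moreover obtain j e' where "e = e'(n := j)" "j \<le> B" "e' \<in> ?E"
    using Suc.prems(7) unfolding E_Suc by auto
  ultimately show ?case by blast
qed

section \<open>Separating functions and the upper bound for chains\<close>

text \<open>If \<open>P\<close> has weight \<open>n\<close>, then \<open>P b ^ w m\<close> and
  \<open>b m ^ n\<close> both have weight \<open>n * w m\<close>, so their quotient is invariant; on
  the slice its denominator is 1. As \<open>w m > 0\<close>, the zeros of \<open>P\<close> remain
  zeros.\<close>

lemma regular_separation:
  assumes "closedin X Z" "a \<in> L" "cls a \<notin> Z"
  shows "\<exists>h P. poly_fun (Suc m) P \<and> regular h \<and> h a \<noteq> 0 \<and> (\<forall>b\<in>L. cls b \<in> Z \<longrightarrow> h b = 0) \<and>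
    (\<forall>b\<in>L. b m = 1 \<longrightarrow> h b = P b)"
proof -
  from separation[OF assms] obtain n P where
    "monomial_span (Suc m) {e. (\<Sum>i<Suc m. e i * w i) = n} P" "P a \<noteq> 0"
    "\<forall>b\<in>L. cls b \<in> Z \<longrightarrow> P b = 0"
    by (elim exE conjE)
  note P = this[rule_format]
  define h where "h b = P b ^ w m / b m ^ n" for b
  have pf: "poly_fun (Suc m) (\<lambda>b. P b ^ w m)"
    by (intro poly_fun_power monomial_span_mono[OF P(1)]) auto
  moreover have "regular h"
  proof (rule regularI[OF pf])
    show "P b ^ w m = h b * b m ^ n" if "b \<in> L" for b
      using that by (simp add: h_def L_def)
    show "h (\<lambda>i. c ^ w i * b i) = h b" if "b \<in> L" "c \<noteq> 0" for b c
    proof -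
      have "P (\<lambda>i. c ^ w i * b i) ^ w m = c ^ (n * w m) * P b ^ w m"
        by (simp add: monomial_span_homogeneous[OF P(1)] power_mult_distrib power_mult)
      moreover have "(c ^ w m * b m) ^ n = c ^ (n * w m) * b m ^ n"
        by (simp add: power_mult_distrib mult.commute flip: power_mult)
      ultimately show ?thesis
        using that by (simp add: h_def)
    qed
  qed
  moreover have "h a \<noteq> 0"
    using P(2) assms(2) by (simp add: h_def L_def)
  moreover have "\<forall>b\<in>L. cls b \<in> Z \<longrightarrow> h b = 0"
    using P(3) w_m by (simp add: h_def)
  moreover have "\<forall>b\<in>L. b m = 1 \<longrightarrow> h b = P b ^ w m"
    by (simp add: h_def)
  ultimately show ?thesis by blast
qed

lemma chain_length_le:
  assumes irr: "\<And>i. i \<le> n \<Longrightarrow> irreducible_in X (Z i)"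
    and closed: "\<And>i. i \<le> n \<Longrightarrow> closedin X (Z i)"
    and strict: "\<And>i. i < n \<Longrightarrow> Z i \<subset> Z (Suc i)"
  shows "n \<le> m"
proof (rule ccontr)
  assume "\<not> n \<le> m"
  then have n: "n \<ge> Suc m" by simp
  \<comment> \<open>Only the first m + 1 steps of the chain are used: one function for each,
    vanishing on the smaller set but not on the larger.\<close>
  have "\<exists>h. \<exists>P. poly_fun (Suc m) P \<and> regular h \<and> (\<exists>a\<in>L. cls a \<in> Z (Suc i) \<and> h a \<noteq> 0) \<and>
      (\<forall>b\<in>L. cls b \<in> Z i \<longrightarrow> h b = 0) \<and> (\<forall>b\<in>L. b m = 1 \<longrightarrow> h b = P b)" if "i < Suc m" for i
  proof -
    have i: "i < n" using that n by simp
    then obtain x where x: "x \<in> Z (Suc i)" "x \<notin> Z i" using strict by blast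
    moreover have "Z (Suc i) \<subseteq> cls ` L"
      using irr[of "Suc i"] i by (simp add: irreducible_in_def topspace_eq)
    ultimately obtain a where a: "a \<in> L" "cls a \<in> Z (Suc i)" "cls a \<notin> Z i" by blast
    from regular_separation[OF closed[OF less_imp_le[OF i]] a(1,3)] obtain h P where
      "poly_fun (Suc m) P" "regular h" "h a \<noteq> 0" "\<forall>b\<in>L. cls b \<in> Z i \<longrightarrow> h b = 0"
      "\<forall>b\<in>L. b m = 1 \<longrightarrow> h b = P b"
      by (elim exE conjE)
    then show ?thesis
      using a by (intro exI[of _ h] exI[of _ P] conjI bexI[of _ a])
  qed
  then have "\<forall>i\<in>{..<Suc m}. \<exists>h. \<exists>P. poly_fun (Suc m) P \<and> regular h \<and>
      (\<exists>a\<in>L. cls a \<in> Z (Suc i) \<and> h a \<noteq> 0) \<and>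
      (\<forall>b\<in>L. cls b \<in> Z i \<longrightarrow> h b = 0) \<and> (\<forall>b\<in>L. b m = 1 \<longrightarrow> h b = P b)"
    by blast
  from bchoice[OF this] obtain f where "\<forall>i\<in>{..<Suc m}. \<exists>P. poly_fun (Suc m) P \<and> regular (f i) \<and>
      (\<exists>a\<in>L. cls a \<in> Z (Suc i) \<and> f i a \<noteq> 0) \<and>
      (\<forall>b\<in>L. cls b \<in> Z i \<longrightarrow> f i b = 0) \<and> (\<forall>b\<in>L. b m = 1 \<longrightarrow> f i b = P b)"
    by blast
  from bchoice[OF this] obtain P where "\<forall>i\<in>{..<Suc m}. poly_fun (Suc m) (P i) \<and> regular (f i) \<and>
      (\<exists>a\<in>L. cls a \<in> Z (Suc i) \<and> f i a \<noteq> 0) \<and>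
      (\<forall>b\<in>L. cls b \<in> Z i \<longrightarrow> f i b = 0) \<and> (\<forall>b\<in>L. b m = 1 \<longrightarrow> f i b = P i b)"
    by blast
  then have P: "\<And>i. i < Suc m \<Longrightarrow> poly_fun (Suc m) (P i)"
    and reg: "\<And>i. i < Suc m \<Longrightarrow> regular (f i)"
    and nz: "\<And>i. i < Suc m \<Longrightarrow> \<exists>a\<in>L. cls a \<in> Z (Suc i) \<and> f i a \<noteq> 0"
    and zer: "\<And>i b. i < Suc m \<Longrightarrow> b \<in> L \<Longrightarrow> cls b \<in> Z i \<Longrightarrow> f i b = 0"
    and fP: "\<And>i b. i < Suc m \<Longrightarrow> b \<in> L \<Longrightarrow> b m = 1 \<Longrightarrow> f i b = P i b"
    by auto
  \<comment> \<open>Setting the last coordinate to 1 leaves m + 1 polynomials in \<open>m\<close>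
    variables, which are algebraically dependent.\<close>
  have pf: "poly_fun m (\<lambda>x. P i (x(m := 1)))" if "i < Suc m" for i
  proof (rule poly_fun_subst[OF P[OF that]])
    show "poly_fun m (\<lambda>x. (x(m := 1)) j)" if "j < Suc m" for j
      using that by (cases "j = m") (auto intro: poly_fun_const poly_fun_var)
  qed
  have "\<exists>B l. (\<exists>e\<in>PiE {..<Suc m} (\<lambda>_. {..B}). l e \<noteq> 0) \<and>
    (\<forall>x. (\<Sum>e\<in>PiE {..<Suc m} (\<lambda>_. {..B}). l e * (\<Prod>j<Suc m. P j (x(m := 1)) ^ e j)) = 0)"
    by (rule poly_fun_algebraically_dependent) (rule pf)
  then obtain B l where
    l: "\<exists>e\<in>PiE {..<Suc m} (\<lambda>_. {..B}). l e \<noteq> 0"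
      "\<forall>x. (\<Sum>e\<in>PiE {..<Suc m} (\<lambda>_. {..B}). l e * (\<Prod>j<Suc m. P j (x(m := 1)) ^ e j)) = 0"
    by (elim exE conjE)
  have rel: "(\<Sum>e\<in>PiE {..<Suc m} (\<lambda>_. {..B}). l e * (\<Prod>j<Suc m. f j a ^ e j)) = 0" if a: "a \<in> L" for a
  proof -
    \<comment> \<open>Every orbit meets the slice: scaling by this root makes the last coordinate 1.
      Invariance then carries the relation from the slice to all of \<open>L\<close>.\<close>
    obtain c where c: "c ^ w m = inverse (a m)"
      using nth_root_exists[OF w_m] by blast
    have am: "a m \<noteq> 0" using a by (simp add: L_def)
    then have c0: "c \<noteq> 0" using c w_m by (auto simp: zero_power)
    define b where "b = (\<lambda>i. c ^ w i * a i)"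
    have b: "b \<in> L" "b m = 1" "cls b = cls a"
      using scale_in_L[OF a c0] cls_scale[OF a c0] c am by (auto simp: b_def)
    have "b(m := 1) = b" using b(2) by auto
    moreover have "f j a = P j b" if "j < Suc m" for j
      using fP[OF that b(1,2)] regular_cls_eq[OF reg[OF that] b(1) a b(3)] by simp
    ultimately show ?thesis
      using l(2)[rule_format, of b] by simp
  qed
  have "l e = 0" if "e \<in> PiE {..<Suc m} (\<lambda>_. {..B})" for e
    by (rule chain_algebraically_independent[where f = f and Z = Z and n = "Suc m", OF _ _ reg zer nz rel that])
      (use n irr strict in \<open>simp_all add: psubset_imp_subset\<close>)
  with l(1) show False by blast
qed

section \<open>Irreducible linear sections and the lower bound\<close>

text \<open>Take points of \<open>S\<close> outside \<open>A\<close> and outside \<open>B\<close>,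
  with functions \<open>P\<close> and \<open>Q\<close> separating them from these sets. On the line
  through the two points, \<open>P\<close> or \<open>Q\<close> vanishes at every parameter for which
  the line is in \<open>L\<close>, so one of them vanishes on the whole line, contradicting its
  value at parameter 0 or 1.\<close>

lemma irreducible_linear_section:
  assumes S: "S \<subseteq> L" "S \<noteq> {}"
    and line: "\<And>a b t. a \<in> S \<Longrightarrow> b \<in> S \<Longrightarrow> (\<lambda>i. a i + t * (b i - a i)) \<in> L \<Longrightarrow>
      (\<lambda>i. a i + t * (b i - a i)) \<in> S"
  shows "irreducible_in X (cls ` S)"
  unfolding irreducible_in_def
proof (intro conjI allI impI)
  show "cls ` S \<subseteq> topspace X" "cls ` S \<noteq> {}"
    using S by (auto simp: topspace_eq)
next
  fix A B assume AB: "closedin X A \<and> closedin X B \<and> cls ` S \<subseteq> A \<union> B"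
  show "cls ` S \<subseteq> A \<or> cls ` S \<subseteq> B"
  proof (rule ccontr)
    assume "\<not> (cls ` S \<subseteq> A \<or> cls ` S \<subseteq> B)"
    then obtain a b where ab: "a \<in> S" "cls a \<notin> A" "b \<in> S" "cls b \<notin> B" by blast
    have "closedin X A" "a \<in> L" using AB ab S by auto
    from separation[OF this ab(2)] obtain n P where
      "monomial_span (Suc m) {e. (\<Sum>i<Suc m. e i * w i) = n} P" "P a \<noteq> 0"
      "\<forall>x\<in>L. cls x \<in> A \<longrightarrow> P x = 0"
      by (elim exE conjE)
    note P = this[rule_format]
    have "closedin X B" "b \<in> L" using AB ab S by auto
    from separation[OF this ab(4)] obtain n' Q where
      "monomial_span (Suc m) {e. (\<Sum>i<Suc m. e i * w i) = n'} Q" "Q b \<noteq> 0"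
      "\<forall>x\<in>L. cls x \<in> B \<longrightarrow> Q x = 0"
      by (elim exE conjE)
    note Q = this[rule_format]
    let ?p = "\<lambda>t i. a i + t * (b i - a i)"
    have "poly_fun (Suc m) P" "poly_fun (Suc m) Q"
      by (rule monomial_span_mono[OF P(1)] monomial_span_mono[OF Q(1)]; simp)+
    from this[THEN poly_fun_line[of "Suc m" _ a "\<lambda>i. b i - a i"]] obtain q r
      where "\<forall>t. poly q t = P (?p t)" "\<forall>t. poly r t = Q (?p t)"
      by (elim exE)
    note q = this(1)[rule_format] and r = this(2)[rule_format]
    \<comment> \<open>\<open>u\<close> vanishes exactly at the parameters where the line leaves
      \<open>L\<close>; multiplying by it removes these exceptions.\<close>
    define u where "u = [:a 0, b 0 - a 0:] * [:a m, b m - a m:]"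
    have u: "poly u t = ?p t 0 * ?p t m" for t by (simp add: u_def algebra_simps)
    have "poly (q * r * u) t = 0" for t
    proof (cases "?p t \<in> L")
      case True
      then have "?p t \<in> S" using line ab by blast
      then have "cls (?p t) \<in> A \<or> cls (?p t) \<in> B" using AB by blast
      then have "P (?p t) = 0 \<or> Q (?p t) = 0" using P(3) Q(3) True by blast
      then show ?thesis by (auto simp: q r)
    next
      case False
      then show ?thesis using u by (auto simp: L_def)
    qed
    then have "q * r * u = 0"
      using poly_eq_0_if_cofinite_roots[of "{}"] by blast
    then have "q = 0 \<or> r = 0 \<or> u = 0" by simp
    moreover have "poly q 0 \<noteq> 0" using P(2) q[of 0] by simp
    moreover have "poly r 1 \<noteq> 0" using Q(2) r[of 1] by simp
    moreover have "poly u 0 \<noteq> 0" using u[of 0] ab S by (auto simp: L_def)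
    ultimately show False by auto
  qed
qed

text \<open>Images under \<open>cls\<close> commute with these intersections because the vanishing
  of a coordinate survives scaling. The guard \<open>i \<le> m\<close> is there since a class does
  not determine coordinates above \<open>m\<close>.\<close>

lemma closedin_coordinate_section:
  assumes "finite I"
  shows "closedin X (cls ` {a \<in> L. \<forall>i\<in>I. i \<le> m \<longrightarrow> a i = 0})"
  using assms
proof (induction I rule: finite_induct)
  case empty
  then show ?case by (simp flip: topspace_eq)
next
  case (insert j I)
  show ?case
  proof (cases "j \<le> m")
    case False
    then have "{a \<in> L. \<forall>i\<in>insert j I. i \<le> m \<longrightarrow> a i = 0} = {a \<in> L. \<forall>i\<in>I. i \<le> m \<longrightarrow> a i = 0}"
      by auto
    then show ?thesis using insert by simp
  next
    case True
    have "closedin X (cls ` {a \<in> L. a j = 0})"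
      by (rule closedin_zeros) (use True in \<open>auto intro: poly_fun_var\<close>)
    moreover have "cls ` {a \<in> L. \<forall>i\<in>insert j I. i \<le> m \<longrightarrow> a i = 0} =
      cls ` {a \<in> L. a j = 0} \<inter> cls ` {a \<in> L. \<forall>i\<in>I. i \<le> m \<longrightarrow> a i = 0}" (is "?A = ?B \<inter> ?C")
    proof
      show "?A \<subseteq> ?B \<inter> ?C" using True by auto
      show "?B \<inter> ?C \<subseteq> ?A"
      proof
        fix x assume "x \<in> ?B \<inter> ?C"
        then obtain a b where ab: "a \<in> L" "a j = 0" "x = cls a" "b \<in> L"
          "\<forall>i\<in>I. i \<le> m \<longrightarrow> b i = 0" "x = cls b" by auto
        then obtain c where "c \<noteq> 0" "\<forall>i\<le>m. b i = c ^ w i * a i"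
          using cls_eq_iff[of a b] by auto
        then have "b j = 0" using True ab(2) by simp
        then have "b \<in> {a \<in> L. \<forall>i\<in>insert j I. i \<le> m \<longrightarrow> a i = 0}" using ab by simp
        then show "x \<in> ?A" unfolding ab(6) by (rule imageI)
      qed
    qed
    ultimately show ?thesis
      using insert.IH by (simp add: closedin_Int)
  qed
qed

lemma krull_dim_eq: "krull_dim X = enat m"
proof (rule antisym)
  show "krull_dim X \<le> enat m"
    unfolding krull_dim_def
  proof (rule Sup_least)
    fix x assume "x \<in> {enat n | n. \<exists>Z. (\<forall>i\<le>n. closedin X (Z i) \<and> irreducible_in X (Z i)) \<and>
      (\<forall>i<n. Z i \<subset> Z (Suc i))}"
    then obtain n Z where "x = enat n" "\<forall>i\<le>n. closedin X (Z i) \<and> irreducible_in X (Z i)"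
      "\<forall>i<n. Z i \<subset> Z (Suc i)"
      by blast
    with chain_length_le[of n Z] show "x \<le> enat m" by simp
  qed
next
  \<comment> \<open>\<open>max 1 j\<close> keeps \<open>a 0\<close> out of the vanishing conditions,
    as it is nonzero on \<open>L\<close>. The indices 0 and 1 share these conditions and are told
    apart by \<open>a 0 = 1\<close>.\<close>
  define S where "S j = {a \<in> L. (\<forall>i\<in>{max 1 j..<m}. i \<le> m \<longrightarrow> a i = 0) \<and> (j = 0 \<longrightarrow> a 0 = 1)}" for j
  define Z where "Z j = cls ` S j" for j
  have irr: "irreducible_in X (Z j)" for j
    unfolding Z_def
  proof (rule irreducible_linear_section)
    show "S j \<subseteq> L" by (auto simp: S_def)
    have "(\<lambda>i. if i = 0 \<or> i = m then 1 else 0) \<in> S j"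
      by (auto simp: S_def L_def)
    then show "S j \<noteq> {}" by blast
  qed (auto simp: S_def)
  \<comment> \<open>Scaling preserves the equations of \<open>S j\<close>, including
    \<open>a 0 = 1\<close> because \<open>w 0 = 0\<close>. Strictness can thus be tested on
    representatives.\<close>
  have Z_saturated: "a \<in> S j" if a: "a \<in> L" "cls a \<in> Z j" for a j
  proof -
    obtain b where b: "b \<in> S j" "cls a = cls b" using a unfolding Z_def by blast
    then obtain c where "c \<noteq> 0" "\<forall>i\<le>m. b i = c ^ w i * a i"
      using cls_eq_iff[of a b] a by (auto simp: S_def)
    then show ?thesis using b(1) a(1) w_0 by (auto simp: S_def)
  qed
  have closed: "closedin X (Z j)" for j
  proof (cases "j = 0")
    case False
    then show ?thesis
      unfolding Z_def S_def using closedin_coordinate_section[of "{max 1 j..<m}"] by simp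
  next
    case True
    have "closedin X (cls ` {a \<in> L. a 0 - 1 = 0})"
    proof (rule closedin_zeros)
      have "poly_fun (Suc m) (\<lambda>a. a 0 + (- 1 :: 'k))"
        by (intro monomial_span.add poly_fun_var poly_fun_const) simp
      then show "poly_fun (Suc m) (\<lambda>a. a 0 - (1 :: 'k))" by simp
    qed (simp add: w_0)
    moreover have "Z 0 = cls ` {a \<in> L. a 0 - 1 = 0} \<inter> cls ` {a \<in> L. \<forall>i\<in>{max 1 0..<m}. i \<le> m \<longrightarrow> a i = 0}"
      (is "_ = ?B \<inter> ?C")
    proof
      show "Z 0 \<subseteq> ?B \<inter> ?C" by (auto simp: Z_def S_def)
      show "?B \<inter> ?C \<subseteq> Z 0"
      proof
        fix x assume "x \<in> ?B \<inter> ?C"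
        then obtain a b where ab: "a \<in> L" "a 0 = 1" "x = cls a" "b \<in> L"
          "\<forall>i\<in>{max 1 0..<m}. i \<le> m \<longrightarrow> b i = 0" "x = cls b" by auto
        then obtain c where "c \<noteq> 0" "\<forall>i\<le>m. b i = c ^ w i * a i"
          using cls_eq_iff[of a b] by auto
        then have "b 0 = 1" using ab(2) w_0 by simp
        then have "b \<in> S 0" using ab by (simp add: S_def)
        then show "x \<in> Z 0" unfolding Z_def ab(6) by (rule imageI)
      qed
    qed
    ultimately show ?thesis
      using closedin_coordinate_section[of "{max 1 0..<m}"] True by (simp add: closedin_Int)
  qed
  have strict: "Z j \<subset> Z (Suc j)" if j: "j < m" for j
  proof -
    have "S j \<subseteq> S (Suc j)" by (auto simp: S_def)
    then have "Z j \<subseteq> Z (Suc j)" unfolding Z_def by blast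
    moreover have "Z j \<noteq> Z (Suc j)"
    proof (cases "j = 0")
      case False
      let ?a = "\<lambda>i. if i = 0 \<or> i = j \<or> i = m then 1 else 0 :: 'k"
      have a: "?a \<in> S (Suc j)" by (auto simp: S_def L_def)
      then have "?a \<notin> S j \<and> ?a \<in> L" using j False by (force simp: S_def)
      then have "cls ?a \<notin> Z j" using Z_saturated by blast
      then show ?thesis using a unfolding Z_def by blast
    next
      case True
      \<comment> \<open>A value of \<open>a 0\<close> other than 1, and other than 0 to stay in
        \<open>L\<close>, gives a class outside the bottom set.\<close>
      obtain t :: 'k where t: "t \<notin> {0, 1}"
        using ex_new_if_finite[OF infinite_UNIV_alg_closed] by (metis finite.emptyI finite_insert)
      let ?a = "\<lambda>i. if i = 0 then t else if i = m then 1 else 0"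
      have a: "?a \<in> S (Suc j)" using t True m_pos by (auto simp: S_def L_def)
      then have "?a \<notin> S j \<and> ?a \<in> L" using t True by (force simp: S_def)
      then have "cls ?a \<notin> Z j" using Z_saturated by blast
      then show ?thesis using a unfolding Z_def by blast
    qed
    ultimately show ?thesis by blast
  qed
  show "enat m \<le> krull_dim X"
    unfolding krull_dim_def
    by (rule Sup_upper) (use irr closed strict in blast)
qed

end

section \<open>Conjugation in homogeneous coordinates\<close>

text \<open>The binary form of degree \<open>n\<close> attached to \<open>P\<close>. The degree is a
  parameter because one of numerator and denominator may have smaller degree than the map; the drop
  is then a zero at infinity.\<close>

definition form_eval :: "nat \<Rightarrow> 'k::comm_ring_1 poly \<Rightarrow> 'k \<Rightarrow> 'k \<Rightarrow> 'k" where
  "form_eval n P x y = (\<Sum>i\<le>n. coeff P i * (x ^ i * y ^ (n - i)))"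

definition form_subst :: "nat \<Rightarrow> 'k::comm_ring_1 poly \<Rightarrow> 'k poly \<Rightarrow> 'k poly \<Rightarrow> 'k poly" where
  "form_subst n P X Y = (\<Sum>i\<le>n. smult (coeff P i) (X ^ i * Y ^ (n - i)))"

lemma poly_form_subst: "poly (form_subst n P X Y) z = form_eval n P (poly X z) (poly Y z)"
  by (simp add: form_subst_def form_eval_def poly_sum poly_power)

lemma form_eval_scale: "form_eval n P (t * x) (t * y) = t ^ n * form_eval n P x y"
proof -
  have "t ^ n = t ^ i * t ^ (n - i)" if "i \<le> n" for i
    using that by (simp flip: power_add)
  then show ?thesis
    unfolding form_eval_def sum_distrib_left
    by (intro sum.cong refl) (simp add: power_mult_distrib mult_ac)
qed

lemma form_eval_add: "form_eval n (P + Q) x y = form_eval n P x y + form_eval n Q x y"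
  by (simp add: form_eval_def algebra_simps sum.distrib)

lemma form_eval_smult: "form_eval n (smult c P) x y = c * form_eval n P x y"
  by (simp add: form_eval_def sum_distrib_left mult_ac)

lemma form_subst_add: "form_subst n (P + Q) X Y = form_subst n P X Y + form_subst n Q X Y"
  by (simp add: form_subst_def smult_add_left sum.distrib)

lemma smult_sum_right: "smult c (\<Sum>i\<in>A. f i) = (\<Sum>i\<in>A. smult c (f i))"
  by (induction A rule: infinite_finite_induct) (auto simp: smult_add_right)

lemma form_subst_smult: "form_subst n (smult c P) X Y = smult c (form_subst n P X Y)"
  by (simp add: form_subst_def smult_sum_right)

lemma poly_as_sum_le: "degree P \<le> n \<Longrightarrow> poly P x = (\<Sum>i\<le>n. coeff P i * x ^ i)"
  for P :: "'k::comm_ring_1 poly"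
  unfolding poly_altdef
  by (rule sum.mono_neutral_left) (auto simp: coeff_eq_0)

lemma form_eval_1: "degree P \<le> n \<Longrightarrow> form_eval n P x 1 = poly P x"
  by (simp add: form_eval_def poly_as_sum_le)

lemma form_eval_nonzero_snd:
  fixes x y :: "'k::field"
  assumes "degree P \<le> n" "y \<noteq> 0"
  shows "form_eval n P x y = y ^ n * poly P (x / y)"
  using form_eval_scale[of n P y "x / y" 1] form_eval_1[OF assms(1)] assms(2) by simp

lemma form_eval_0: "form_eval n P x 0 = coeff P n * x ^ n"
proof -
  have "form_eval n P x 0 = (\<Sum>i\<le>n. if i = n then coeff P n * x ^ n else 0)"
    unfolding form_eval_def by (intro sum.cong refl) (simp add: power_0_left)
  then show ?thesis by simp
qed

lemma degree_prod_powers_le: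
  assumes "degree X \<le> 1" "degree Y \<le> 1" "i \<le> n"
  shows "degree (X ^ i * Y ^ (n - i)) \<le> n"
proof -
  have "degree (X ^ i) \<le> 1 * i" "degree (Y ^ (n - i)) \<le> 1 * (n - i)"
    by (rule order_trans[OF degree_power_le mult_le_mono1]; rule assms)+
  then show ?thesis
    using degree_mult_le[of "X ^ i" "Y ^ (n - i)"] assms(3) by linarith
qed

lemma degree_form_subst_le:
  assumes "degree X \<le> 1" "degree Y \<le> 1"
  shows "degree (form_subst n P X Y) \<le> n"
  unfolding form_subst_def
  by (intro degree_sum_le order_trans[OF degree_smult_le] degree_prod_powers_le assms) auto

lemma coeff_linear_power: "coeff ([:b, a:] ^ i) i = (a::'k::comm_ring_1) ^ i"
proof (induction i)
  case (Suc i)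
  have "degree ([:b, a:] ^ i) \<le> 1 * i"
    by (rule order_trans[OF degree_power_le]) simp
  then have "coeff ([:b, a:] ^ i) (Suc i) = 0"
    by (intro coeff_eq_0) simp
  with Suc show ?case by (simp add: mult_pCons_left coeff_pCons_Suc)
qed simp

lemma coeff_mult_top:
  fixes p q :: "'k::comm_ring_1 poly"
  assumes "degree p \<le> i" "degree q \<le> j"
  shows "coeff (p * q) (i + j) = coeff p i * coeff q j"
proof -
  have "coeff (p * q) (i + j) = (\<Sum>k\<le>i + j. if k = i then coeff p i * coeff q j else 0)"
    unfolding coeff_mult
  proof (intro sum.cong refl)
    fix k
    show "coeff p k * coeff q (i + j - k) = (if k = i then coeff p i * coeff q j else 0)"
    proof (cases k i rule: linorder_cases)
      case less
      then have "coeff q (i + j - k) = 0" using assms(2) by (intro coeff_eq_0) linarith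
      then show ?thesis using less by simp
    next
      case greater
      then have "coeff p k = 0" using assms(1) by (intro coeff_eq_0) linarith
      then show ?thesis using greater by simp
    qed simp
  qed
  then show ?thesis by simp
qed

lemma coeff_linear_powers:
  assumes "i \<le> n"
  shows "coeff ([:b, a:] ^ i * [:d, c:] ^ (n - i)) n = (a::'k::comm_ring_1) ^ i * c ^ (n - i)"
proof -
  have "degree ([:b, a:] ^ i) \<le> 1 * i" "degree ([:d, c:] ^ (n - i)) \<le> 1 * (n - i)"
    by (rule order_trans[OF degree_power_le]; simp)+
  then have "coeff ([:b, a:] ^ i * [:d, c:] ^ (n - i)) (i + (n - i)) =
      coeff ([:b, a:] ^ i) i * coeff ([:d, c:] ^ (n - i)) (n - i)"
    by (intro coeff_mult_top) auto
  then show ?thesis using assms by (simp add: coeff_linear_power)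
qed

text \<open>The coefficient at \<open>n\<close> is the value of the form at infinity, which (a z +
  b) / (c z + d) sends to (a : c). It serves to control the degree of a conjugate.\<close>

lemma coeff_form_subst_top:
  "coeff (form_subst n P [:b, a:] [:d, c:]) n = form_eval n P a (c::'k::comm_ring_1)"
  unfolding form_subst_def form_eval_def coeff_sum
  by (intro sum.cong refl) (simp add: coeff_linear_powers)

text \<open>Both sides agree wherever \<open>Y'\<close> does not vanish.\<close>

lemma form_subst_form_subst:
  fixes X' Y' :: "'k::alg_closed_field poly"
  assumes "Y' \<noteq> 0"
  shows "form_subst n (form_subst n P [:-b, d:] [:a, -c:]) X' Y' =
    form_subst n P (smult d X' - smult b Y') (smult a Y' - smult c X')" (is "?A = ?B")
proof -
  have "?A - ?B = 0"
  proof (rule poly_eq_0_if_cofinite_roots)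
    show "finite {z. poly Y' z = 0}"
      using poly_roots_finite[OF assms] .
    fix z assume "z \<notin> {z. poly Y' z = 0}"
    then have z: "poly Y' z \<noteq> 0" by simp
    define x y where "x = poly X' z" and "y = poly Y' z"
    have y: "y \<noteq> 0" using z by (simp add: y_def)
    have "poly ?A z = y ^ n * form_eval n P (poly [:-b, d:] (x / y)) (poly [:a, -c:] (x / y))"
      unfolding poly_form_subst x_def[symmetric] y_def[symmetric]
      by (subst form_eval_nonzero_snd[OF degree_form_subst_le y]) (auto simp: poly_form_subst)
    also have "\<dots> = form_eval n P (y * poly [:-b, d:] (x / y)) (y * poly [:a, -c:] (x / y))"
      by (rule form_eval_scale[symmetric])
    also have "y * poly [:-b, d:] (x / y) = d * x - b * y"
      using y by (simp add: field_simps)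
    also have "y * poly [:a, -c:] (x / y) = a * y - c * x"
      using y by (simp add: field_simps)
    also have "form_eval n P (d * x - b * y) (a * y - c * x) = poly ?B z"
      by (simp add: poly_form_subst x_def y_def)
    finally show "poly (?A - ?B) z = 0" by simp
  qed
  then show ?thesis by simp
qed

section \<open>Rational maps in lowest terms and their composition\<close>

lemma coprime_poly_iff_no_common_root:
  fixes A B :: "'k::{alg_closed_field,field_gcd} poly"
  shows "coprime A B \<longleftrightarrow> (A \<noteq> 0 \<or> B \<noteq> 0) \<and> (\<forall>z. \<not> (poly A z = 0 \<and> poly B z = 0))"
proof (intro iffI conjI allI notI)
  fix z assume cop: "coprime A B" and "poly A z = 0 \<and> poly B z = 0"
  then have "[:-z, 1:] dvd A" "[:-z, 1:] dvd B" by (simp_all add: poly_eq_0_iff_dvd)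
  with cop have "is_unit [:-z, 1:]" by (rule coprime_common_divisor)
  then show False by (simp add: is_unit_pCons_iff)
next
  assume "coprime A B"
  then show "A \<noteq> 0 \<or> B \<noteq> 0" by auto
next
  assume AB: "(A \<noteq> 0 \<or> B \<noteq> 0) \<and> (\<forall>z. \<not> (poly A z = 0 \<and> poly B z = 0))"
  show "coprime A B"
  proof (rule coprimeI)
    fix C assume C: "C dvd A" "C dvd B"
    with AB have "C \<noteq> 0" by auto
    moreover have "degree C = 0"
    proof (rule ccontr)
      assume "degree C \<noteq> 0"
      then obtain z where "poly C z = 0" using alg_closed_imp_poly_has_root by blast
      with C AB show False by (metis dvdE mult_eq_0_iff poly_mult)
    qed
    ultimately show "is_unit C" by (simp add: is_unit_iff_degree)
  qed
qed

text \<open>After cross-multiplication, coprimality makes the two denominators divide each other, so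
  they differ by a unit, a nonzero constant. From here on the choice made by
  \<open>quot_of_fract\<close> is only a scalar \<open>r\<close>.\<close>

lemma quot_of_fract_coprime:
  fixes A B :: "'k::{alg_closed_field,field_gcd} poly"
  assumes "coprime A B" "B \<noteq> 0"
  obtains r where "r \<noteq> 0" "rat_num (Fract A B) = smult r A" "rat_den (Fract A B) = smult r B"
proof -
  let ?N = "rat_num (Fract A B)" and ?D = "rat_den (Fract A B)"
  have cop: "coprime ?N ?D" and D: "?D \<noteq> 0"
    by (simp_all add: rat_num_def rat_den_def coprime_quot_of_fract)
  have "Fract ?N ?D = Fract A B"
    by (simp add: rat_num_def rat_den_def)
  then have eq: "?N * B = A * ?D"
    using D assms(2) by (simp add: eq_fract)
  have "B dvd B * ?N" by simp
  also have "B * ?N = A * ?D" using eq by (simp add: mult.commute)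
  finally have "B dvd ?D"
    using assms(1) by (metis coprime_commute coprime_dvd_mult_right_iff)
  moreover have "?D dvd ?N * B" unfolding eq by simp
  then have "?D dvd B"
    using cop by (metis coprime_commute coprime_dvd_mult_right_iff)
  ultimately obtain u v where u: "?D = B * u" and "B = ?D * v"
    unfolding dvd_def by blast
  then have "B * (u * v) = B * 1"
    by (simp flip: mult.assoc)
  then have uv: "u * v = 1"
    using assms(2) by (simp only: mult_cancel_left) simp
  then have "degree u + degree v = 0"
    by (metis degree_1 degree_mult_eq mult_zero_left mult_zero_right zero_neq_one)
  then obtain r where r: "u = [:r:]" "r \<noteq> 0"
    using uv by (metis add_is_0 degree_eq_zeroE mult_zero_left pCons_0_0 zero_neq_one)
  have "?N * B = smult r A * B"
    using eq u r by (simp add: mult.commute)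
  then have "?N = smult r A" using assms(2) by (simp only: mult_cancel_right) simp
  moreover have "?D = smult r B" using u r by (simp add: mult.commute)
  ultimately show ?thesis using that r by blast
qed

lemma to_fract_sum: "to_fract (\<Sum>i\<in>A. f i) = (\<Sum>i\<in>A. to_fract (f i))"
  by (induction A rule: infinite_finite_induct) auto

lemma to_fract_power: "to_fract (x ^ n) = to_fract x ^ n"
  by (induction n) auto

lemma poly_at_rat_Fract:
  fixes X Y P :: "'k::{alg_closed_field,field_gcd} poly"
  assumes "degree P \<le> n" "Y \<noteq> 0"
  shows "poly_at_rat P (Fract X Y) = to_fract (form_subst n P X Y) / to_fract (Y ^ n)"
proof -
  let ?g = "Fract X Y"
  have "poly_at_rat P ?g = (\<Sum>i\<le>n. to_fract [:coeff P i:] * ?g ^ i)"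
    unfolding poly_at_rat_def
    by (subst poly_as_sum_le[of _ n])
      (use assms(1) in \<open>auto simp: coeff_map_poly coeff_eq_0 intro!: degree_le\<close>)
  then have "poly_at_rat P ?g * to_fract (Y ^ n) =
      (\<Sum>i\<le>n. to_fract [:coeff P i:] * ?g ^ i * to_fract Y ^ n)"
    by (simp add: sum_distrib_right to_fract_power)
  also have "\<dots> = (\<Sum>i\<le>n. to_fract (smult (coeff P i) (X ^ i * Y ^ (n - i))))"
  proof (intro sum.cong refl)
    fix i assume "i \<in> {..n}"
    then have n: "to_fract Y ^ n = to_fract Y ^ i * to_fract Y ^ (n - i)"
      by (simp flip: power_add)
    have "?g ^ i * to_fract Y ^ i = to_fract X ^ i"
      using assms(2) by (simp add: Fract_conv_to_fract power_divide)
    then have "?g ^ i * to_fract Y ^ n = to_fract X ^ i * to_fract Y ^ (n - i)"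
      unfolding n by (simp flip: mult.assoc)
    then have "to_fract [:coeff P i:] * ?g ^ i * to_fract Y ^ n =
        to_fract ([:coeff P i:] * (X ^ i * Y ^ (n - i)))"
      unfolding to_fract_mult to_fract_power by (simp only: mult.assoc)
    then show "to_fract [:coeff P i:] * ?g ^ i * to_fract Y ^ n =
        to_fract (smult (coeff P i) (X ^ i * Y ^ (n - i)))"
      by simp
  qed
  also have "\<dots> = to_fract (form_subst n P X Y)"
    by (simp only: form_subst_def to_fract_sum)
  finally show ?thesis
    using assms(2) by (simp add: nonzero_eq_divide_eq)
qed

lemma rat_comp_Fract:
  fixes A B X Y :: "'k::{alg_closed_field,field_gcd} poly"
  assumes "coprime A B" "B \<noteq> 0" "degree A \<le> n" "degree B \<le> n" "Y \<noteq> 0"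
  shows "rat_comp (Fract A B) (Fract X Y) = Fract (form_subst n A X Y) (form_subst n B X Y)"
proof -
  obtain r where r: "r \<noteq> 0" "rat_num (Fract A B) = smult r A" "rat_den (Fract A B) = smult r B"
    using quot_of_fract_coprime[OF assms(1,2)] by blast
  have "poly_at_rat (smult r A) (Fract X Y) = to_fract [:r:] * to_fract (form_subst n A X Y) / to_fract (Y ^ n)"
    using assms by (subst poly_at_rat_Fract[of _ n]) (auto simp: form_subst_smult simp flip: to_fract_mult)
  moreover have "poly_at_rat (smult r B) (Fract X Y) = to_fract [:r:] * to_fract (form_subst n B X Y) / to_fract (Y ^ n)"
    using assms by (subst poly_at_rat_Fract[of _ n]) (auto simp: form_subst_smult simp flip: to_fract_mult)
  moreover have "to_fract [:r:] \<noteq> 0" "to_fract (Y ^ n) \<noteq> 0"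
    using r(1) assms(5) by simp_all
  ultimately show ?thesis
    unfolding rat_comp_def r(2,3) by (simp add: Fract_conv_to_fract)
qed

section \<open>The conjugation action of invertible matrices on pairs of forms\<close>

lemma linear_coprime:
  fixes a b c d :: "'k::{alg_closed_field,field_gcd}"
  assumes "a * d - b * c \<noteq> 0"
  shows "coprime [:b, a:] [:d, c:]" "[:d, c:] \<noteq> 0"
proof -
  show nz: "[:d, c:] \<noteq> 0" using assms by auto
  have "\<not> (poly [:b, a:] z = 0 \<and> poly [:d, c:] z = 0)" for z
  proof
    assume *: "poly [:b, a:] z = 0 \<and> poly [:d, c:] z = 0"
    have "a * d - b * c = a * poly [:d, c:] z - c * poly [:b, a:] z"
      by (simp add: algebra_simps)
    with * assms show False by simp
  qed
  with nz show "coprime [:b, a:] [:d, c:]"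
    by (simp only: coprime_poly_iff_no_common_root) simp
qed

text \<open>Numerator and denominator of \<open>\<alpha> \<circ> (P/Q) \<circ> \<alpha>\<inverse>\<close> for \<open>\<alpha>(z) = (a z + b) / (c z + d)\<close>.\<close>

definition conj_num :: "nat \<Rightarrow> 'k::field \<Rightarrow> 'k \<Rightarrow> 'k \<Rightarrow> 'k \<Rightarrow> 'k poly \<Rightarrow> 'k poly \<Rightarrow> 'k poly" where
  "conj_num n a b c d P Q = form_subst n (smult a P + smult b Q) [:-b, d:] [:a, -c:]"

definition conj_den :: "nat \<Rightarrow> 'k::field \<Rightarrow> 'k \<Rightarrow> 'k \<Rightarrow> 'k \<Rightarrow> 'k poly \<Rightarrow> 'k poly \<Rightarrow> 'k poly" where
  "conj_den n a b c d P Q = form_subst n (smult c P + smult d Q) [:-b, d:] [:a, -c:]"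

lemma conj_num_smult: "conj_num n a b c d (smult r P) (smult r Q) = smult r (conj_num n a b c d P Q)"
  and conj_den_smult: "conj_den n a b c d (smult r P) (smult r Q) = smult r (conj_den n a b c d P Q)"
  by (simp_all add: conj_num_def conj_den_def form_subst_add form_subst_smult smult_add_right mult.commute)

text \<open>The adjugate reverses products, so conjugating twice is conjugating by the matrix
  product. This is an exact identity of polynomials, with no scalar to keep track of.\<close>

lemma conj_compose:
  fixes a b c d a' b' c' d' :: "'k::alg_closed_field"
  assumes "a' * d' - b' * c' \<noteq> 0"
  shows "conj_num n a' b' c' d' (conj_num n a b c d P Q) (conj_den n a b c d P Q) =
      conj_num n (a' * a + b' * c) (a' * b + b' * d) (c' * a + d' * c) (c' * b + d' * d) P Q"
    and "conj_den n a' b' c' d' (conj_num n a b c d P Q) (conj_den n a b c d P Q) =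
      conj_den n (a' * a + b' * c) (a' * b + b' * d) (c' * a + d' * c) (c' * b + d' * d) P Q"
proof -
  have nz: "[:a', - c':] \<noteq> 0" using assms by auto
  have lin: "smult s (conj_num n a b c d P Q) + smult t (conj_den n a b c d P Q) =
      form_subst n (smult (s * a + t * c) P + smult (s * b + t * d) Q) [:-b, d:] [:a, -c:]" for s t
    by (simp add: conj_num_def conj_den_def form_subst_add form_subst_smult smult_add_right
        smult_add_left algebra_simps)
  have X: "smult d [:- b', d':] - smult b [:a', - c':] = [:- (a' * b + b' * d), c' * b + d' * d:]"
    and Y: "smult a [:a', - c':] - smult c [:- b', d':] = [:a' * a + b' * c, - (c' * a + d' * c):]"
    by (simp_all add: algebra_simps)
  show "conj_num n a' b' c' d' (conj_num n a b c d P Q) (conj_den n a b c d P Q) =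
      conj_num n (a' * a + b' * c) (a' * b + b' * d) (c' * a + d' * c) (c' * b + d' * d) P Q"
    unfolding conj_num_def[of _ a' b' c' d'] lin form_subst_form_subst[OF nz] X Y
    unfolding conj_num_def ..
  show "conj_den n a' b' c' d' (conj_num n a b c d P Q) (conj_den n a b c d P Q) =
      conj_den n (a' * a + b' * c) (a' * b + b' * d) (c' * a + d' * c) (c' * b + d' * d) P Q"
    unfolding conj_den_def[of _ a' b' c' d'] lin form_subst_form_subst[OF nz] X Y
    unfolding conj_den_def ..
qed

lemma form_subst_scalar:
  assumes "degree P \<le> n"
  shows "form_subst n P [:0, t:] [:t:] = smult (t ^ n) (P :: 'k::alg_closed_field poly)"
proof -
  have "form_subst n P [:0, t:] [:t:] - smult (t ^ n) P = 0"
  proof (rule poly_eq_0_if_cofinite_roots[of "{}"])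
    fix z
    have "form_eval n P (t * z) (t * 1) = t ^ n * form_eval n P z 1"
      by (rule form_eval_scale)
    then show "poly (form_subst n P [:0, t:] [:t:] - smult (t ^ n) P) z = 0"
      using assms by (simp add: poly_form_subst form_eval_1 mult.commute)
  qed simp
  then show ?thesis by simp
qed

text \<open>A scalar matrix fixes the map but rescales the pair: \<open>t ^ n\<close> comes from the
  substitution and one more \<open>t\<close> from the outer matrix.\<close>

lemma conj_scalar:
  assumes "degree P \<le> n" "degree Q \<le> n"
  shows "conj_num n t 0 0 t P Q = smult (t ^ Suc n) (P :: 'k::alg_closed_field poly)"
    and "conj_den n t 0 0 t P Q = smult (t ^ Suc n) Q"
  using assms by (simp_all add: conj_num_def conj_den_def form_subst_smult form_subst_scalar)

lemma rat_maps_properties: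
  assumes "f \<in> rat_maps n"
  shows "coprime (rat_num f) (rat_den f)" "rat_den f \<noteq> 0" "degree (rat_num f) \<le> n"
    "degree (rat_den f) \<le> n" "coeff (rat_num f) n \<noteq> 0 \<or> coeff (rat_den f) n \<noteq> 0 \<or> n = 0"
    "f = Fract (rat_num f) (rat_den f)"
proof -
  show "coprime (rat_num f) (rat_den f)" "rat_den f \<noteq> 0" "f = Fract (rat_num f) (rat_den f)"
    by (simp_all add: rat_num_def rat_den_def coprime_quot_of_fract)
  have n: "max (degree (rat_num f)) (degree (rat_den f)) = n"
    using assms by (simp add: rat_maps_def rat_degree_def)
  then show "degree (rat_num f) \<le> n" "degree (rat_den f) \<le> n" by auto
  show "coeff (rat_num f) n \<noteq> 0 \<or> coeff (rat_den f) n \<noteq> 0 \<or> n = 0"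
    using n by (metis degree_0 leading_coeff_0_iff max_def)
qed

lemma rat_mapsI:
  fixes A B :: "'k::{alg_closed_field,field_gcd} poly"
  assumes "coprime A B" "B \<noteq> 0" "degree A \<le> n" "degree B \<le> n" "coeff A n \<noteq> 0 \<or> coeff B n \<noteq> 0"
  shows "Fract A B \<in> rat_maps n"
proof -
  obtain r where r: "r \<noteq> 0" "rat_num (Fract A B) = smult r A" "rat_den (Fract A B) = smult r B"
    using quot_of_fract_coprime[OF assms(1,2)] by blast
  have "degree A \<ge> n \<or> degree B \<ge> n"
    using assms(5) le_degree by blast
  then show ?thesis
    using assms(3,4) r by (auto simp: rat_maps_def rat_degree_def max_def)
qed

text \<open>A pair of exact degree \<open>n\<close> has no base point on the projective line:
  coprimality excludes the affine points, and the coefficients at \<open>n\<close> exclude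
  infinity.\<close>

lemma form_eval_common_zero:
  fixes P Q :: "'k::{alg_closed_field,field_gcd} poly"
  assumes "coprime P Q" "degree P \<le> n" "degree Q \<le> n" "coeff P n \<noteq> 0 \<or> coeff Q n \<noteq> 0"
    and "form_eval n P x y = 0" "form_eval n Q x y = 0"
  shows "x = 0 \<and> y = 0"
proof (cases "y = 0")
  case True
  then show ?thesis using assms(4-6) by (auto simp: form_eval_0)
next
  case False
  then have "poly P (x / y) = 0" "poly Q (x / y) = 0"
    using assms by (auto simp: form_eval_nonzero_snd)
  then show ?thesis
    using assms(1) coprime_poly_iff_no_common_root by blast
qed

lemma linear_system_zero:
  fixes u v :: "'k::field"
  assumes "a * d - b * c \<noteq> 0" "a * u + b * v = 0" "c * u + d * v = 0"
  shows "u = 0 \<and> v = 0"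
proof -
  have "(a * d - b * c) * u = d * (a * u + b * v) - b * (c * u + d * v)"
    "(a * d - b * c) * v = a * (c * u + d * v) - c * (a * u + b * v)"
    by (simp_all add: algebra_simps)
  then show ?thesis using assms by simp
qed

text \<open>Coprimality and exact degree together say that the two forms have no common zero, which
  an invertible linear change of the forms or of the variables preserves. \<open>common\<close> is
  applied at affine points and at infinity.\<close>

lemma conj_properties:
  fixes f :: "'k::{alg_closed_field,field_gcd} poly fract"
  assumes f: "f \<in> rat_maps n" and n: "n > 0" and det: "a * d - b * c \<noteq> 0"
  defines "A \<equiv> conj_num n a b c d (rat_num f) (rat_den f)"
    and "B \<equiv> conj_den n a b c d (rat_num f) (rat_den f)"
  shows "coprime A B" "B \<noteq> 0" "degree A \<le> n" "degree B \<le> n" "coeff A n \<noteq> 0 \<or> coeff B n \<noteq> 0"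
    "rat_comp (rat_comp (moebius_rat a b c d) f) (moebius_rat d (- b) (- c) a) = Fract A B"
proof -
  define P Q where "P = rat_num f" and "Q = rat_den f"
  note f_props = rat_maps_properties[OF f, folded P_def Q_def]
  have top: "coeff P n \<noteq> 0 \<or> coeff Q n \<noteq> 0" using f_props(5) n by simp
  have common: "x = 0 \<and> y = 0"
    if "form_eval n (smult a P + smult b Q) x y = 0" "form_eval n (smult c P + smult d Q) x y = 0" for x y
  proof -
    have "form_eval n P x y = 0 \<and> form_eval n Q x y = 0"
      by (rule linear_system_zero[OF det]) (use that in \<open>simp_all add: form_eval_add form_eval_smult\<close>)
    then show ?thesis
      using form_eval_common_zero[OF f_props(1,3,4) top] by blast
  qed
  show degA: "degree A \<le> n" and degB: "degree B \<le> n"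
    unfolding A_def B_def conj_num_def conj_den_def by (intro degree_form_subst_le; simp)+
  have ev: "poly A z = form_eval n (smult a P + smult b Q) (d * z - b) (a - c * z)"
    "poly B z = form_eval n (smult c P + smult d Q) (d * z - b) (a - c * z)" for z
    by (simp_all add: A_def B_def conj_num_def conj_den_def poly_form_subst P_def Q_def mult.commute)
  have no_root: "\<not> (poly A z = 0 \<and> poly B z = 0)" for z
  proof
    assume "poly A z = 0 \<and> poly B z = 0"
    then have "d * z - b = 0 \<and> a - c * z = 0"
      by (intro common) (simp_all add: ev)
    then have "b = d * z" "a = c * z" by auto
    then have "a * d - b * c = 0" by simp
    with det show False by simp
  qed
  show top': "coeff A n \<noteq> 0 \<or> coeff B n \<noteq> 0"
  proof (rule ccontr)
    assume "\<not> (coeff A n \<noteq> 0 \<or> coeff B n \<noteq> 0)"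
    then have "d = 0 \<and> - c = 0"
      by (intro common) (simp_all add: A_def B_def conj_num_def conj_den_def coeff_form_subst_top P_def Q_def)
    with det show False by simp
  qed
  then have "A \<noteq> 0 \<or> B \<noteq> 0" by auto
  with no_root show cop: "coprime A B"
    by (simp add: coprime_poly_iff_no_common_root)
  show B0: "B \<noteq> 0"
  proof
    assume B: "B = 0"
    then have "is_unit A" using cop by simp
    then have "degree A = 0" using is_unit_iff_degree[of A] by fastforce
    then have "coeff A n = 0" using n by (simp add: coeff_eq_0)
    with top' B show False by simp
  qed
  define P1 Q1 where "P1 = smult a P + smult b Q" and "Q1 = smult c P + smult d Q"
  have deg1: "degree P1 \<le> n" "degree Q1 \<le> n"
    unfolding P1_def Q1_def using f_props(3,4)
    by (auto intro!: degree_add_le intro: order_trans[OF degree_smult_le])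
  have no_root1: "\<not> (poly P1 z = 0 \<and> poly Q1 z = 0)" for z
    using common[of z 1] deg1 by (auto simp: form_eval_1 P1_def Q1_def)
  have Q1: "Q1 \<noteq> 0"
  proof
    assume "Q1 = 0"
    then have "B = form_subst n 0 [:-b, d:] [:a, -c:]"
      by (simp add: B_def conj_den_def Q1_def P_def Q_def)
    then show False using B0 by (simp add: form_subst_def)
  qed
  then have cop1: "coprime P1 Q1"
    using no_root1 by (simp add: coprime_poly_iff_no_common_root)
  have f_eq: "f = Fract P Q" and Q0: "Q \<noteq> 0"
    using f_props by simp_all
  have "rat_comp (moebius_rat a b c d) f = Fract (form_subst 1 [:b, a:] P Q) (form_subst 1 [:d, c:] P Q)"
    unfolding moebius_rat_def f_eq
    by (rule rat_comp_Fract) (use linear_coprime[OF det] Q0 in auto)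
  also have "form_subst 1 [:b, a:] P Q = P1"
    by (simp add: form_subst_def P1_def add.commute)
  also have "form_subst 1 [:d, c:] P Q = Q1"
    by (simp add: form_subst_def Q1_def add.commute)
  finally have "rat_comp (moebius_rat a b c d) f = Fract P1 Q1" .
  moreover have "rat_comp (Fract P1 Q1) (moebius_rat d (- b) (- c) a) =
      Fract (form_subst n P1 [:-b, d:] [:a, -c:]) (form_subst n Q1 [:-b, d:] [:a, -c:])"
    unfolding moebius_rat_def
    by (rule rat_comp_Fract[OF cop1 Q1 deg1]) (use det in auto)
  ultimately show "rat_comp (rat_comp (moebius_rat a b c d) f) (moebius_rat d (- b) (- c) a) = Fract A B"
    by (simp add: A_def B_def conj_num_def conj_den_def P1_def Q1_def P_def Q_def)
qed

lemma conj_exists: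
  fixes f :: "'k::{alg_closed_field,field_gcd} poly fract"
  assumes f: "f \<in> rat_maps n" and n: "n > 0" and det: "a * d - b * c \<noteq> 0"
  obtains g r where "(f, g) \<in> conj_rel n" "r \<noteq> 0"
    "rat_num g = smult r (conj_num n a b c d (rat_num f) (rat_den f))"
    "rat_den g = smult r (conj_den n a b c d (rat_num f) (rat_den f))"
proof -
  note props = conj_properties[OF assms]
  let ?g = "Fract (conj_num n a b c d (rat_num f) (rat_den f)) (conj_den n a b c d (rat_num f) (rat_den f))"
  have "?g \<in> rat_maps n" by (rule rat_mapsI[OF props(1-5)])
  then have "(f, ?g) \<in> conj_rel n"
    unfolding conj_rel_def lin_conjugate_def using f det props(6)[symmetric] by blast
  moreover obtain r where "r \<noteq> 0"
    "rat_num ?g = smult r (conj_num n a b c d (rat_num f) (rat_den f))"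
    "rat_den ?g = smult r (conj_den n a b c d (rat_num f) (rat_den f))"
    by (rule quot_of_fract_coprime[OF props(1,2)])
  ultimately show ?thesis by (rule that)
qed

text \<open>Conjugacy in the function field becomes an identity between coefficient vectors;
  \<open>r\<close> absorbs the normalisation of the denominator.\<close>

lemma conj_rel_iff:
  fixes f g :: "'k::{alg_closed_field,field_gcd} poly fract"
  assumes n: "n > 0"
  shows "(f, g) \<in> conj_rel n \<longleftrightarrow> f \<in> rat_maps n \<and> g \<in> rat_maps n \<and>
    (\<exists>a b c d r. a * d - b * c \<noteq> 0 \<and> r \<noteq> 0 \<and>
      rat_num g = smult r (conj_num n a b c d (rat_num f) (rat_den f)) \<and>
      rat_den g = smult r (conj_den n a b c d (rat_num f) (rat_den f)))" (is "?l \<longleftrightarrow> ?r")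
proof
  assume ?l
  then obtain a b c d where f: "f \<in> rat_maps n" and g: "g \<in> rat_maps n" and det: "a * d - b * c \<noteq> 0"
    and eq: "g = rat_comp (rat_comp (moebius_rat a b c d) f) (moebius_rat d (- b) (- c) a)"
    by (auto simp: conj_rel_def lin_conjugate_def)
  note props = conj_properties[OF f n det]
  obtain r where "r \<noteq> 0" "rat_num g = smult r (conj_num n a b c d (rat_num f) (rat_den f))"
    "rat_den g = smult r (conj_den n a b c d (rat_num f) (rat_den f))"
    unfolding eq props(6) by (rule quot_of_fract_coprime[OF props(1,2)])
  with f g det show ?r by blast
next
  assume ?r
  then obtain a b c d r where f: "f \<in> rat_maps n" and g: "g \<in> rat_maps n" and det: "a * d - b * c \<noteq> 0"
    and r: "r \<noteq> 0" "rat_num g = smult r (conj_num n a b c d (rat_num f) (rat_den f))"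
      "rat_den g = smult r (conj_den n a b c d (rat_num f) (rat_den f))" by blast
  note props = conj_properties[OF f n det]
  have "g = Fract (rat_num g) (rat_den g)"
    by (rule rat_maps_properties(6)[OF g])
  also have "\<dots> = Fract (conj_num n a b c d (rat_num f) (rat_den f)) (conj_den n a b c d (rat_num f) (rat_den f))"
    using r props(2) by (simp add: eq_fract)
  also have "\<dots> = rat_comp (rat_comp (moebius_rat a b c d) f) (moebius_rat d (- b) (- c) a)"
    by (rule props(6)[symmetric])
  finally show ?l
    using f g det unfolding conj_rel_def lin_conjugate_def by blast
qed

lemma equiv_conj_rel:
  assumes n: "n > 0"
  shows "equiv (rat_maps n :: 'k::{alg_closed_field,field_gcd} poly fract set) (conj_rel n)"
proof (rule equivI)
  let ?R = "conj_rel n :: 'k poly fract rel"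
  show "?R \<subseteq> rat_maps n \<times> rat_maps n"
    by (auto simp: conj_rel_def)
  show "refl_on (rat_maps n) ?R"
    unfolding refl_on_def
  proof
    fix f :: "'k poly fract" assume f: "f \<in> rat_maps n"
    note props = rat_maps_properties[OF f]
    show "(f, f) \<in> conj_rel n"
      unfolding conj_rel_iff[OF n]
      by (intro conjI f, rule exI[of _ 1], rule exI[of _ 0], rule exI[of _ 0], rule exI[of _ 1],
          rule exI[of _ 1]) (simp_all add: conj_scalar[OF props(3,4)])
  qed
  show "sym ?R"
  proof (rule symI)
    fix f g :: "'k poly fract" assume fg: "(f, g) \<in> conj_rel n"
    then obtain a b c d r where f: "f \<in> rat_maps n" and g: "g \<in> rat_maps n" and det: "a * d - b * c \<noteq> 0"
      and r: "r \<noteq> 0" "rat_num g = smult r (conj_num n a b c d (rat_num f) (rat_den f))"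
        "rat_den g = smult r (conj_den n a b c d (rat_num f) (rat_den f))"
      unfolding conj_rel_iff[OF n] by blast
    note props = rat_maps_properties[OF f]
    let ?D = "a * d - b * c"
    have det': "d * a - (- b) * (- c) \<noteq> 0" using det by (simp add: mult.commute)
    have coeffs: "d * a + (- b) * c = ?D" "d * b + (- b) * d = 0" "(- c) * a + a * c = 0"
      "(- c) * b + a * d = ?D"
      by (simp_all add: algebra_simps)
    \<comment> \<open>The adjugate times the matrix is the scalar matrix of the determinant, which
      contributes \<open>?D ^ Suc n\<close>.\<close>
    define t where "t = r * ?D ^ Suc n"
    have t: "t \<noteq> 0" using r det by (simp add: t_def)
    have "conj_num n d (- b) (- c) a (rat_num g) (rat_den g) = smult t (rat_num f)"
      "conj_den n d (- b) (- c) a (rat_num g) (rat_den g) = smult t (rat_den f)"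
      unfolding r(2,3) conj_num_smult conj_den_smult conj_compose[OF det'] coeffs
        conj_scalar[OF props(3,4)] by (simp_all add: t_def)
    then have "rat_num f = smult (inverse t) (conj_num n d (- b) (- c) a (rat_num g) (rat_den g))"
      "rat_den f = smult (inverse t) (conj_den n d (- b) (- c) a (rat_num g) (rat_den g))"
      "inverse t \<noteq> 0"
      using t by simp_all
    then show "(g, f) \<in> conj_rel n"
      unfolding conj_rel_iff[OF n] using f g det' by blast
  qed
  show "trans ?R"
  proof (rule transI)
    fix f g h :: "'k poly fract" assume fg: "(f, g) \<in> conj_rel n" and gh: "(g, h) \<in> conj_rel n"
    from fg obtain a b c d r where f: "f \<in> rat_maps n" and det: "a * d - b * c \<noteq> 0"
      and r: "r \<noteq> 0" "rat_num g = smult r (conj_num n a b c d (rat_num f) (rat_den f))"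
        "rat_den g = smult r (conj_den n a b c d (rat_num f) (rat_den f))"
      unfolding conj_rel_iff[OF n] by blast
    from gh obtain a' b' c' d' r' where h: "h \<in> rat_maps n" and det': "a' * d' - b' * c' \<noteq> 0"
      and r': "r' \<noteq> 0" "rat_num h = smult r' (conj_num n a' b' c' d' (rat_num g) (rat_den g))"
        "rat_den h = smult r' (conj_den n a' b' c' d' (rat_num g) (rat_den g))"
      unfolding conj_rel_iff[OF n] by blast
    let ?a = "a' * a + b' * c" and ?b = "a' * b + b' * d" and ?c = "c' * a + d' * c"
      and ?d = "c' * b + d' * d"
    have "?a * ?d - ?b * ?c = (a' * d' - b' * c') * (a * d - b * c)"
      by (simp add: algebra_simps)
    then have det'': "?a * ?d - ?b * ?c \<noteq> 0" using det det' by simp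
    have "rat_num h = smult (r' * r) (conj_num n ?a ?b ?c ?d (rat_num f) (rat_den f))"
      "rat_den h = smult (r' * r) (conj_den n ?a ?b ?c ?d (rat_num f) (rat_den f))"
      unfolding r'(2,3) r(2,3) conj_num_smult conj_den_smult conj_compose[OF det'] by simp_all
    moreover have "r' * r \<noteq> 0" using r r' by simp
    ultimately show "(f, h) \<in> conj_rel n"
      unfolding conj_rel_iff[OF n] using f h det'' by blast
  qed
qed

section \<open>Homogeneous functions and the topology of the moduli space\<close>

definition homogeneous_fun :: "nat \<Rightarrow> nat \<Rightarrow> ((nat \<Rightarrow> 'k::comm_ring_1) \<Rightarrow> 'k) \<Rightarrow> bool" where
  "homogeneous_fun N n = monomial_span N {e. (\<Sum>i<N. e i) = n}"

lemma homogeneous_fun_zero: "homogeneous_fun N n (\<lambda>x. 0)"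
  unfolding homogeneous_fun_def by (rule monomial_span.zero)

lemma homogeneous_fun_add:
  "homogeneous_fun N n f \<Longrightarrow> homogeneous_fun N n g \<Longrightarrow> homogeneous_fun N n (\<lambda>x. f x + g x)"
  unfolding homogeneous_fun_def by (rule monomial_span.add)

lemma homogeneous_fun_sum:
  "(\<And>s. s \<in> S \<Longrightarrow> homogeneous_fun N n (f s)) \<Longrightarrow> homogeneous_fun N n (\<lambda>x. \<Sum>s\<in>S. f s x)"
  unfolding homogeneous_fun_def by (rule monomial_span_sum)

lemma homogeneous_fun_const: "homogeneous_fun N 0 (\<lambda>x. c)"
  using monomial_span.mono[of "\<lambda>_. 0" "{e. (\<Sum>i<N. e i) = 0}" N c]
  by (simp add: homogeneous_fun_def)

lemma homogeneous_fun_var: "j < N \<Longrightarrow> homogeneous_fun N 1 (\<lambda>x. x j)"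
  unfolding homogeneous_fun_def by (rule monomial_span_var) auto

lemma homogeneous_fun_mult:
  "homogeneous_fun N n f \<Longrightarrow> homogeneous_fun N n' g \<Longrightarrow> homogeneous_fun N (n + n') (\<lambda>x. f x * g x)"
  unfolding homogeneous_fun_def by (rule monomial_span_mult) (auto simp: sum.distrib)

lemma homogeneous_fun_cmult: "homogeneous_fun N n f \<Longrightarrow> homogeneous_fun N n (\<lambda>x. c * f x)"
  using homogeneous_fun_mult[OF homogeneous_fun_const, of N n f c] by simp

lemma homogeneous_fun_uminus: "homogeneous_fun N n f \<Longrightarrow> homogeneous_fun N n (\<lambda>x. - f x)"
  using homogeneous_fun_cmult[of N n f "-1"] by simp

lemma homogeneous_fun_power: "homogeneous_fun N n f \<Longrightarrow> homogeneous_fun N (n * k) (\<lambda>x. f x ^ k)"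
  by (induction k) (auto intro: homogeneous_fun_mult homogeneous_fun_const)

lemma homogeneous_fun_prod:
  assumes "\<And>s. s \<in> S \<Longrightarrow> homogeneous_fun N (n s) (f s)"
  shows "homogeneous_fun N (\<Sum>s\<in>S. n s) (\<lambda>x. \<Prod>s\<in>S. f s x)"
  using assms
  by (induction S rule: infinite_finite_induct)
    (auto intro: homogeneous_fun_mult homogeneous_fun_const)

lemma homogeneous_fun_subst:
  assumes "homogeneous_fun N n f" "\<And>i. i < N \<Longrightarrow> homogeneous_fun K r (s i)"
  shows "homogeneous_fun K (r * n) (\<lambda>x. f (\<lambda>i. s i x))"
  using assms(1) unfolding homogeneous_fun_def[of N]
proof (induction rule: monomial_span.induct)
  case (mono e c)
  have "homogeneous_fun K (\<Sum>i<N. r * e i) (\<lambda>x. \<Prod>i<N. s i x ^ e i)"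
    by (intro homogeneous_fun_prod homogeneous_fun_power assms(2)) auto
  then show ?case
    using mono by (intro homogeneous_fun_cmult) (simp flip: sum_distrib_left)
qed (auto intro: homogeneous_fun_zero homogeneous_fun_add)

lemma homogeneous_fun_scale:
  "homogeneous_fun N n f \<Longrightarrow> f (\<lambda>i. c * x i) = c ^ n * f x"
  using monomial_span_homogeneous[of N "\<lambda>_. 1" n f c x] by (simp add: homogeneous_fun_def)

text \<open>Since all \<open>s i\<close> and \<open>t\<close> have the same degree \<open>r\<close>,
  multiplying by a power of \<open>t\<close> clears the denominators and makes every monomial of
  \<open>P\<close> homogeneous of the same degree.\<close>

lemma homogenization:
  fixes P :: "(nat \<Rightarrow> 'k::field) \<Rightarrow> 'k"
  assumes "poly_fun N P"
    and s: "\<And>i. i < N \<Longrightarrow> homogeneous_fun K r (s i)" and t: "homogeneous_fun K r t"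
  shows "\<exists>M h. homogeneous_fun K (r * M) h \<and>
    (\<forall>x. t x \<noteq> 0 \<longrightarrow> h x = t x ^ M * P (\<lambda>i. s i x / t x))"
proof -
  \<comment> \<open>Strengthened to all large exponents, so that the two summands of a sum can be
    given a common one.\<close>
  have "\<exists>M. \<forall>n\<ge>M. \<exists>h. homogeneous_fun K (r * n) h \<and>
    (\<forall>x. t x \<noteq> 0 \<longrightarrow> h x = t x ^ n * P (\<lambda>i. s i x / t x))"
    using assms(1)
  proof (induction rule: monomial_span.induct)
    case zero
    show ?case by (intro exI[of _ 0] allI impI exI[of _ "\<lambda>_. 0"]) (auto intro: homogeneous_fun_zero)
  next
    case (mono e c)
    let ?M = "\<Sum>i<N. e i"
    show ?case
    proof (intro exI[of _ ?M] allI impI)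
      fix n assume n: "?M \<le> n"
      let ?h = "\<lambda>x. c * ((\<Prod>i<N. s i x ^ e i) * t x ^ (n - ?M))"
      have "homogeneous_fun K ((\<Sum>i<N. r * e i) + r * (n - ?M)) ?h"
        by (intro homogeneous_fun_cmult homogeneous_fun_mult homogeneous_fun_prod
            homogeneous_fun_power s t) auto
      also have "(\<Sum>i<N. r * e i) + r * (n - ?M) = r * n"
        using n by (simp flip: sum_distrib_left distrib_left)
      finally have "homogeneous_fun K (r * n) ?h" .
      moreover have "?h x = t x ^ n * (c * (\<Prod>i<N. (s i x / t x) ^ e i))" if "t x \<noteq> 0" for x
      proof -
        have "(\<Prod>i<N. (s i x / t x) ^ e i) = (\<Prod>i<N. s i x ^ e i) / t x ^ ?M"
          by (simp add: power_divide prod_dividef power_sum)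
        moreover have "t x ^ n = t x ^ ?M * t x ^ (n - ?M)"
          using n by (simp flip: power_add)
        ultimately show ?thesis using that by simp
      qed
      ultimately show "\<exists>h. homogeneous_fun K (r * n) h \<and>
          (\<forall>x. t x \<noteq> 0 \<longrightarrow> h x = t x ^ n * (c * (\<Prod>i<N. (s i x / t x) ^ e i)))"
        by blast
    qed
  next
    case (add f g)
    from add.IH obtain M M' where
      M: "\<forall>n\<ge>M. \<exists>h. homogeneous_fun K (r * n) h \<and>
        (\<forall>x. t x \<noteq> 0 \<longrightarrow> h x = t x ^ n * f (\<lambda>i. s i x / t x))"
      and M': "\<forall>n\<ge>M'. \<exists>h. homogeneous_fun K (r * n) h \<and>
        (\<forall>x. t x \<noteq> 0 \<longrightarrow> h x = t x ^ n * g (\<lambda>i. s i x / t x))"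
      by (elim exE)
    show ?case
    proof (intro exI[of _ "max M M'"] allI impI)
      fix n assume n: "max M M' \<le> n"
      from M[rule_format, of n] n obtain h where h: "homogeneous_fun K (r * n) h"
        "\<forall>x. t x \<noteq> 0 \<longrightarrow> h x = t x ^ n * f (\<lambda>i. s i x / t x)" by auto
      from M'[rule_format, of n] n obtain h' where h': "homogeneous_fun K (r * n) h'"
        "\<forall>x. t x \<noteq> 0 \<longrightarrow> h' x = t x ^ n * g (\<lambda>i. s i x / t x)" by auto
      show "\<exists>h. homogeneous_fun K (r * n) h \<and>
        (\<forall>x. t x \<noteq> 0 \<longrightarrow> h x = t x ^ n * (f (\<lambda>i. s i x / t x) + g (\<lambda>i. s i x / t x)))"
        using homogeneous_fun_add[OF h(1) h'(1)] h(2) h'(2)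
        by (intro exI[of _ "\<lambda>x. h x + h' x"]) (simp add: distrib_left)
    qed
  qed
  then show ?thesis by blast
qed

section \<open>Comparison with formal polynomials, and basic open sets\<close>

lemma multipoly_eval_superset:
  assumes "finite S" "Poly_Mapping.keys P \<subseteq> S"
  shows "multipoly_eval P x = (\<Sum>\<mu>\<in>S. Poly_Mapping.lookup P \<mu> *
    (\<Prod>i\<in>Poly_Mapping.keys \<mu>. x i ^ Poly_Mapping.lookup \<mu> i))"
  unfolding multipoly_eval_def
  by (rule sum.mono_neutral_left) (use assms in \<open>auto simp: in_keys_iff\<close>)

lemma multipoly_eval_add: "multipoly_eval (P + Q) x = multipoly_eval P x + multipoly_eval Q x"
proof -
  let ?S = "Poly_Mapping.keys P \<union> Poly_Mapping.keys Q"
  have "Poly_Mapping.keys (P + Q) \<subseteq> ?S" by (rule keys_add)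
  then show ?thesis
    by (subst (1 2 3) multipoly_eval_superset[of ?S])
      (auto simp: lookup_add distrib_right sum.distrib)
qed

lemma homogeneous_fun_imp_multipoly:
  fixes f :: "(nat \<Rightarrow> 'k::comm_ring_1) \<Rightarrow> 'k"
  assumes "homogeneous_fun N n f"
  shows "\<exists>P. homogeneous_multipoly N n P \<and> (\<forall>x. multipoly_eval P x = f x)"
  using assms unfolding homogeneous_fun_def
proof (induction rule: monomial_span.induct)
  case zero
  show ?case
    by (rule exI[of _ 0]) (simp add: homogeneous_multipoly_def multipoly_eval_def)
next
  case (mono e c)
  define \<mu> :: "nat \<Rightarrow>\<^sub>0 nat" where "\<mu> = Abs_poly_mapping (\<lambda>i. if i < N then e i else 0)"
  have lookup: "Poly_Mapping.lookup \<mu> i = (if i < N then e i else 0)" for i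
    unfolding \<mu>_def by (subst lookup_Abs_poly_mapping) (auto intro: finite_subset[of _ "{..<N}"] split: if_splits)
  have keys: "Poly_Mapping.keys \<mu> \<subseteq> {..<N}"
    by (auto simp: in_keys_iff lookup split: if_splits)
  have deg: "(\<Sum>i\<in>Poly_Mapping.keys \<mu>. Poly_Mapping.lookup \<mu> i) = n"
  proof -
    have "(\<Sum>i\<in>Poly_Mapping.keys \<mu>. Poly_Mapping.lookup \<mu> i) = (\<Sum>i<N. Poly_Mapping.lookup \<mu> i)"
      by (rule sum.mono_neutral_left) (use keys in \<open>auto simp: in_keys_iff\<close>)
    also have "\<dots> = n" using mono by (simp add: lookup)
    finally show ?thesis .
  qed
  have "(\<Prod>i\<in>Poly_Mapping.keys \<mu>. x i ^ Poly_Mapping.lookup \<mu> i) = (\<Prod>i<N. x i ^ e i)" for x :: "nat \<Rightarrow> 'k"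
  proof -
    have "(\<Prod>i\<in>Poly_Mapping.keys \<mu>. x i ^ Poly_Mapping.lookup \<mu> i) = (\<Prod>i<N. x i ^ Poly_Mapping.lookup \<mu> i)"
      by (rule prod.mono_neutral_left) (use keys in \<open>auto simp: in_keys_iff\<close>)
    then show ?thesis by (simp add: lookup)
  qed
  then show ?case
    using keys deg
    by (intro exI[of _ "Poly_Mapping.single \<mu> c"])
      (auto simp: homogeneous_multipoly_def multipoly_eval_def)
next
  case (add f g)
  then obtain P Q where P: "homogeneous_multipoly N n P" "\<forall>x. multipoly_eval P x = f x"
    and Q: "homogeneous_multipoly N n Q" "\<forall>x. multipoly_eval Q x = g x"
    by blast
  have "homogeneous_multipoly N n (P + Q)"
    using P(1) Q(1) keys_add[of P Q] unfolding homogeneous_multipoly_def by blast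
  then show ?case
    using P(2) Q(2) by (intro exI[of _ "P + Q"]) (simp add: multipoly_eval_add)
qed

lemma multipoly_imp_homogeneous_fun:
  fixes P :: "'k::comm_ring_1 multipoly"
  assumes "homogeneous_multipoly N n P"
  shows "homogeneous_fun N n (multipoly_eval P)"
  unfolding multipoly_eval_def
proof (intro homogeneous_fun_sum homogeneous_fun_cmult)
  fix \<mu> assume "\<mu> \<in> Poly_Mapping.keys P"
  then have \<mu>: "Poly_Mapping.keys \<mu> \<subseteq> {..<N}" "(\<Sum>i\<in>Poly_Mapping.keys \<mu>. Poly_Mapping.lookup \<mu> i) = n"
    using assms by (auto simp: homogeneous_multipoly_def)
  have "homogeneous_fun N (\<Sum>i\<in>Poly_Mapping.keys \<mu>. 1 * Poly_Mapping.lookup \<mu> i)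
      (\<lambda>x. \<Prod>i\<in>Poly_Mapping.keys \<mu>. x i ^ Poly_Mapping.lookup \<mu> i)"
    by (intro homogeneous_fun_prod homogeneous_fun_power homogeneous_fun_var) (use \<mu> in auto)
  then show "homogeneous_fun N n (\<lambda>x :: nat \<Rightarrow> 'k. \<Prod>i\<in>Poly_Mapping.keys \<mu>. x i ^ Poly_Mapping.lookup \<mu> i)"
    using \<mu>(2) by simp
qed

lemma openin_rat_topology_basic:
  fixes h :: "(nat \<Rightarrow> 'k::{alg_closed_field,field_gcd}) \<Rightarrow> 'k"
  assumes "homogeneous_fun (2 * d + 2) n h"
  shows "openin (rat_topology d) {f \<in> rat_maps d. h (rat_coords d f) \<noteq> 0}"
proof -
  obtain P where P: "homogeneous_multipoly (2 * d + 2) n P" "\<And>x. multipoly_eval P x = h x"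
    using homogeneous_fun_imp_multipoly[OF assms] by blast
  then have "{f \<in> rat_maps d. h (rat_coords d f) \<noteq> 0} \<in>
    {{f \<in> rat_maps d. multipoly_eval P (rat_coords d f) \<noteq> 0} | P n.
        homogeneous_multipoly (2 * d + 2) n P}"
    by (intro CollectI exI[of _ P] exI[of _ n]) simp
  then show ?thesis
    unfolding rat_topology_def openin_topology_generated_by_iff
    by (rule generate_topology_on.Basis)
qed

text \<open>The generating sets already form a base: the product of two homogeneous polynomials
  defines the intersection of their nonvanishing sets.\<close>

lemma openin_rat_topology_imp_basic:
  fixes f :: "'k::{alg_closed_field,field_gcd} poly fract"
  assumes "openin (rat_topology d) U" "f \<in> U"
  shows "\<exists>n h. homogeneous_fun (2 * d + 2) n h \<and> h (rat_coords d f) \<noteq> 0 \<and>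
    (\<forall>g\<in>rat_maps d. h (rat_coords d g) \<noteq> 0 \<longrightarrow> g \<in> U)"
  using assms unfolding rat_topology_def openin_topology_generated_by_iff
proof (induction rule: generate_topology_on.induct)
  case Empty
  then show ?case by simp
next
  case (Int a b)
  from Int.IH(1) Int.prems obtain n h where h: "homogeneous_fun (2 * d + 2) n h"
    "h (rat_coords d f) \<noteq> 0" "\<forall>g\<in>rat_maps d. h (rat_coords d g) \<noteq> 0 \<longrightarrow> g \<in> a" by auto
  from Int.IH(2) Int.prems obtain n' h' where h': "homogeneous_fun (2 * d + 2) n' h'"
    "h' (rat_coords d f) \<noteq> 0" "\<forall>g\<in>rat_maps d. h' (rat_coords d g) \<noteq> 0 \<longrightarrow> g \<in> b" by auto
  show ?case
    using homogeneous_fun_mult[OF h(1) h'(1)] h(2,3) h'(2,3)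
    by (intro exI[of _ "n + n'"] exI[of _ "\<lambda>x. h x * h' x"]) simp
next
  case (UN K)
  then obtain k where k: "k \<in> K" "f \<in> k" by blast
  from UN.IH[OF k] obtain n h where "homogeneous_fun (2 * d + 2) n h"
    "h (rat_coords d f) \<noteq> 0" "\<forall>g\<in>rat_maps d. h (rat_coords d g) \<noteq> 0 \<longrightarrow> g \<in> k"
    by (elim exE conjE)
  with k(1) show ?case
    by (intro exI[of _ n] exI[of _ h]) auto
next
  case (Basis s)
  then obtain P n where "s = {f \<in> rat_maps d. multipoly_eval P (rat_coords d f) \<noteq> 0}"
    "homogeneous_multipoly (2 * d + 2) n P" by blast
  with Basis.prems show ?case
    by (intro exI[of _ n] exI[of _ "multipoly_eval P"])
      (auto intro: multipoly_imp_homogeneous_fun)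
qed

subsection \<open>Conjugation as a homogeneous map of coordinates\<close>

text \<open>Unlike \<open>rat_coords\<close>, this applies to a conjugated pair before it is
  normalised.\<close>

definition pair_coords :: "nat \<Rightarrow> 'k::zero poly \<Rightarrow> 'k poly \<Rightarrow> nat \<Rightarrow> 'k" where
  "pair_coords d P Q i = (if i \<le> d then coeff P i else coeff Q (i - (d + 1)))"

lemma rat_coords_eq: "rat_coords d f = pair_coords d (rat_num f) (rat_den f)"
  by (rule ext) (simp add: rat_coords_def pair_coords_def)

lemma pair_coords_smult:
  "pair_coords d (smult r P) (smult r Q) = (\<lambda>i. r * pair_coords d P Q i)"
  by (rule ext) (simp add: pair_coords_def)

definition coords_num :: "nat \<Rightarrow> (nat \<Rightarrow> 'k::comm_monoid_add) \<Rightarrow> 'k poly" where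
  "coords_num d x = (\<Sum>i\<le>d. monom (x i) i)"

definition coords_den :: "nat \<Rightarrow> (nat \<Rightarrow> 'k::comm_monoid_add) \<Rightarrow> 'k poly" where
  "coords_den d x = (\<Sum>i\<le>d. monom (x (d + 1 + i)) i)"

lemma coeff_coords_num: "coeff (coords_num d x) j = (if j \<le> d then x j else 0)"
  by (simp add: coords_num_def coeff_sum coeff_monom)

lemma coeff_coords_den: "coeff (coords_den d x) j = (if j \<le> d then x (d + 1 + j) else 0)"
  by (simp add: coords_den_def coeff_sum coeff_monom)

lemma coords_num_pair: "degree P \<le> d \<Longrightarrow> coords_num d (pair_coords d P Q) = P"
  by (rule poly_eqI) (auto simp: coeff_coords_num pair_coords_def coeff_eq_0)

lemma coords_den_pair: "degree Q \<le> d \<Longrightarrow> coords_den d (pair_coords d P Q) = Q"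
  by (rule poly_eqI) (auto simp: coeff_coords_den pair_coords_def coeff_eq_0)

definition homogeneous_coeffs ::
    "nat \<Rightarrow> nat \<Rightarrow> ((nat \<Rightarrow> 'k::comm_ring_1) \<Rightarrow> 'k poly) \<Rightarrow> bool" where
  "homogeneous_coeffs N n A \<longleftrightarrow> (\<forall>j. homogeneous_fun N n (\<lambda>x. coeff (A x) j))"

lemma homogeneous_coeffs_num: "homogeneous_coeffs (2 * d + 2) 1 (coords_num d)"
  unfolding homogeneous_coeffs_def coeff_coords_num
  proof
  fix j
  show "homogeneous_fun (2 * d + 2) 1 (\<lambda>x :: nat \<Rightarrow> 'a. if j \<le> d then x j else 0)"
    by (cases "j \<le> d") (auto intro: homogeneous_fun_var[unfolded One_nat_def] homogeneous_fun_zero)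
qed

lemma homogeneous_coeffs_den: "homogeneous_coeffs (2 * d + 2) 1 (coords_den d)"
  unfolding homogeneous_coeffs_def coeff_coords_den
proof
  fix j
  show "homogeneous_fun (2 * d + 2) 1 (\<lambda>x :: nat \<Rightarrow> 'a. if j \<le> d then x (d + 1 + j) else 0)"
    by (cases "j \<le> d") (auto intro: homogeneous_fun_var[unfolded One_nat_def] homogeneous_fun_zero)
qed

lemma homogeneous_coeffs_linear:
  assumes "homogeneous_fun N n f" "homogeneous_fun N n g"
  shows "homogeneous_coeffs N n (\<lambda>x. [:f x, g x:])"
  unfolding homogeneous_coeffs_def
proof
  fix j
  show "homogeneous_fun N n (\<lambda>x. coeff [:f x, g x:] j)"
    using assms homogeneous_fun_zero by (cases j; cases "j - 1") (auto simp: coeff_pCons)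
qed

lemma homogeneous_coeffs_add:
  "homogeneous_coeffs N n A \<Longrightarrow> homogeneous_coeffs N n B \<Longrightarrow> homogeneous_coeffs N n (\<lambda>x. A x + B x)"
  unfolding homogeneous_coeffs_def by (simp add: homogeneous_fun_add)

lemma homogeneous_coeffs_smult:
  "homogeneous_fun N n f \<Longrightarrow> homogeneous_coeffs N n' A \<Longrightarrow>
    homogeneous_coeffs N (n + n') (\<lambda>x. smult (f x) (A x))"
  unfolding homogeneous_coeffs_def by (simp add: homogeneous_fun_mult)

lemma homogeneous_coeffs_mult:
  "homogeneous_coeffs N n A \<Longrightarrow> homogeneous_coeffs N n' B \<Longrightarrow>
    homogeneous_coeffs N (n + n') (\<lambda>x. A x * B x)"
  unfolding homogeneous_coeffs_def coeff_mult
  by (intro allI homogeneous_fun_sum homogeneous_fun_mult) auto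

lemma homogeneous_coeffs_power:
  "homogeneous_coeffs N n A \<Longrightarrow> homogeneous_coeffs N (n * k) (\<lambda>x. A x ^ k)"
proof (induction k)
  case 0
  show ?case
    unfolding homogeneous_coeffs_def using homogeneous_fun_const[where 'a = 'a] by simp
next
  case (Suc k)
  then show ?case
    using homogeneous_coeffs_mult[of N n A "n * k" "\<lambda>x. A x ^ k"] by simp
qed

lemma homogeneous_coeffs_form_subst:
  assumes P: "homogeneous_coeffs N r P" and X: "homogeneous_coeffs N s X" and Y: "homogeneous_coeffs N s Y"
  shows "homogeneous_coeffs N (r + s * n) (\<lambda>x. form_subst n (P x) (X x) (Y x))"
proof -
  have "homogeneous_fun N (r + s * n) (\<lambda>x. coeff (smult (coeff (P x) i) (X x ^ i * Y x ^ (n - i))) j)"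
    if "i \<le> n" for i j
  proof -
    have "homogeneous_coeffs N (r + (s * i + s * (n - i))) (\<lambda>x. smult (coeff (P x) i) (X x ^ i * Y x ^ (n - i)))"
      using P unfolding homogeneous_coeffs_def[of N r P]
      by (intro homogeneous_coeffs_smult homogeneous_coeffs_mult homogeneous_coeffs_power X Y) auto
    moreover have "s * i + s * (n - i) = s * n"
      using that by (simp flip: distrib_left)
    ultimately show ?thesis by (simp add: homogeneous_coeffs_def)
  qed
  then show ?thesis
    unfolding homogeneous_coeffs_def form_subst_def coeff_sum by (auto intro: homogeneous_fun_sum)
qed

text \<open>The matrix may depend on the coordinates: degree \<open>s = 0\<close> is a fixed matrix,
  \<open>s = 1\<close> a matrix read off from the map. The summands of the degree come from the
  outer matrix, the pair and the substitution.\<close>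

lemma homogeneous_coeffs_conj:
  assumes "homogeneous_fun N s a" "homogeneous_fun N s b" "homogeneous_fun N s c" "homogeneous_fun N s e"
    and "homogeneous_coeffs N r P" "homogeneous_coeffs N r Q"
  shows "homogeneous_coeffs N (s + r + s * n) (\<lambda>x. conj_num n (a x) (b x) (c x) (e x) (P x) (Q x))"
    and "homogeneous_coeffs N (s + r + s * n) (\<lambda>x. conj_den n (a x) (b x) (c x) (e x) (P x) (Q x))"
  unfolding conj_num_def conj_den_def
  by (intro homogeneous_coeffs_form_subst homogeneous_coeffs_add homogeneous_coeffs_smult
      homogeneous_coeffs_linear homogeneous_fun_uminus assms)+

text \<open>The set of classes meeting a basic open set is open, because its preimage is the union of the
  translates of that set.\<close>

lemma openin_moduli_topology_classes_meeting:
  fixes h :: "(nat \<Rightarrow> 'k::{alg_closed_field,field_gcd}) \<Rightarrow> 'k"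
  assumes h: "homogeneous_fun (2 * d + 2) n h" and d: "d > 0"
  shows "openin (moduli_topology d) {C \<in> moduli d. \<exists>g\<in>C. h (rat_coords d g) \<noteq> 0}"
proof -
  let ?U = "{C \<in> moduli d. \<exists>g\<in>C. h (rat_coords d g) \<noteq> 0}"
  \<comment> \<open>The pullback of \<open>h\<close> under conjugation by a fixed matrix. It has the
    same degree as \<open>h\<close>, because conjugation is then linear in the coordinates.\<close>
  define T where "T a b c e x =
    h (pair_coords d (conj_num d a b c e (coords_num d x) (coords_den d x))
      (conj_den d a b c e (coords_num d x) (coords_den d x)))" for a b c e x
  have T_hom: "homogeneous_fun (2 * d + 2) n (T a b c e)" for a b c e
  proof -
    have coeffs: "homogeneous_coeffs (2 * d + 2) (0 + 1 + 0 * d)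
        (\<lambda>x. conj_num d a b c e (coords_num d x) (coords_den d x))"
      "homogeneous_coeffs (2 * d + 2) (0 + 1 + 0 * d)
        (\<lambda>x. conj_den d a b c e (coords_num d x) (coords_den d x))"
      by (intro homogeneous_coeffs_conj homogeneous_fun_const homogeneous_coeffs_num
          homogeneous_coeffs_den)+
    have "homogeneous_fun (2 * d + 2) (1 * n) (T a b c e)"
      unfolding T_def
    proof (rule homogeneous_fun_subst[OF h])
      fix i
      show "homogeneous_fun (2 * d + 2) 1 (\<lambda>x. pair_coords d
          (conj_num d a b c e (coords_num d x) (coords_den d x))
          (conj_den d a b c e (coords_num d x) (coords_den d x)) i)"
        using coeffs unfolding homogeneous_coeffs_def pair_coords_def
        by (cases "i \<le> d") auto
    qed
    then show ?thesis by simp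
  qed
  have "{f \<in> rat_maps d. conj_rel d `` {f} \<in> ?U} =
    (\<Union>(a, b, c, e)\<in>{(a, b, c, e). a * e - b * c \<noteq> 0}. {f \<in> rat_maps d. T a b c e (rat_coords d f) \<noteq> 0})"
    (is "?A = ?B")
  proof (intro equalityI subsetI)
    fix f assume "f \<in> ?A"
    then obtain g where f: "f \<in> rat_maps d" and fg: "(f, g) \<in> conj_rel d" and g: "h (rat_coords d g) \<noteq> 0"
      by auto
    note f_props = rat_maps_properties[OF f]
    from fg obtain a b c e r where det: "a * e - b * c \<noteq> 0" and
      r: "rat_num g = smult r (conj_num d a b c e (rat_num f) (rat_den f))"
        "rat_den g = smult r (conj_den d a b c e (rat_num f) (rat_den f))"
      unfolding conj_rel_iff[OF d] by blast
    have "h (rat_coords d g) = r ^ n * T a b c e (rat_coords d f)"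
      unfolding rat_coords_eq T_def r pair_coords_smult homogeneous_fun_scale[OF h]
        coords_num_pair[OF f_props(3)] coords_den_pair[OF f_props(4)] ..
    with g have "T a b c e (rat_coords d f) \<noteq> 0" by auto
    with f det show "f \<in> ?B" by auto
  next
    fix f assume "f \<in> ?B"
    then obtain a b c e where f: "f \<in> rat_maps d" and det: "a * e - b * c \<noteq> 0"
      and T: "T a b c e (rat_coords d f) \<noteq> 0" by auto
    note f_props = rat_maps_properties[OF f]
    obtain g r where fg: "(f, g) \<in> conj_rel d" and r: "r \<noteq> 0"
        "rat_num g = smult r (conj_num d a b c e (rat_num f) (rat_den f))"
        "rat_den g = smult r (conj_den d a b c e (rat_num f) (rat_den f))"
      by (rule conj_exists[OF f d det])
    have "h (rat_coords d g) = r ^ n * T a b c e (rat_coords d f)"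
      unfolding rat_coords_eq T_def r(2,3) pair_coords_smult homogeneous_fun_scale[OF h]
        coords_num_pair[OF f_props(3)] coords_den_pair[OF f_props(4)] ..
    with T r have "h (rat_coords d g) \<noteq> 0" by simp
    with fg f show "f \<in> ?A"
      by (auto simp: moduli_def quotient_def)
  qed
  also have "openin (rat_topology d) \<dots>"
    by (intro openin_Union) (auto intro: openin_rat_topology_basic[OF T_hom])
  finally show ?thesis
    unfolding openin_moduli_topology by blast
qed

section \<open>Additive polynomials\<close>

locale prime_char_field =
  fixes p :: nat and k_type :: "'k::{alg_closed_field,field_gcd} itself"
  assumes prime_p: "prime p" and CHAR_p: "CHAR('k) = p"
begin

lemma p_gt_1: "p > 1"
  using prime_p prime_gt_1_nat by blast

lemma p_pos [simp]: "p > 0"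
  using p_gt_1 by simp

lemma p_neq_0 [simp]: "p \<noteq> 0"
  using p_gt_1 by simp

lemma frobenius_add: "(x + y) ^ (p ^ i) = x ^ (p ^ i) + (y :: 'k) ^ (p ^ i)"
  by (rule freshmans_dream') (use prime_p CHAR_p in auto)

lemma frobenius_add_poly: "(x + y) ^ (p ^ i) = x ^ (p ^ i) + (y :: 'k poly) ^ (p ^ i)"
  by (rule freshmans_dream') (use prime_p CHAR_p in auto)

lemma frobenius_sum: "(\<Sum>s\<in>A. f s) ^ p = (\<Sum>s\<in>A. (f s :: 'k) ^ p)"
  by (rule freshmans_dream_sum) (use prime_p CHAR_p in auto)

lemma frobenius_inj:
  assumes "x ^ p = (y :: 'k) ^ p"
  shows "x = y"
proof -
  have "x ^ p = (x - y) ^ p + y ^ p"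
    using frobenius_add[of "x - y" y 1] by simp
  then have "(x - y) ^ p = 0" using assms by simp
  then show ?thesis by simp
qed

lemma of_nat_eq_0_iff: "of_nat n = (0 :: 'k) \<longleftrightarrow> p dvd n"
  by (simp add: of_nat_eq_0_iff_char_dvd CHAR_p)

text \<open>An additive polynomial has constant derivative \<open>c\<close>, so \<open>f - c z = h\<^sup>p\<close> with \<open>h\<close> again additive.\<close>

lemma additive_poly_exponents:
  fixes f :: "'k poly"
  assumes "additive_poly f" "coeff f n \<noteq> 0"
  shows "\<exists>i. n = p ^ i"
  using assms
proof (induction "degree f" arbitrary: f n rule: less_induct)
  case less
  have add: "poly f (x + y) = poly f x + poly f y" for x y
    using less.prems(1) by (simp add: additive_poly_def)
  have "poly f 0 + 0 = poly f 0 + poly f 0"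
    unfolding add[symmetric] by simp
  then have f0: "coeff f 0 = 0"
    by (simp only: add_left_cancel poly_0_coeff_0)
  have n0: "n > 0" using less.prems(2) f0 by (cases n) auto
  then have deg: "degree f > 0"
    using le_degree[OF less.prems(2)] by simp
  define c where "c = coeff f 1"
  \<comment> \<open>Differentiating f(z + y) = f(z) + f(y) in z shows that the derivative is
    invariant under translation, hence constant.\<close>
  have deriv: "pderiv f = [:c:]"
  proof -
    have "poly (pderiv f) y = c" for y
    proof -
      have "pcompose f [:y, 1:] - (f + [:poly f y:]) = 0"
        by (rule poly_eq_0_if_cofinite_roots[of "{}"]) (auto simp: poly_pcompose add add.commute)
      then have eq: "pcompose f [:y, 1:] = f + [:poly f y:]" by simp
      have "pderiv (pcompose f [:y, 1:]) = pderiv (f + [:poly f y:])"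
        unfolding eq ..
      then have "pcompose (pderiv f) [:y, 1:] = pderiv f"
        by (simp add: pderiv_pcompose pderiv_pCons pderiv_add)
      then have "poly (pcompose (pderiv f) [:y, 1:]) 0 = poly (pderiv f) 0"
        by simp
      then show ?thesis
        by (simp add: poly_pcompose poly_0_coeff_0 coeff_pderiv c_def)
    qed
    then have "pderiv f - [:c:] = 0"
      by (intro poly_eq_0_if_cofinite_roots[of "{}"]) auto
    then show ?thesis by simp
  qed
  have dvd: "p dvd k" if "coeff f k \<noteq> 0" "k \<noteq> 1" for k
  proof (cases "k = 0")
    case False
    with that(2) have k: "k \<ge> 2" by simp
    then have "coeff (pderiv f) (k - 1) = 0"
      by (simp add: deriv coeff_pCons split: nat.split)
    then have "of_nat k * coeff f k = 0"
      using k by (simp add: coeff_pderiv)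
    then show ?thesis using that(1) by (simp add: of_nat_eq_0_iff)
  qed simp
  obtain rt :: "'k \<Rightarrow> 'k" where rt: "\<And>x. rt x ^ p = x"
    using nth_root_exists[of p] p_gt_1 by (metis gr_implies_not0 not_gr_zero)
  \<comment> \<open>Apart from 1, only multiples of p occur as exponents, so p-th roots of the
    coefficients there suffice. Additivity descends from the p-th power to \<open>h\<close> because
    Frobenius is injective.\<close>
  define h where "h = (\<Sum>j\<le>degree f. monom (rt (coeff f (p * j))) j)"
  have coeff_h: "coeff h j = rt (coeff f (p * j))" if "j \<le> degree f" for j
    using that by (simp add: h_def coeff_sum coeff_monom)
  have rt0: "rt 0 = 0" using rt[of 0] p_gt_1 by (metis power_not_zero)
  have coeff_h_nz: "j \<le> degree f \<and> coeff f (p * j) \<noteq> 0" if "coeff h j \<noteq> 0" for j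
    using that rt0 by (auto simp: h_def coeff_sum coeff_monom split: if_splits)
  have decomp: "poly f x = c * x + poly h x ^ p" for x
  proof -
    have "poly h x ^ p = (\<Sum>j\<le>degree f. (rt (coeff f (p * j)) * x ^ j) ^ p)"
      by (simp add: h_def poly_sum poly_monom frobenius_sum)
    also have "\<dots> = (\<Sum>j\<le>degree f. coeff f (p * j) * x ^ (p * j))"
      by (simp add: power_mult_distrib rt mult.commute flip: power_mult)
    also have "\<dots> = (\<Sum>k\<in>(*) p ` {..degree f}. coeff f k * x ^ k)"
      using p_gt_1 by (subst sum.reindex) (auto simp: inj_on_def)
    also have "\<dots> = (\<Sum>k\<in>{..degree f} - {1}. coeff f k * x ^ k)"
    proof (rule sum.mono_neutral_cong)
      fix k assume k: "k \<in> {..degree f} - {1} - (*) p ` {..degree f}"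
      have "\<not> p dvd k"
      proof
        assume "p dvd k"
        then obtain j where j: "k = p * j" by (elim dvdE)
        then have "j \<le> k" using p_gt_1 by simp
        with k have "j \<le> degree f" by simp
        then have "k \<in> (*) p ` {..degree f}" unfolding j by blast
        with k show False by blast
      qed
      moreover have "k \<noteq> 1" using k by simp
      ultimately show "coeff f k * x ^ k = 0" using dvd by auto
    next
      fix k assume k: "k \<in> (*) p ` {..degree f} - ({..degree f} - {1})"
      then have "k \<noteq> 1" using p_gt_1 by auto
      with k have "k > degree f" by auto
      then show "coeff f k * x ^ k = 0" by (simp add: coeff_eq_0)
    qed auto
    finally have "poly h x ^ p = (\<Sum>k\<in>{..degree f} - {1}. coeff f k * x ^ k)" .
    moreover have "poly f x = c * x + (\<Sum>k\<in>{..degree f} - {1}. coeff f k * x ^ k)"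
      unfolding poly_altdef using deg by (subst sum.remove[of _ 1]) (auto simp: c_def)
    ultimately show ?thesis by simp
  qed
  have "additive_poly h"
    unfolding additive_poly_def
  proof (intro allI)
    fix x y
    have pow: "poly h z ^ p = poly f z - c * z" for z
      by (simp only: decomp[of z] add_diff_cancel_left')
    have "poly h (x + y) ^ p = poly h x ^ p + poly h y ^ p"
      unfolding pow add by (simp only: distrib_left add_diff_add)
    then have "poly h (x + y) ^ p = (poly h x + poly h y) ^ p"
      using frobenius_add[of "poly h x" "poly h y" 1] by simp
    then show "poly h (x + y) = poly h x + poly h y"
      by (rule frobenius_inj)
  qed
  moreover have "degree h < degree f"
  proof (cases "h = 0")
    case False
    then have "coeff f (p * degree h) \<noteq> 0"
      using coeff_h_nz[of "degree h"] by simp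
    then have le: "p * degree h \<le> degree f" by (rule le_degree)
    show ?thesis
    proof (cases "degree h = 0")
      case False
      then have "degree h < p * degree h" using p_gt_1 by simp
      then show ?thesis using le by (rule less_le_trans)
    qed (use deg in simp)
  qed (use deg in simp)
  ultimately have IH: "coeff h j \<noteq> 0 \<Longrightarrow> \<exists>i. j = p ^ i" for j
    using less.hyps by blast
  show ?case
  proof (cases "n = 1")
    case True
    then show ?thesis by (intro exI[of _ 0]) simp
  next
    case False
    with dvd[OF less.prems(2)] obtain j where j: "n = p * j"
      by (auto elim: dvdE)
    have "j \<le> n" using j p_gt_1 by simp
    then have "j \<le> degree f" using le_degree[OF less.prems(2)] by simp
    then have "coeff h j ^ p = coeff f n" by (simp add: coeff_h rt j)
    then have "coeff h j \<noteq> 0"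
      using less.prems(2) p_gt_1 by (metis gr_implies_not0 zero_power not_gr_zero)
    then obtain i where "j = p ^ i" using IH by blast
    then show ?thesis using j by (intro exI[of _ "Suc i"]) simp
  qed
qed

end

section \<open>The family of additive separable polynomials\<close>

locale additive_family = prime_char_field p k_type
  for p :: nat and k_type :: "'k::{alg_closed_field,field_gcd} itself" +
  fixes m :: nat
  assumes m_pos: "m > 0"
begin

abbreviation d :: nat where "d \<equiv> p ^ m"

lemma d_gt_1: "d > 1"
  using p_gt_1 m_pos one_less_power by blast

lemma d_pos: "d > 0"
  using d_gt_1 by simp

lemma p_power_le_d: "i \<le> m \<Longrightarrow> p ^ i \<le> d"
  using p_gt_1 by (intro power_increasing) auto

lemma p_power_eq_iff: "p ^ i = p ^ j \<longleftrightarrow> i = j"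
  using p_gt_1 by (simp add: power_inject_exp)

definition ap :: "(nat \<Rightarrow> 'k) \<Rightarrow> 'k poly" where
  "ap a = (\<Sum>i\<le>m. monom (a i) (p ^ i))"

definition L :: "(nat \<Rightarrow> 'k) set" where
  "L = {a. a 0 \<noteq> 0 \<and> a m \<noteq> 0}"

definition cls :: "(nat \<Rightarrow> 'k) \<Rightarrow> 'k poly fract set" where
  "cls a = conj_rel d `` {to_fract (ap a)}"

lemma coeff_ap: "coeff (ap a) k = (\<Sum>i\<le>m. if p ^ i = k then a i else 0)"
  by (simp add: ap_def coeff_sum coeff_monom)

lemma coeff_ap_power: "i \<le> m \<Longrightarrow> coeff (ap a) (p ^ i) = a i"
  by (simp add: coeff_ap p_power_eq_iff)

lemma coeff_ap_other: "(\<And>i. i \<le> m \<Longrightarrow> k \<noteq> p ^ i) \<Longrightarrow> coeff (ap a) k = 0"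
  unfolding coeff_ap by (rule sum.neutral) auto

lemma coeff_ap_1: "coeff (ap a) 1 = a 0"
  using coeff_ap_power[of 0 a] by simp

lemma degree_ap_le: "degree (ap a) \<le> d"
  by (intro degree_le allI impI coeff_ap_other) (use p_power_le_d in fastforce)

lemma degree_ap: "a m \<noteq> 0 \<Longrightarrow> degree (ap a) = d"
  using degree_ap_le le_degree[of "ap a" d] coeff_ap_power[of m a] by (simp add: le_antisym)

lemma rat_num_ap: "rat_num (to_fract (ap a)) = ap a"
  and rat_den_ap: "rat_den (to_fract (ap a)) = 1"
  by (simp_all add: rat_num_def rat_den_def)

lemma ap_in_rat_maps: "a m \<noteq> 0 \<Longrightarrow> to_fract (ap a) \<in> rat_maps d"
  by (simp add: rat_maps_def rat_degree_def rat_num_ap rat_den_ap degree_ap)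

lemma additive_ap: "additive_poly (ap a)"
  by (simp add: additive_poly_def ap_def poly_sum poly_monom frobenius_add algebra_simps sum.distrib)

lemma pderiv_ap: "pderiv (ap a) = [:a 0:]"
proof (rule poly_eqI)
  fix k
  show "coeff (pderiv (ap a)) k = coeff [:a 0:] k"
  proof (cases k)
    case 0
    then show ?thesis using coeff_ap_1 by (simp add: coeff_pderiv)
  next
    case (Suc k')
    have "of_nat (Suc k) * coeff (ap a) (Suc k) = 0"
    proof (cases "\<exists>i\<le>m. Suc k = p ^ i")
      case True
      then obtain i where i: "Suc k = p ^ i" by blast
      then have "i \<noteq> 0" using Suc by (cases i) auto
      then have "p dvd Suc k" unfolding i by simp
      then have "of_nat (Suc k) = (0 :: 'k)" by (simp only: of_nat_eq_0_iff)
      then show ?thesis by simp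
    next
      case False
      then show ?thesis using coeff_ap_other[of "Suc k" a] by auto
    qed
    then show ?thesis using Suc by (simp add: coeff_pderiv)
  qed
qed

lemma separable_ap: "a 0 \<noteq> 0 \<Longrightarrow> separable_poly (ap a)"
  unfolding separable_poly_def pderiv_ap coprime_poly_iff_no_common_root by simp

lemma additive_separable_imp_ap:
  assumes "additive_poly f" "separable_poly f" "degree f = d"
  shows "\<exists>a\<in>L. f = ap a"
proof -
  define a where "a i = coeff f (p ^ i)" for i
  have f: "f = ap a"
  proof (rule poly_eqI)
    fix k
    show "coeff f k = coeff (ap a) k"
    proof (cases "\<exists>i\<le>m. k = p ^ i")
      case True
      then show ?thesis by (auto simp: coeff_ap_power a_def)
    next
      case False
      have "coeff f k = 0"
      proof (rule ccontr)
        assume nz: "coeff f k \<noteq> 0"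
        then obtain i where i: "k = p ^ i"
          using additive_poly_exponents[OF assms(1)] by blast
        with nz have "p ^ i \<le> p ^ m" using le_degree[OF nz] assms(3) by simp
        then have "i \<le> m" using p_gt_1 power_le_imp_le_exp by blast
        with False i show False by blast
      qed
      then show ?thesis using False coeff_ap_other[of k a] by auto
    qed
  qed
  have "a m \<noteq> 0"
    using assms(3) d_gt_1 by (auto simp: a_def simp flip: assms(3))
  moreover have "a 0 \<noteq> 0"
  proof
    assume "a 0 = 0"
    then have "coprime f 0"
      using assms(2) unfolding separable_poly_def f pderiv_ap by simp
    then have "is_unit f" by simp
    then have "degree f = 0" using is_unit_iff_degree[of f] by fastforce
    then show False using assms(3) d_gt_1 by simp
  qed
  ultimately show ?thesis using f by (auto simp: L_def)
qed

lemma equiv_d: "equiv (rat_maps d :: 'k poly fract set) (conj_rel d)"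
  by (rule equiv_conj_rel[OF d_pos])

lemma additive_separable_classes_eq: "additive_separable_classes d = cls ` L"
proof (intro equalityI subsetI)
  fix C :: "'k poly fract set" assume "C \<in> additive_separable_classes d"
  then obtain f where C: "C \<in> moduli d" and f: "additive_poly f" "separable_poly f" "to_fract f \<in> C"
    by (auto simp: additive_separable_classes_def)
  have "C \<subseteq> rat_maps d"
    using C equiv_d in_quotient_imp_subset by (auto simp: moduli_def)
  then have "to_fract f \<in> rat_maps d" using f by blast
  then have "degree f = d"
    by (simp add: rat_maps_def rat_degree_def rat_num_def rat_den_def)
  then obtain a where a: "a \<in> L" "f = ap a"
    using additive_separable_imp_ap f by blast
  from C obtain g where g: "C = conj_rel d `` {g}"
    unfolding moduli_def by (rule quotientE)
  then have "(g, to_fract (ap a)) \<in> conj_rel d" using f(3) a(2) by simp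
  then have "C = cls a"
    unfolding cls_def g by (rule equiv_class_eq[OF equiv_d])
  then show "C \<in> cls ` L" using a by blast
next
  fix C assume "C \<in> cls ` L"
  then obtain a where a: "a \<in> L" "C = cls a" by blast
  have "to_fract (ap a) \<in> rat_maps d" using ap_in_rat_maps a by (simp add: L_def)
  then have "C \<in> moduli d" "to_fract (ap a) \<in> C"
    unfolding a(2) cls_def moduli_def
    using equiv_class_self[OF equiv_d] by (auto intro: quotientI)
  then show "C \<in> additive_separable_classes d"
    using additive_ap separable_ap a(1) unfolding additive_separable_classes_def L_def by blast
qed

section \<open>The ramified fixed point and straightening\<close>

lemma form_subst_ap:
  "form_subst d (ap a) X Y = (\<Sum>j\<le>m. smult (a j) (X ^ (p ^ j) * Y ^ (d - p ^ j)))"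
proof -
  have sum: "form_subst d (\<Sum>j\<in>A. f j) X Y = (\<Sum>j\<in>A. form_subst d (f j) X Y)" for f :: "nat \<Rightarrow> 'k poly" and A
    by (induction A rule: infinite_finite_induct) (auto simp: form_subst_add, auto simp: form_subst_def)
  have monom: "form_subst d (monom c k) X Y = smult c (X ^ k * Y ^ (d - k))" if "k \<le> d" for c :: 'k and k
  proof -
    have "form_subst d (monom c k) X Y = (\<Sum>i\<le>d. if i = k then smult c (X ^ k * Y ^ (d - k)) else 0)"
      unfolding form_subst_def by (intro sum.cong refl) auto
    then show ?thesis using that by simp
  qed
  show ?thesis
    unfolding ap_def sum by (intro sum.cong refl monom) (use p_power_le_d in auto)
qed

lemma form_subst_1: "form_subst d 1 X Y = (Y :: 'k poly) ^ d"
proof -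
  have "form_subst d 1 X Y = (\<Sum>i\<le>d. if i = 0 then Y ^ d else 0)"
    unfolding form_subst_def by (intro sum.cong refl) auto
  then show ?thesis by simp
qed

lemma form_subst_const: "form_subst d [:c:] X Y = smult c ((Y :: 'k poly) ^ d)"
  using form_subst_smult[of d c 1 X Y] by (simp add: form_subst_1)

lemma pderiv_power_dvd: "p dvd k \<Longrightarrow> pderiv ((Y :: 'k poly) ^ k) = 0"
  by (simp add: pderiv_power of_nat_eq_0_iff)

text \<open>The coefficients of \<open>z\<close> are the derivatives at \<open>0\<close>; all terms but one are polynomials in \<open>z\<^sup>p\<close>.\<close>

lemma coeff_1_form_subst_ap:
  fixes a :: "nat \<Rightarrow> 'k"
  shows "coeff (form_subst d (ap a) [:-\<beta>, \<delta>:] [:\<alpha>, -\<gamma>:]) 1 = a 0 * (\<alpha> * \<delta> - \<beta> * \<gamma>) * \<alpha> ^ (d - 2)"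
proof -
  let ?X = "[:-\<beta>, \<delta>:]" and ?Y = "[:\<alpha>, -\<gamma>:]"
  have term_0: "pderiv (?X ^ (p ^ j) * ?Y ^ (d - p ^ j)) = 0" if "j \<le> m" "j > 0" for j
  proof -
    have "p dvd p ^ j" using that(2) by simp
    moreover have "p dvd d" using m_pos by simp
    ultimately have "p dvd p ^ j" "p dvd d - p ^ j" by (auto intro: dvd_diff_nat)
    then show ?thesis by (simp add: pderiv_mult pderiv_power_dvd)
  qed
  \<comment> \<open>The exponent d - 1 is \<open>Suc e\<close>. As p divides \<open>d\<close>, it
    equals -1 in the field, and this sign is what produces the determinant in the derivative of
    \<open>?X * ?Y ^ (d - 1)\<close>.\<close>
  obtain e where e: "d = Suc (Suc e)"
    using d_gt_1 by (metis One_nat_def less_natE add_Suc_right plus_1_eq_Suc Suc_lessE)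
  have "of_nat (Suc (Suc e)) = (0 :: 'k)"
    using m_pos by (simp only: of_nat_eq_0_iff flip: e) simp
  then have neg: "of_nat (Suc e) = (-1 :: 'k)"
    by (simp add: eq_neg_iff_add_eq_0 add.commute)
  have pderiv_sum: "pderiv (\<Sum>j\<in>A. f j) = (\<Sum>j\<in>A. pderiv (f j))" for f :: "nat \<Rightarrow> 'k poly" and A
    by (induction A rule: infinite_finite_induct) (simp_all add: pderiv_add)
  have "coeff (form_subst d (ap a) ?X ?Y) 1 = poly (pderiv (form_subst d (ap a) ?X ?Y)) 0"
    by (simp add: poly_0_coeff_0 coeff_pderiv)
  also have "\<dots> = (\<Sum>j\<le>m. a j * poly (pderiv (?X ^ (p ^ j) * ?Y ^ (d - p ^ j))) 0)"
    unfolding form_subst_ap pderiv_sum by (simp add: poly_sum pderiv_smult)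
  also have "\<dots> = (\<Sum>j\<le>m. if j = 0 then a 0 * poly (pderiv (?X * ?Y ^ (d - 1))) 0 else 0)"
    by (intro sum.cong refl) (auto simp: term_0)
  also have "\<dots> = a 0 * poly (pderiv (?X * ?Y ^ (d - 1))) 0"
    by simp
  also have "poly (pderiv (?X * ?Y ^ (d - 1))) 0 = (\<alpha> * \<delta> - \<beta> * \<gamma>) * \<alpha> ^ (d - 2)"
  proof -
    have "pderiv (?Y ^ Suc e) = smult (- 1) (?Y ^ e) * [:-\<gamma>:]"
      unfolding pderiv_power_Suc neg by (simp add: pderiv_pCons)
    then have "poly (pderiv (?X * ?Y ^ Suc e)) 0 = - \<beta> * (\<alpha> ^ e * \<gamma>) + \<alpha> ^ Suc e * \<delta>"
      unfolding pderiv_mult by (simp add: pderiv_pCons poly_power del: power_Suc)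
    then show ?thesis
      unfolding e by (simp add: algebra_simps)
  qed
  finally show ?thesis by (simp add: mult.assoc)
qed

lemma coeff_1_power_d: "coeff ((Y :: 'k poly) ^ d) 1 = 0"
proof -
  have "coeff (Y ^ d) 1 = poly (pderiv (Y ^ d)) 0"
    by (simp add: poly_0_coeff_0 coeff_pderiv)
  then show ?thesis using m_pos by (simp add: pderiv_power_dvd)
qed

text \<open>By Frobenius a translation changes only the constant term, so the coefficients at
  \<open>p ^ i\<close> do not depend on \<open>B\<close>. Dividing by the constant denominator
  \<open>D * A ^ d\<close> leaves the scaling by \<open>D / A\<close>.\<close>

lemma conj_upper_triangular:
  fixes a :: "nat \<Rightarrow> 'k"
  assumes "A \<noteq> 0" "D \<noteq> 0"
  shows "coeff (conj_den d A B 0 D (ap a) 1) 0 = D * A ^ d"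
    and "i \<le> m \<Longrightarrow> coeff (conj_num d A B 0 D (ap a) 1) (p ^ i) = D * A ^ d * ((D / A) ^ (p ^ i - 1) * a i)"
proof -
  have Y: "[:A:] ^ k = [:A ^ k:]" for k
    by (simp add: poly_const_pow)
  show "coeff (conj_den d A B 0 D (ap a) 1) 0 = D * A ^ d"
    by (simp add: conj_den_def form_subst_const Y)
  assume i: "i \<le> m"
  have X: "coeff ([:- B, D:] ^ (p ^ j)) (p ^ i) = (if j = i then D ^ (p ^ i) else 0)" for j
  proof -
    have "[:- B, D:] = [:- B:] + monom D 1" by (simp add: monom_altdef)
    then have "[:- B, D:] ^ (p ^ j) = [:(- B) ^ (p ^ j):] + monom (D ^ (p ^ j)) (p ^ j)"
      by (simp add: frobenius_add_poly monom_power poly_const_pow)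
    moreover have "p ^ i \<noteq> 0" using p_gt_1 by simp
    ultimately show ?thesis
      by (auto simp: coeff_monom p_power_eq_iff coeff_pCons split: nat.split)
  qed
  have const: "coeff [:x:] (p ^ i) = 0" for x :: 'k
    using p_gt_1 by (simp add: coeff_pCons split: nat.split)
  have "coeff (conj_num d A B 0 D (ap a) 1) (p ^ i) =
      A * (\<Sum>j\<le>m. a j * (coeff ([:- B, D:] ^ (p ^ j)) (p ^ i) * A ^ (d - p ^ j)))
        + B * 0"
    by (simp add: conj_num_def form_subst_add form_subst_smult form_subst_ap form_subst_const Y coeff_sum
        const mult_ac)
  also have "(\<Sum>j\<le>m. a j * (coeff ([:- B, D:] ^ (p ^ j)) (p ^ i) * A ^ (d - p ^ j))) =
      (\<Sum>j\<le>m. if j = i then a i * (D ^ (p ^ i) * A ^ (d - p ^ i)) else 0)"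
    by (intro sum.cong refl) (simp add: X)
  also have "\<dots> = a i * (D ^ (p ^ i) * A ^ (d - p ^ i))"
    using i by simp
  also have "A * (a i * (D ^ (p ^ i) * A ^ (d - p ^ i))) + B * 0 =
      D * A ^ d * ((D / A) ^ (p ^ i - 1) * a i)"
  proof -
    obtain k where k: "p ^ i = Suc k" using p_gt_1 by (metis gr0_implies_Suc zero_less_power zero_less_one order.strict_trans)
    have "d = k + Suc (d - p ^ i)" using p_power_le_d[OF i] k by simp
    then have "A ^ d = A ^ k * (A * A ^ (d - p ^ i))"
      by (metis power_Suc power_add)
    then show ?thesis using assms by (simp add: k power_divide)
  qed
  finally show "coeff (conj_num d A B 0 D (ap a) 1) (p ^ i) = D * A ^ d * ((D / A) ^ (p ^ i - 1) * a i)" .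
qed

text \<open>If \<open>g = P/Q\<close> is conjugate to an additive separable polynomial, the totally ramified fixed point
  of \<open>g\<close> is \<open>u / v\<close>, where \<open>u\<close> and \<open>v\<close> are the coefficients of \<open>z\<close> in \<open>P\<close> and \<open>Q\<close>. The matrix
  \<open>(u, 0; -v, u)\<close> moves it to \<open>\<infinity>\<close>.\<close>

definition straight_num :: "'k poly \<Rightarrow> 'k poly \<Rightarrow> 'k poly" where
  "straight_num P Q = conj_num d (coeff P 1) 0 (- coeff Q 1) (coeff P 1) P Q"

definition straight_den :: "'k poly \<Rightarrow> 'k poly \<Rightarrow> 'k poly" where
  "straight_den P Q = conj_den d (coeff P 1) 0 (- coeff Q 1) (coeff P 1) P Q"

text \<open>The matrix formed from the coefficients of z is \<open>w\<close> times (\<alpha>, 0;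
  -\<gamma>, \<alpha>). Its product with the unknown conjugating matrix is upper triangular, so only
  an affine change of variable remains, with scaling factor \<open>D / A\<close>.\<close>

lemma straighten_conjugate:
  assumes a: "a \<in> L" and g: "g \<in> cls a" and u: "coeff (rat_num g) 1 \<noteq> 0"
  shows "coeff (straight_den (rat_num g) (rat_den g)) 0 \<noteq> 0 \<and>
    (\<exists>c. c \<noteq> 0 \<and> (\<forall>i\<le>m. coeff (straight_num (rat_num g) (rat_den g)) (p ^ i) =
      coeff (straight_den (rat_num g) (rat_den g)) 0 * (c ^ (p ^ i - 1) * a i)))"
proof -
  have "(to_fract (ap a), g) \<in> conj_rel d" using g by (simp add: cls_def)
  then obtain \<alpha> \<beta> \<gamma> \<delta> r where det: "\<alpha> * \<delta> - \<beta> * \<gamma> \<noteq> 0" and r: "r \<noteq> 0"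
    and num: "rat_num g = smult r (conj_num d \<alpha> \<beta> \<gamma> \<delta> (ap a) 1)"
    and den: "rat_den g = smult r (conj_den d \<alpha> \<beta> \<gamma> \<delta> (ap a) 1)"
    using conj_rel_iff[OF d_pos, of "to_fract (ap a)" g] unfolding rat_num_ap rat_den_ap by blast
  \<comment> \<open>The common factor of the two coefficients of z, which are
    \<open>\<alpha> * w\<close> and \<open>\<gamma> * w\<close>; their ratio is the image of
    infinity.\<close>
  define w where "w = r * (a 0 * (\<alpha> * \<delta> - \<beta> * \<gamma>) * \<alpha> ^ (d - 2))"
  have num1: "coeff (rat_num g) 1 = \<alpha> * w"
    unfolding num conj_num_def form_subst_add form_subst_smult form_subst_1 coeff_smult coeff_add
      coeff_1_form_subst_ap coeff_1_power_d w_def by (simp add: mult_ac)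
  have den1: "coeff (rat_den g) 1 = \<gamma> * w"
    unfolding den conj_den_def form_subst_add form_subst_smult form_subst_1 coeff_smult coeff_add
      coeff_1_form_subst_ap coeff_1_power_d w_def by (simp add: mult_ac)
  have \<alpha>: "\<alpha> \<noteq> 0" and w: "w \<noteq> 0" using u num1 by auto
  define A B D where "A = \<alpha> * w * \<alpha>" and "B = \<alpha> * w * \<beta>" and "D = w * (\<alpha> * \<delta> - \<beta> * \<gamma>)"
  have nz: "A \<noteq> 0" "D \<noteq> 0" using \<alpha> w det by (simp_all add: A_def D_def)
  have det': "(\<alpha> * w) * (\<alpha> * w) - 0 * (- (\<gamma> * w)) \<noteq> 0" using \<alpha> w by simp
  have coeffs: "\<alpha> * w * \<alpha> + 0 * \<gamma> = A" "\<alpha> * w * \<beta> + 0 * \<delta> = B"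
    "- (\<gamma> * w) * \<alpha> + \<alpha> * w * \<gamma> = 0" "- (\<gamma> * w) * \<beta> + \<alpha> * w * \<delta> = D"
    by (simp_all add: A_def B_def D_def algebra_simps)
  have S: "straight_num (rat_num g) (rat_den g) = smult r (conj_num d A B 0 D (ap a) 1)"
    "straight_den (rat_num g) (rat_den g) = smult r (conj_den d A B 0 D (ap a) 1)"
    unfolding straight_num_def straight_den_def num1 den1
    unfolding num den conj_num_smult conj_den_smult conj_compose[OF det'] coeffs by simp_all
  have "D / A \<noteq> 0" using nz by simp
  moreover have "\<forall>i\<le>m. coeff (straight_num (rat_num g) (rat_den g)) (p ^ i) =
      coeff (straight_den (rat_num g) (rat_den g)) 0 * ((D / A) ^ (p ^ i - 1) * a i)"
    by (simp add: S conj_upper_triangular[OF nz])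
  moreover have "coeff (straight_den (rat_num g) (rat_den g)) 0 \<noteq> 0"
    using nz r by (simp add: S conj_upper_triangular[OF nz])
  ultimately show ?thesis by blast
qed

text \<open>Here u = \<open>b 0\<close> and v = 0, so the straightening matrix is scalar and
  multiplies the pair by \<open>b 0 ^ Suc d\<close>.\<close>

lemma straight_ap:
  assumes "b \<in> L"
  shows "coeff (straight_den (ap b) 1) 0 = b 0 ^ Suc d"
    and "i \<le> m \<Longrightarrow> coeff (straight_num (ap b) 1) (p ^ i) = b 0 ^ Suc d * b i"
proof -
  have c: "coeff (ap b) 1 = b 0" "coeff (1 :: 'k poly) 1 = 0"
    using coeff_ap_1 by simp_all
  have S: "straight_num (ap b) 1 = smult (b 0 ^ Suc d) (ap b)"
    "straight_den (ap b) 1 = smult (b 0 ^ Suc d) 1"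
    unfolding straight_num_def straight_den_def c minus_zero
    by (rule conj_scalar; simp add: degree_ap_le)+
  show "coeff (straight_den (ap b) 1) 0 = b 0 ^ Suc d"
    unfolding S by simp
  show "coeff (straight_num (ap b) 1) (p ^ i) = b 0 ^ Suc d * b i" if "i \<le> m"
    unfolding S using that by (simp add: coeff_ap_power)
qed

lemma cls_self: "a \<in> L \<Longrightarrow> to_fract (ap a) \<in> cls a"
  unfolding cls_def using equiv_class_self[OF equiv_d] ap_in_rat_maps by (simp add: L_def)

lemma cls_eq_if_mem: "a \<in> L \<Longrightarrow> to_fract (ap b) \<in> cls a \<Longrightarrow> cls a = cls b"
  unfolding cls_def using equiv_class_eq[OF equiv_d] by simp

text \<open>Straightening \<open>ap b\<close> is computed twice, directly and as a conjugate of
  \<open>ap a\<close>; comparing coefficients leaves a scaling as the only freedom.\<close>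

lemma cls_eq_iff:
  assumes a: "a \<in> L" and b: "b \<in> L"
  shows "cls a = cls b \<longleftrightarrow> (\<exists>c. c \<noteq> 0 \<and> (\<forall>i\<le>m. b i = c ^ (p ^ i - 1) * a i))"
proof
  assume "cls a = cls b"
  then have g: "to_fract (ap b) \<in> cls a" using cls_self[OF b] by simp
  have b0: "b 0 \<noteq> 0" using b by (simp add: L_def)
  then have "coeff (rat_num (to_fract (ap b))) 1 \<noteq> 0"
    unfolding rat_num_ap coeff_ap_1 .
  from straighten_conjugate[OF a g this] obtain c where c: "c \<noteq> 0"
    "\<forall>i\<le>m. coeff (straight_num (ap b) 1) (p ^ i) =
      coeff (straight_den (ap b) 1) 0 * (c ^ (p ^ i - 1) * a i)"
    unfolding rat_num_ap rat_den_ap by blast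
  have "b i = c ^ (p ^ i - 1) * a i" if i: "i \<le> m" for i
    using c(2)[rule_format, OF i] b0 unfolding straight_ap[OF b] straight_ap(2)[OF b i] by simp
  with c(1) show "\<exists>c. c \<noteq> 0 \<and> (\<forall>i\<le>m. b i = c ^ (p ^ i - 1) * a i)" by blast
next
  assume "\<exists>c. c \<noteq> 0 \<and> (\<forall>i\<le>m. b i = c ^ (p ^ i - 1) * a i)"
  then obtain c where c: "c \<noteq> 0" "\<And>i. i \<le> m \<Longrightarrow> b i = c ^ (p ^ i - 1) * a i" by blast
  \<comment> \<open>The conjugating map is z / c: it takes f to f(c z) / c, whose coefficients are
    \<open>c ^ (p ^ i - 1) * a i\<close>.\<close>
  have den: "conj_den d 1 0 0 c (ap a) 1 = [:c:]"
    by (simp add: conj_den_def form_subst_const poly_const_pow)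
  have num: "conj_num d 1 0 0 c (ap a) 1 = smult c (ap b)"
  proof -
    have "conj_num d 1 0 0 c (ap a) 1 = (\<Sum>j\<le>m. smult (a j) ([:0, c:] ^ (p ^ j)))"
      by (simp add: conj_num_def form_subst_ap pCons_one)
    also have "\<dots> = (\<Sum>j\<le>m. smult c (monom (b j) (p ^ j)))"
    proof (intro sum.cong refl)
      fix j assume "j \<in> {..m}"
      obtain k where k: "p ^ j = Suc k" using p_gt_1 by (metis gr0_implies_Suc zero_less_power zero_less_one order.strict_trans)
      have "[:0, c:] = monom c 1" by (simp add: monom_altdef)
      then show "smult (a j) ([:0, c:] ^ (p ^ j)) = smult c (monom (b j) (p ^ j))"
        using c(2)[of j] \<open>j \<in> {..m}\<close> by (simp add: monom_power smult_monom mult_monom k mult_ac)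
    qed
    finally show ?thesis by (simp add: ap_def smult_sum_right)
  qed
  have "(to_fract (ap a), to_fract (ap b)) \<in> conj_rel d"
  proof -
    have "1 * c - 0 * 0 \<noteq> 0" "inverse c \<noteq> 0"
      "ap b = smult (inverse c) (conj_num d 1 0 0 c (ap a) 1)"
      "1 = smult (inverse c) (conj_den d 1 0 0 c (ap a) 1)"
      using c(1) unfolding num den by simp_all
    then show ?thesis
      using conj_rel_iff[OF d_pos, of "to_fract (ap a)" "to_fract (ap b)"] a b ap_in_rat_maps
      unfolding rat_num_ap rat_den_ap L_def by blast
  qed
  then show "cls a = cls b"
    using cls_eq_if_mem[OF a] by (simp add: cls_def)
qed

section \<open>Closed sets of classes\<close>

abbreviation X :: "'k poly fract set topology" where
  "X \<equiv> subtopology (moduli_topology d) (additive_separable_classes d)"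

lemma topspace_X: "topspace X = cls ` L"
  unfolding topspace_subtopology topspace_moduli_topology
  by (auto simp: additive_separable_classes_def simp flip: additive_separable_classes_eq)

text \<open>A basic open neighbourhood of \<open>ap a\<close> gives a polynomial \<open>R\<close> in
  the coefficients which is nonzero at \<open>a\<close> and vanishes over \<open>Z\<close>, though
  it need not be weighted homogeneous. It vanishes on whole torus orbits, hence so does each of its
  weighted components.\<close>

lemma separation:
  assumes Z: "closedin X Z" and a: "a \<in> L" "cls a \<notin> Z"
  shows "\<exists>n P. monomial_span (Suc m) {e. (\<Sum>i<Suc m. e i * (p ^ i - 1)) = n} P \<and> P a \<noteq> 0 \<and>
    (\<forall>b\<in>L. cls b \<in> Z \<longrightarrow> P b = 0)"
proof -
  have "openin X (cls ` L - Z)" using Z by (simp only: closedin_def topspace_X)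
  then obtain U where U: "openin (moduli_topology d) U" "cls ` L - Z = U \<inter> cls ` L"
    unfolding openin_subtopology additive_separable_classes_eq by (elim exE conjE)
  let ?O = "{f \<in> rat_maps d. conj_rel d `` {f} \<in> U}"
  have O: "openin (rat_topology d) ?O"
    using U(1) unfolding openin_moduli_topology by blast
  have mem: "to_fract (ap b) \<in> ?O \<longleftrightarrow> cls b \<notin> Z" if "b \<in> L" for b
  proof -
    have "to_fract (ap b) \<in> rat_maps d"
      using that ap_in_rat_maps by (simp add: L_def)
    then have "to_fract (ap b) \<in> ?O \<longleftrightarrow> cls b \<in> U \<inter> cls ` L"
      using that by (simp add: cls_def)
    then show ?thesis
      using that by (simp add: U(2)[symmetric])
  qed
  have "to_fract (ap a) \<in> ?O" using mem[OF a(1)] a(2) by simp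
  from openin_rat_topology_imp_basic[OF O this] obtain N h where
    h: "homogeneous_fun (2 * d + 2) N h" "h (rat_coords d (to_fract (ap a))) \<noteq> 0"
    "\<forall>g\<in>rat_maps d. h (rat_coords d g) \<noteq> 0 \<longrightarrow> g \<in> ?O"
    by (elim exE conjE)
  define R where "R b = h (rat_coords d (to_fract (ap b)))" for b
  have "poly_fun (Suc m) R"
    unfolding R_def
  proof (rule poly_fun_subst[where s = "\<lambda>b. rat_coords d (to_fract (ap b))"])
    show "poly_fun (2 * d + 2) h"
      using h(1) unfolding homogeneous_fun_def by (rule monomial_span_mono) simp
    fix i
    have "poly_fun (Suc m) (\<lambda>b. coeff (ap b) i)"
      unfolding coeff_ap
    proof (rule monomial_span_sum)
      fix j assume "j \<in> {..m}"
      then show "poly_fun (Suc m) (\<lambda>b. if p ^ j = i then b j else 0 :: 'k)"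
        by (cases "p ^ j = i") (auto intro: poly_fun_var monomial_span.zero)
    qed
    then show "poly_fun (Suc m) (\<lambda>b. rat_coords d (to_fract (ap b)) i)"
      unfolding rat_coords_eq rat_num_ap rat_den_ap pair_coords_def
      by (cases "i \<le> d") (auto intro: poly_fun_const)
  qed
  from poly_fun_weight_decomposition[OF this, of "\<lambda>i. p ^ i - 1"] obtain F n where
    "\<forall>j. monomial_span (Suc m) {e. (\<Sum>i<Suc m. e i * (p ^ i - 1)) = j} (F j)"
    "\<forall>x. R x = (\<Sum>j<n. F j x)"
    by (elim exE conjE)
  note F = this[rule_format]
  have "R a \<noteq> 0" using h(2) by (simp add: R_def)
  \<comment> \<open>The weight depends on \<open>a\<close> alone, so one component serves for all
    classes in \<open>Z\<close>.\<close>
  then obtain j where j: "j < n" "F j a \<noteq> 0"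
    unfolding F(2) by (meson lessThan_iff sum.neutral)
  have "F j b = 0" if b: "b \<in> L" "cls b \<in> Z" for b
  proof -
    \<comment> \<open>\<open>R\<close> along the orbit of \<open>b\<close>, as a polynomial in the
      scaling parameter; its coefficients are the weighted components at \<open>b\<close>.\<close>
    define q where "q = (\<Sum>j<n. monom (F j b) j)"
    have "poly q c = 0" if "c \<notin> {0}" for c
    proof -
      have c: "c \<noteq> 0" using that by simp
      let ?b = "\<lambda>i. c ^ (p ^ i - 1) * b i"
      have b': "?b \<in> L" using b(1) c by (simp add: L_def)
      have "cls b = cls ?b" using cls_eq_iff[OF b(1) b'] c by blast
      then have "to_fract (ap ?b) \<notin> ?O" using mem[OF b'] b(2) by simp
      then have "R ?b = 0"
        using h(3) b' ap_in_rat_maps[of ?b] unfolding R_def L_def by blast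
      then show ?thesis
        unfolding F(2) monomial_span_homogeneous[OF F(1)] q_def
        by (simp add: poly_sum poly_monom mult.commute)
    qed
    then have "q = 0" by (intro poly_eq_0_if_cofinite_roots[of "{0}"]) auto
    then have "coeff q j = 0" by simp
    then show ?thesis using j(1) by (simp add: q_def coeff_sum coeff_monom)
  qed
  then show ?thesis
    using F(1) j(2) by blast
qed

text \<open>The complement must be the trace of an open set of the whole moduli space. This calls
  for a homogeneous function on all rational maps of degree \<open>d\<close> that vanishes on every
  conjugate of \<open>ap a\<close> when \<open>P a = 0\<close>, and not at \<open>ap b\<close> when
  \<open>P b\<close> is nonzero.\<close>

lemma closedin_zeros:
  assumes P: "poly_fun (Suc m) P"
    and inv: "\<And>a c. a \<in> L \<Longrightarrow> c \<noteq> 0 \<Longrightarrow> P a = 0 \<Longrightarrow> P (\<lambda>i. c ^ (p ^ i - 1) * a i) = 0"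
  shows "closedin X (cls ` {a \<in> L. P a = 0})"
proof -
  let ?N = "2 * d + 2"
  let ?r = "1 + 1 + 1 * d"
  \<comment> \<open>The coordinates \<open>x 1\<close> and \<open>x (d + 2)\<close> are u and v,
    since the denominator starts at index \<open>d + 1\<close>.\<close>
  define num :: "(nat \<Rightarrow> 'k) \<Rightarrow> 'k poly" where
    "num x = conj_num d (x 1) 0 (- x (d + 2)) (x 1) (coords_num d x) (coords_den d x)" for x
  define den :: "(nat \<Rightarrow> 'k) \<Rightarrow> 'k poly" where
    "den x = conj_den d (x 1) 0 (- x (d + 2)) (x 1) (coords_num d x) (coords_den d x)" for x
  have hom: "homogeneous_coeffs ?N ?r num" "homogeneous_coeffs ?N ?r den"
    unfolding num_def den_def
    by ((rule homogeneous_coeffs_conj; intro homogeneous_fun_var homogeneous_fun_zero homogeneous_fun_uminus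
        homogeneous_coeffs_num homogeneous_coeffs_den); simp)+
  have num_coords: "num (rat_coords d g) = straight_num (rat_num g) (rat_den g)"
    and den_coords: "den (rat_coords d g) = straight_den (rat_num g) (rat_den g)"
    and coord_1: "rat_coords d g 1 = coeff (rat_num g) 1" if "g \<in> rat_maps d" for g
  proof -
    note props = rat_maps_properties[OF that]
    show c1: "rat_coords d g 1 = coeff (rat_num g) 1"
      using d_gt_1 by (simp add: rat_coords_def)
    have c2: "rat_coords d g (d + 2) = coeff (rat_den g) 1"
      by (simp add: rat_coords_def)
    show "num (rat_coords d g) = straight_num (rat_num g) (rat_den g)"
      "den (rat_coords d g) = straight_den (rat_num g) (rat_den g)"
      unfolding num_def den_def straight_num_def straight_den_def c1 c2
      unfolding rat_coords_eq coords_num_pair[OF props(3)] coords_den_pair[OF props(4)] by simp_all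
  qed
  have "\<exists>M h. homogeneous_fun ?N (?r * M) h \<and> (\<forall>x. coeff (den x) 0 \<noteq> 0 \<longrightarrow>
      h x = coeff (den x) 0 ^ M * P (\<lambda>i. coeff (num x) (p ^ i) / coeff (den x) 0))"
    using hom unfolding homogeneous_coeffs_def by (intro homogenization[OF P]) auto
  then obtain M h where h: "homogeneous_fun ?N (?r * M) h" "\<And>x. coeff (den x) 0 \<noteq> 0 \<Longrightarrow>
      h x = coeff (den x) 0 ^ M * P (\<lambda>i. coeff (num x) (p ^ i) / coeff (den x) 0)"
    by blast
  define R where "R x = x 1 * h x" for x
  have R: "homogeneous_fun ?N (1 + ?r * M) R"
    unfolding R_def by (intro homogeneous_fun_mult homogeneous_fun_var h(1)) simp
  let ?U = "{C \<in> moduli d. \<exists>g\<in>C. R (rat_coords d g) \<noteq> 0}"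
  have U: "openin (moduli_topology d) ?U"
    by (rule openin_moduli_topology_classes_meeting[OF R]) (use d_gt_1 in simp)
  have zero: "R (rat_coords d g) = 0" if a: "a \<in> L" "P a = 0" and g: "g \<in> cls a" for a g
  proof (cases "coeff (rat_num g) 1 = 0")
    case False
    have "g \<in> rat_maps d" using g by (auto simp: cls_def conj_rel_def)
    note coords = num_coords[OF this] den_coords[OF this]
    from straighten_conjugate[OF a(1) g False] obtain c where
      nz: "coeff (den (rat_coords d g)) 0 \<noteq> 0" and c: "c \<noteq> 0"
      "\<forall>i\<le>m. coeff (num (rat_coords d g)) (p ^ i) =
        coeff (den (rat_coords d g)) 0 * (c ^ (p ^ i - 1) * a i)"
      unfolding coords by blast
    have "P (\<lambda>i. coeff (num (rat_coords d g)) (p ^ i) / coeff (den (rat_coords d g)) 0) =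
        P (\<lambda>i. c ^ (p ^ i - 1) * a i)"
      by (rule poly_fun_cong[OF P]) (use nz c(2) in simp)
    also have "\<dots> = 0" by (rule inv[OF a(1) c(1) a(2)])
    finally show ?thesis using h(2)[OF nz] by (simp add: R_def)
  next
    case True
    moreover have "g \<in> rat_maps d" using g by (auto simp: cls_def conj_rel_def)
    ultimately show ?thesis using coord_1 by (simp add: R_def)
  qed
  have nonzero: "R (rat_coords d (to_fract (ap b))) \<noteq> 0" if b: "b \<in> L" "P b \<noteq> 0" for b
  proof -
    let ?x = "rat_coords d (to_fract (ap b))"
    have mem: "to_fract (ap b) \<in> rat_maps d" using b ap_in_rat_maps by (simp add: L_def)
    note coords = num_coords[OF mem, unfolded rat_num_ap rat_den_ap]
      den_coords[OF mem, unfolded rat_num_ap rat_den_ap]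
    have b0: "b 0 \<noteq> 0" using b by (simp add: L_def)
    have nz: "coeff (den ?x) 0 \<noteq> 0"
      unfolding coords straight_ap(1)[OF b(1)] using b0 by simp
    have "P (\<lambda>i. coeff (num ?x) (p ^ i) / coeff (den ?x) 0) = P b"
      by (rule poly_fun_cong[OF P])
        (use b0 in \<open>simp add: coords straight_ap[OF b(1)]\<close>)
    moreover have "?x 1 = b 0"
      unfolding coord_1[OF mem] rat_num_ap coeff_ap_1 ..
    ultimately show ?thesis
      using h(2)[OF nz] nz b0 b(2) by (simp add: R_def)
  qed
  have "topspace X - cls ` {a \<in> L. P a = 0} = ?U \<inter> cls ` L"
  proof (intro equalityI subsetI)
    fix C assume "C \<in> topspace X - cls ` {a \<in> L. P a = 0}"
    then obtain b where b: "b \<in> L" "C = cls b" "P b \<noteq> 0"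
      unfolding topspace_X by blast
    moreover have "cls b \<in> moduli d"
      using b(1) unfolding additive_separable_classes_eq[symmetric] image_eqI
      by (metis (no_types, lifting) additive_separable_classes_def additive_separable_classes_eq image_eqI mem_Collect_eq)
    ultimately show "C \<in> ?U \<inter> cls ` L"
      using nonzero cls_self by blast
  next
    fix C assume "C \<in> ?U \<inter> cls ` L"
    then show "C \<in> topspace X - cls ` {a \<in> L. P a = 0}"
      unfolding topspace_X using zero by blast
  qed
  then have "openin X (topspace X - cls ` {a \<in> L. P a = 0})"
    unfolding openin_subtopology using U additive_separable_classes_eq by auto
  then show ?thesis
    unfolding closedin_def topspace_X by blast
qed

text \<open>The weight of \<open>a 0\<close> is \<open>p ^ 0 - 1 = 0\<close>: it is the constant
  derivative, hence the multiplier at every finite fixed point, and conjugation does not change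
  it.\<close>

sublocale weighted_quotient X cls m "\<lambda>i. p ^ i - 1" L
proof
  show "p ^ m - 1 > 0" using d_gt_1 by simp
qed (fact L_def m_pos topspace_X cls_eq_iff separation closedin_zeros | simp)+

end

text \<open>An algebraically closed field of characteristic p, all of whose elements are algebraic
  over the prime field, is an algebraic closure of the field with p elements.\<close>

theorem theorem1p3:
  fixes p m :: nat
  assumes "prime p"
    and "m \<ge> 1"
    and "CHAR('k::{alg_closed_field,field_gcd}) = p"
    and "\<And>x::'k. algebraic_over_prime_field x"
  shows "krull_dim (subtopology (moduli_topology (p ^ m))
           (additive_separable_classes (p ^ m) :: 'k poly fract set set)) = enat m"
proof -
  interpret additive_family p "TYPE('k)" m
    by standard (use assms in auto)
  show ?thesis by (rule krull_dim_eq)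
qed

end
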